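(* Let $(\widetilde M^{4n},Q,\widetilde g)$ be a para-quaternionic Kähler manifold with $\nu\neq0$. Then every non-degenerate almost para-quaternionic submanifold $M^{4m}$ of $\widetilde M^{4n}$ is a totally geodesic para-quaternionic Kähler submanifold (that is, $M$ is totally geodesic and $(M,Q|_{TM},\widetilde g|_M)$ is a para-quaternionic Kähler manifold).
   Context: An almost para-quaternionic structure on $\widetilde M$ is a rank 3 subbundle $Q\subset \mathrm{End}\,T\widetilde M$ locally generated by three anticommuting fields of endomorphisms $J_1,J_2,J_3=J_1J_2$ with $J_\alpha^2=\epsilon_\alpha Id$, where $(\epsilon_1,\epsilon_2,\epsilon_3)$ is a permutation of $(-1,1,1)$. A para-quaternionic Kähler manifold $(\widetilde M^{4n},Q,\widetilde g)$ is a pseudo-Riemannian manifold (of dimension $4n$, neutral signature) with such a $Q$ consisting of $\widetilde g$-skew-symmetric endomorphisms and preserved by the Levi-Civita connection; in dimension 4 ($n=1$) one requires in addition that the curvature tensor decomposes as $\widetilde R=\nu R_0+W$, with $R_0(X,Y)=\frac12\sum_\alpha\epsilon_\alpha\widetilde g(J_\alpha X,Y)J_\alpha+\frac14(X\wedge Y-\sum_\alpha\epsilon_\alpha J_\alpha X\wedge J_\alpha Y)$, $(X\wedge Y)Z=\widetilde g(Y,Z)X-\widetilde g(X,Z)Y$, and $W$ a trace-free $Q$-invariant algebraic curvature tensor ($Q$ acting by derivations). $\nu=scal/(4n(n+2))$ is the reduced scalar curvature. A submanifold $M$ of $(\widetilde M,Q)$ is an almost para-quaternionic submanifold if its tangent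 bundle is $Q$-invariant. It is non-degenerate if $\widetilde g$ is non-degenerate on each $T_xM$. *)

theory Defs
  imports "HOL-Analysis.Analysis"
begin

section \<open>Smooth maps between Euclidean spaces\<close>

text \<open>On an open set of a Euclidean space this is the usual class of k times continuously
  differentiable maps: \<open>f\<close> is differentiable and every directional derivative is of class
  \<open>k - 1\<close>.\<close>

primrec Ck_on :: "nat \<Rightarrow> 'e::euclidean_space set \<Rightarrow> ('e \<Rightarrow> 'b::real_normed_vector) \<Rightarrow> bool" where
  "Ck_on 0 S f \<longleftrightarrow> continuous_on S f"
| "Ck_on (Suc k) S f \<longleftrightarrow> (\<forall>x\<in>S. f differentiable (at x)) \<and>
     (\<forall>v. Ck_on k S (\<lambda>x. frechet_derivative f (at x) v))"

definition smooth_on :: "'e::euclidean_space set \<Rightarrow> ('e \<Rightarrow> 'b::real_normed_vector) \<Rightarrow> bool" where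
  "smooth_on S f \<longleftrightarrow> (\<forall>k. Ck_on k S f)"


section \<open>Smooth manifolds\<close>

text \<open>A chart is a pair of its domain and its coordinate map; the values of the coordinate map
  outside the domain are irrelevant.\<close>

type_synonym ('a, 'e) chart = "'a set \<times> ('a \<Rightarrow> 'e)"

definition coords :: "('a, 'e) chart \<Rightarrow> 'e set" where
  "coords c = snd c ` fst c"

definition chart_inv :: "('a, 'e) chart \<Rightarrow> 'e \<Rightarrow> 'a" where
  "chart_inv c = inv_into (fst c) (snd c)"

text \<open>The two charts below may belong to different manifolds, modelled on different spaces, with
  common points. So \<open>transition c d\<close> is a change of coordinates if both charts belong to the same
  manifold, and the coordinate expression of the inclusion if \<open>c\<close> is a chart of a submanifold
  and \<open>d\<close> a chart of the ambient manifold. Likewise \<open>jac c d p\<close> is the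
  Jacobian at the point \<open>p\<close> of the change of coordinates, respectively of the inclusion.\<close>

definition transition :: "('a, 'f) chart \<Rightarrow> ('a, 'e) chart \<Rightarrow> 'f \<Rightarrow> 'e" where
  "transition c d = (\<lambda>z. snd d (chart_inv c z))"

definition overlap :: "('a, 'f) chart \<Rightarrow> ('a, 'e) chart \<Rightarrow> 'f set" where
  "overlap c d = snd c ` (fst c \<inter> fst d)"

definition jac :: "('a, 'f::euclidean_space) chart \<Rightarrow> ('a, 'e::euclidean_space) chart \<Rightarrow> 'a
    \<Rightarrow> 'f \<Rightarrow> 'e" where
  "jac c d p = frechet_derivative (transition c d) (at (snd c p))"

definition smooth_manifold :: "'a topology \<Rightarrow> ('a, 'e::euclidean_space) chart set \<Rightarrow> bool" where
  "smooth_manifold T A \<longleftrightarrow>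
     Hausdorff_space T \<and> second_countable T \<and> topspace T = (\<Union>c\<in>A. fst c) \<and>
     (\<forall>c\<in>A. openin T (fst c) \<and> open (coords c) \<and>
        homeomorphic_map (subtopology T (fst c)) (top_of_set (coords c)) (snd c)) \<and>
     (\<forall>c\<in>A. \<forall>d\<in>A. smooth_on (overlap c d) (transition c d))"

text \<open>An immersed submanifold is a subset with its own topology and smooth structure for which
  the inclusion is a smooth immersion; embedded submanifolds are the case where \<open>S\<close> is the
  subspace topology.\<close>

definition immersed_submanifold :: "'a topology \<Rightarrow> ('a, 'f::euclidean_space) chart set
    \<Rightarrow> 'a topology \<Rightarrow> ('a, 'e::euclidean_space) chart set \<Rightarrow> bool" where
  "immersed_submanifold S B T A \<longleftrightarrow>
     smooth_manifold S B \<and> topspace S \<subseteq> topspace T \<and> continuous_map S T id \<and>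
     (\<forall>c\<in>B. \<forall>d\<in>A. smooth_on (overlap c d) (transition c d) \<and>
        (\<forall>p\<in>fst c \<inter> fst d. inj (jac c d p)))"

text \<open>The tangent space at \<open>p\<close> of a submanifold with chart \<open>c\<close>, as a subspace of the ambient
  tangent space expressed in the chart \<open>d\<close>.\<close>

definition tangent_space :: "('a, 'f::euclidean_space) chart \<Rightarrow> ('a, 'e::euclidean_space) chart
    \<Rightarrow> 'a \<Rightarrow> 'e set" where
  "tangent_space c d p = range (jac c d p)"


section \<open>Pseudo-Riemannian geometry in coordinates\<close>

text \<open>Throughout, \<open>G z u v\<close> is the value at the coordinate point \<open>z\<close> of a metric on the vectors
  with components \<open>u\<close> and \<open>v\<close>.

  The Levi-Civita connection, by its difference from the flat connection of the coordinates: the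
  symmetric (torsion-free) bilinear map that makes the metric parallel.\<close>

definition christoffel :: "('e::euclidean_space \<Rightarrow> 'e \<Rightarrow> 'e \<Rightarrow> real) \<Rightarrow> 'e \<Rightarrow> 'e \<Rightarrow> 'e \<Rightarrow> 'e" where
  "christoffel G z = (THE \<Gamma>. bilinear \<Gamma> \<and> (\<forall>u v. \<Gamma> u v = \<Gamma> v u) \<and>
     (\<forall>u v w. frechet_derivative (\<lambda>y. G y v w) (at z) u = G z (\<Gamma> u v) w + G z v (\<Gamma> u w)))"

definition cov_deriv :: "('e::euclidean_space \<Rightarrow> 'e \<Rightarrow> 'e \<Rightarrow> real) \<Rightarrow> 'e \<Rightarrow> ('e \<Rightarrow> 'e) \<Rightarrow> 'e \<Rightarrow> 'e" where
  "cov_deriv G u Y z = frechet_derivative Y (at z) u + christoffel G z u (Y z)"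

definition cov_deriv_endo :: "('e::euclidean_space \<Rightarrow> 'e \<Rightarrow> 'e \<Rightarrow> real) \<Rightarrow> 'e
    \<Rightarrow> ('e \<Rightarrow> 'e \<Rightarrow> 'e) \<Rightarrow> 'e \<Rightarrow> 'e \<Rightarrow> 'e" where
  "cov_deriv_endo G u E z w = cov_deriv G u (\<lambda>y. E y w) z - E z (cov_deriv G u (\<lambda>_. w) z)"

text \<open>The vectors are extended to constant (so commuting) coordinate fields, hence no bracket
  term.\<close>

definition curvature :: "('e::euclidean_space \<Rightarrow> 'e \<Rightarrow> 'e \<Rightarrow> real) \<Rightarrow> 'e \<Rightarrow> 'e \<Rightarrow> 'e \<Rightarrow> 'e \<Rightarrow> 'e" where
  "curvature G z u v w =
     cov_deriv G u (cov_deriv G v (\<lambda>_. w)) z - cov_deriv G v (cov_deriv G u (\<lambda>_. w)) z"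

definition lin_trace :: "('e::euclidean_space \<Rightarrow> 'e) \<Rightarrow> real" where
  "lin_trace f = (\<Sum>b\<in>Basis. f b \<bullet> b)"

definition ricci_contraction :: "('e::euclidean_space \<Rightarrow> 'e \<Rightarrow> 'e \<Rightarrow> 'e) \<Rightarrow> 'e \<Rightarrow> 'e \<Rightarrow> real" where
  "ricci_contraction R v w = lin_trace (\<lambda>u. R u v w)"

definition scal :: "('e::euclidean_space \<Rightarrow> 'e \<Rightarrow> 'e \<Rightarrow> real) \<Rightarrow> 'e \<Rightarrow> real" where
  "scal G z = lin_trace (THE L. linear L \<and>
     (\<forall>v w. G z (L v) w = ricci_contraction (curvature G z) v w))"

text \<open>The reduced scalar curvature in dimension \<open>4 n\<close>.\<close>

definition reduced_scal :: "('e::euclidean_space \<Rightarrow> 'e \<Rightarrow> 'e \<Rightarrow> real) \<Rightarrow> 'e \<Rightarrow> real" where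
  "reduced_scal G z = (let n = real DIM('e) / 4 in scal G z / (4 * n * (n + 2)))"

definition algebraic_curvature_tensor :: "('e::euclidean_space \<Rightarrow> 'e \<Rightarrow> real)
    \<Rightarrow> ('e \<Rightarrow> 'e \<Rightarrow> 'e \<Rightarrow> 'e) \<Rightarrow> bool" where
  "algebraic_curvature_tensor h W \<longleftrightarrow>
     (\<forall>w. bilinear (\<lambda>u v. W u v w)) \<and> (\<forall>u v. linear (W u v)) \<and>
     (\<forall>u v w. W u v w = - W v u w) \<and>
     (\<forall>u v w x. h (W u v w) x = - h w (W u v x)) \<and>
     (\<forall>u v w. W u v w + W v w u + W w u v = 0)"


section \<open>Tensor fields on manifolds\<close>

text \<open>A metric, and a field of sets of endomorphisms, are given by their coordinate expressions in
  all charts of the atlas, related by the usual transformation rules. The point argument is a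
  coordinate point of the chart.\<close>

type_synonym ('a, 'e) metric = "('a, 'e) chart \<Rightarrow> 'e \<Rightarrow> 'e \<Rightarrow> 'e \<Rightarrow> real"
type_synonym ('a, 'e) endo_field = "('a, 'e) chart \<Rightarrow> 'e \<Rightarrow> ('e \<Rightarrow> 'e) set"

definition pseudo_riemannian_metric ::
    "('a, 'e::euclidean_space) chart set \<Rightarrow> ('a, 'e) metric \<Rightarrow> bool" where
  "pseudo_riemannian_metric A g \<longleftrightarrow>
     (\<forall>c\<in>A. \<forall>d\<in>A. \<forall>p\<in>fst c \<inter> fst d. \<forall>u v.
        g c (snd c p) u v = g d (snd d p) (jac c d p u) (jac c d p v)) \<and>
     (\<forall>c\<in>A. (\<forall>z\<in>coords c. bilinear (g c z) \<and> (\<forall>u v. g c z u v = g c z v u) \<and>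
                (\<forall>u. (\<forall>v. g c z u v = 0) \<longrightarrow> u = 0)) \<and>
             (\<forall>u v. smooth_on (coords c) (\<lambda>z. g c z u v)))"

definition neutral_form :: "('e::euclidean_space \<Rightarrow> 'e \<Rightarrow> real) \<Rightarrow> bool" where
  "neutral_form h \<longleftrightarrow> (\<exists>P N. subspace P \<and> subspace N \<and> dim P = dim N \<and>
     (\<forall>v. \<exists>x\<in>P. \<exists>y\<in>N. v = x + y) \<and> (\<forall>x\<in>P. \<forall>y\<in>N. h x y = 0) \<and>
     (\<forall>x\<in>P. x \<noteq> 0 \<longrightarrow> h x x > 0) \<and> (\<forall>y\<in>N. y \<noteq> 0 \<longrightarrow> h y y < 0))"

definition neutral_metric :: "('a, 'e::euclidean_space) chart set \<Rightarrow> ('a, 'e) metric \<Rightarrow> bool" where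
  "neutral_metric A g \<longleftrightarrow> (\<forall>c\<in>A. \<forall>z\<in>coords c. neutral_form (g c z))"


section \<open>Para-quaternionic structures\<close>

text \<open>The indices 1, 2, 3 are the only ones used.\<close>

definition pq_basis :: "(nat \<Rightarrow> real) \<Rightarrow> (nat \<Rightarrow> 'e::euclidean_space \<Rightarrow> 'e) \<Rightarrow> bool" where
  "pq_basis \<epsilon> J \<longleftrightarrow>
     (\<epsilon> 1, \<epsilon> 2, \<epsilon> 3) \<in> {(-1, 1, 1), (1, -1, 1), (1, 1, -1)} \<and>
     (\<forall>\<alpha>\<in>{1, 2, 3}. linear (J \<alpha>) \<and> (\<forall>v. J \<alpha> (J \<alpha> v) = \<epsilon> \<alpha> *\<^sub>R v)) \<and>
     (\<forall>\<alpha>\<in>{1, 2, 3}. \<forall>\<beta>\<in>{1, 2, 3}. \<alpha> \<noteq> \<beta> \<longrightarrow> (\<forall>v. J \<alpha> (J \<beta> v) = - J \<beta> (J \<alpha> v))) \<and>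
     (\<forall>v. J 3 v = J 1 (J 2 v))"

definition endo_span :: "(nat \<Rightarrow> 'e::euclidean_space \<Rightarrow> 'e) \<Rightarrow> ('e \<Rightarrow> 'e) set" where
  "endo_span J = {(\<lambda>v. \<Sum>\<alpha>\<in>{1, 2, 3}. a \<alpha> *\<^sub>R J \<alpha> v) | a :: nat \<Rightarrow> real. True}"

text \<open>The rank is 3 automatically, as anticommuting \<open>J 1\<close>, \<open>J 2\<close>, \<open>J 3\<close> with nonzero scalar squares
  are linearly independent.\<close>

definition almost_pq_structure ::
    "('a, 'e::euclidean_space) chart set \<Rightarrow> ('a, 'e) endo_field \<Rightarrow> bool" where
  "almost_pq_structure A Q \<longleftrightarrow>
     (\<forall>c\<in>A. \<forall>d\<in>A. \<forall>p\<in>fst c \<inter> fst d.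
        Q d (snd d p) = (\<lambda>E. jac c d p \<circ> E \<circ> jac d c p) ` Q c (snd c p)) \<and>
     (\<forall>c\<in>A. \<forall>z\<in>coords c. \<exists>U \<epsilon> J. open U \<and> z \<in> U \<and> U \<subseteq> coords c \<and>
        (\<forall>\<alpha>\<in>{1, 2, 3}. \<forall>v. smooth_on U (\<lambda>y. J y \<alpha> v)) \<and>
        (\<forall>y\<in>U. pq_basis \<epsilon> (J y) \<and> Q c y = endo_span (J y)))"

definition skew_structure ::
    "('a, 'e::euclidean_space) chart set \<Rightarrow> ('a, 'e) metric \<Rightarrow> ('a, 'e) endo_field \<Rightarrow> bool" where
  "skew_structure A g Q \<longleftrightarrow>
     (\<forall>c\<in>A. \<forall>z\<in>coords c. \<forall>E\<in>Q c z. \<forall>u v. g c z (E u) v = - g c z u (E v))"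

text \<open>The covariant derivatives of all local smooth sections of \<open>Q\<close> are again in \<open>Q\<close>.\<close>

definition parallel_structure ::
    "('a, 'e::euclidean_space) chart set \<Rightarrow> ('a, 'e) metric \<Rightarrow> ('a, 'e) endo_field \<Rightarrow> bool" where
  "parallel_structure A g Q \<longleftrightarrow>
     (\<forall>c\<in>A. \<forall>U E. open U \<longrightarrow> U \<subseteq> coords c \<longrightarrow> (\<forall>w. smooth_on U (\<lambda>y. E y w)) \<longrightarrow>
        (\<forall>y\<in>U. E y \<in> Q c y) \<longrightarrow> (\<forall>z\<in>U. \<forall>u. cov_deriv_endo (g c) u E z \<in> Q c z))"

definition wedge :: "('e::euclidean_space \<Rightarrow> 'e \<Rightarrow> real) \<Rightarrow> 'e \<Rightarrow> 'e \<Rightarrow> 'e \<Rightarrow> 'e" where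
  "wedge h X Y Z = h Y Z *\<^sub>R X - h X Z *\<^sub>R Y"

definition R0 :: "('e::euclidean_space \<Rightarrow> 'e \<Rightarrow> real) \<Rightarrow> (nat \<Rightarrow> real) \<Rightarrow> (nat \<Rightarrow> 'e \<Rightarrow> 'e)
    \<Rightarrow> 'e \<Rightarrow> 'e \<Rightarrow> 'e \<Rightarrow> 'e" where
  "R0 h \<epsilon> J X Y Z =
     (1/2) *\<^sub>R (\<Sum>\<alpha>\<in>{1, 2, 3}. (\<epsilon> \<alpha> * h (J \<alpha> X) Y) *\<^sub>R J \<alpha> Z) +
     (1/4) *\<^sub>R (wedge h X Y Z - (\<Sum>\<alpha>\<in>{1, 2, 3}. \<epsilon> \<alpha> *\<^sub>R wedge h (J \<alpha> X) (J \<alpha> Y) Z))"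

text \<open>\<open>E\<close> acts on \<open>W\<close> as a derivation of the tensor algebra.\<close>

definition invariant_tensor ::
    "('e::euclidean_space \<Rightarrow> 'e) set \<Rightarrow> ('e \<Rightarrow> 'e \<Rightarrow> 'e \<Rightarrow> 'e) \<Rightarrow> bool" where
  "invariant_tensor K W \<longleftrightarrow>
     (\<forall>E\<in>K. \<forall>u v w. E (W u v w) - W (E u) v w - W u (E v) w - W u v (E w) = 0)"

text \<open>\<open>R0\<close> does not depend on the choice of the adapted basis of \<open>Q\<close>, so it is immaterial
  that the condition is imposed for all of them.\<close>

definition pq_curvature_decomposition ::
    "('a, 'e::euclidean_space) chart set \<Rightarrow> ('a, 'e) metric \<Rightarrow> ('a, 'e) endo_field \<Rightarrow> bool" where
  "pq_curvature_decomposition A g Q \<longleftrightarrow>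
     (\<forall>c\<in>A. \<forall>z\<in>coords c. \<forall>\<epsilon> J. pq_basis \<epsilon> J \<and> Q c z = endo_span J \<longrightarrow>
        (\<exists>W. algebraic_curvature_tensor (g c z) W \<and>
             (\<forall>v w. ricci_contraction W v w = 0) \<and> invariant_tensor (Q c z) W \<and>
             (\<forall>X Y Z. curvature (g c) z X Y Z =
                reduced_scal (g c) z *\<^sub>R R0 (g c z) \<epsilon> J X Y Z + W X Y Z)))"

definition pq_kaehler_manifold :: "'a topology \<Rightarrow> ('a, 'e::euclidean_space) chart set
    \<Rightarrow> ('a, 'e) metric \<Rightarrow> ('a, 'e) endo_field \<Rightarrow> bool" where
  "pq_kaehler_manifold T A g Q \<longleftrightarrow>
     smooth_manifold T A \<and> 4 dvd DIM('e) \<and>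
     pseudo_riemannian_metric A g \<and> neutral_metric A g \<and>
     almost_pq_structure A Q \<and> skew_structure A g Q \<and> parallel_structure A g Q \<and>
     (DIM('e) = 4 \<longrightarrow> pq_curvature_decomposition A g Q)"


section \<open>Submanifolds\<close>

definition almost_pq_submanifold :: "'a topology \<Rightarrow> ('a, 'f::euclidean_space) chart set
    \<Rightarrow> 'a topology \<Rightarrow> ('a, 'e::euclidean_space) chart set \<Rightarrow> ('a, 'e) endo_field \<Rightarrow> bool" where
  "almost_pq_submanifold S B T A Q \<longleftrightarrow>
     immersed_submanifold S B T A \<and>
     (\<forall>c\<in>B. \<forall>d\<in>A. \<forall>p\<in>fst c \<inter> fst d. \<forall>E\<in>Q d (snd d p).
        E ` tangent_space c d p \<subseteq> tangent_space c d p)"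

definition nondegenerate_submanifold :: "('a, 'f::euclidean_space) chart set
    \<Rightarrow> ('a, 'e::euclidean_space) chart set \<Rightarrow> ('a, 'e) metric \<Rightarrow> bool" where
  "nondegenerate_submanifold B A g \<longleftrightarrow>
     (\<forall>c\<in>B. \<forall>d\<in>A. \<forall>p\<in>fst c \<inter> fst d. \<forall>t\<in>tangent_space c d p.
        (\<forall>s\<in>tangent_space c d p. g d (snd d p) t s = 0) \<longrightarrow> t = 0)"

text \<open>The ambient covariant derivative of the coordinate field \<open>v\<close> of the chart \<open>c\<close> in the direction
  \<open>u\<close>, at the point \<open>p\<close> of the submanifold, expressed in the ambient chart \<open>d\<close>.\<close>

definition ambient_deriv :: "('a, 'e::euclidean_space) metric \<Rightarrow> ('a, 'f::euclidean_space) chart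
    \<Rightarrow> ('a, 'e) chart \<Rightarrow> 'a \<Rightarrow> 'f \<Rightarrow> 'f \<Rightarrow> 'e" where
  "ambient_deriv g c d p u v =
     frechet_derivative (\<lambda>y. frechet_derivative (transition c d) (at y) v) (at (snd c p)) u +
     christoffel (g d) (snd d p) (jac c d p u) (jac c d p v)"

text \<open>Its normal component; well defined on a non-degenerate submanifold.\<close>

definition second_fundamental_form :: "('a, 'e::euclidean_space) metric
    \<Rightarrow> ('a, 'f::euclidean_space) chart \<Rightarrow> ('a, 'e) chart \<Rightarrow> 'a \<Rightarrow> 'f \<Rightarrow> 'f \<Rightarrow> 'e" where
  "second_fundamental_form g c d p u v =
     (THE N. (\<forall>t\<in>tangent_space c d p. g d (snd d p) N t = 0) \<and>
             ambient_deriv g c d p u v - N \<in> tangent_space c d p)"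

definition totally_geodesic :: "('a, 'f::euclidean_space) chart set
    \<Rightarrow> ('a, 'e::euclidean_space) chart set \<Rightarrow> ('a, 'e) metric \<Rightarrow> bool" where
  "totally_geodesic B A g \<longleftrightarrow>
     (\<forall>c\<in>B. \<forall>d\<in>A. \<forall>p\<in>fst c \<inter> fst d. \<forall>u v. second_fundamental_form g c d p u v = 0)"

text \<open>The induced metric and the restriction of \<open>Q\<close> to the tangent bundle, in the charts of the
  submanifold. They do not depend on the ambient chart used to compute them.\<close>

definition chart_at :: "('a, 'e) chart set \<Rightarrow> 'a \<Rightarrow> ('a, 'e) chart" where
  "chart_at A p = (SOME d. d \<in> A \<and> p \<in> fst d)"

definition induced_metric :: "('a, 'e::euclidean_space) chart set \<Rightarrow> ('a, 'e) metric
    \<Rightarrow> ('a, 'f::euclidean_space) metric" where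
  "induced_metric A g c z u v =
     (let p = chart_inv c z; d = chart_at A p in g d (snd d p) (jac c d p u) (jac c d p v))"

definition induced_structure :: "('a, 'e::euclidean_space) chart set \<Rightarrow> ('a, 'e) endo_field
    \<Rightarrow> ('a, 'f::euclidean_space) endo_field" where
  "induced_structure A Q c z =
     (let p = chart_inv c z; d = chart_at A p in
        {F. \<exists>E\<in>Q d (snd d p). \<forall>u. jac c d p (F u) = E (jac c d p u)})"

end

theory Submission
  imports Defs
begin

text \<open>The submanifold is totally geodesic because its second fundamental form \<open>h\<close> is bilinear over
  the para-quaternions. Indeed \<open>Q\<close> is parallel and preserves the tangent spaces, so differentiating
  \<open>J Y\<close> for a tangent field \<open>Y\<close> gives \<open>h (X, J Y) = J h (X, Y)\<close> up to tangent vectors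
  (\<open>amb_JM\<close>), and \<open>h\<close> is symmetric. Then \<open>h (J\<^sub>1 X, J\<^sub>2 Y)\<close> is both \<open>J\<^sub>1 J\<^sub>2 h (X, Y)\<close> and
  \<open>J\<^sub>2 J\<^sub>1 h (X, Y)\<close>, and as \<open>J\<^sub>1\<close> and \<open>J\<^sub>2\<close> anticommute, \<open>h = 0\<close> (\<open>amb_tangent\<close>).

  It follows that the Levi-Civita connection of the induced metric is the restriction of the ambient
  one (\<open>christoffel_tangential\<close>), and so is the curvature (\<open>gauss_equation\<close>). Hence the
  restriction of \<open>Q\<close> is parallel (\<open>M_parallel\<close>). The induced metric is neutral because some
  element of \<open>Q\<close> is an involution that reverses the sign of the metric.

  What remains is the curvature condition on a four-dimensional submanifold. If the ambient dimension
  is four, the condition is carried over by the differential of the inclusion. Otherwise there is a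
  non-zero normal vector. Parallelism of \<open>Q\<close> says that the commutators of the curvature operators
  with \<open>Q\<close> are in \<open>Q\<close> (\<open>curvature_commutator_in_span\<close>), and the action of the tangential curvature
  on normal vectors forces these commutators to be a multiple of those of \<open>R0\<close>
  (\<open>mixed_curvature\<close>). So the difference to that multiple of \<open>R0\<close> commutes with \<open>Q\<close>; a curvature
  tensor with this property is \<open>Q\<close>-invariant and Ricci-flat (\<open>curvature_decomposition\<close>), and the
  factor is then the reduced scalar curvature (\<open>reduced_scal_eq\<close>).

  All this is local, and is carried out for a pair of charts with an adapted basis of \<open>Q\<close> (locale
  \<open>pq_submanifold_patch\<close>).\<close>

section \<open>Calculus of smooth maps\<close>

abbreviation D :: "('e::euclidean_space \<Rightarrow> 'b::real_normed_vector) \<Rightarrow> 'e \<Rightarrow> 'e \<Rightarrow> 'b" where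
  "D f x \<equiv> frechet_derivative f (at x)"

lemma D_eq: "(f has_derivative f') (at x) \<Longrightarrow> D f x = f'"
  using frechet_derivative_at by metis

lemma D_works: "f differentiable (at x) \<Longrightarrow> (f has_derivative D f x) (at x)"
  by (simp add: frechet_derivative_works)

lemma Ck_on_cong:
  assumes "open S" "\<And>x. x \<in> S \<Longrightarrow> f x = g x" "Ck_on k S f"
  shows "Ck_on k S g"
  using assms(2,3)
proof (induction k arbitrary: f g)
  case 0
  then show ?case by (simp cong: continuous_on_cong)
next
  case (Suc k)
  have fd: "f differentiable (at x)" if "x \<in> S" for x using Suc.prems that by simp
  have gd: "(g has_derivative D f x) (at x)" if "x \<in> S" for x
    by (rule has_derivative_transform_within_open[OF D_works[OF fd[OF that]] assms(1) that Suc.prems(1)])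
  have "Ck_on k S (\<lambda>x. D g x v)" for v
    by (rule Suc.IH[of "\<lambda>x. D f x v"]) (use gd[THEN D_eq] Suc.prems(2) in simp_all)
  then show ?case using gd by (auto intro: differentiableI)
qed

lemma Ck_on_SucI:
  assumes "open S" "\<And>x. x \<in> S \<Longrightarrow> (f has_derivative f' x) (at x)" "\<And>v. Ck_on k S (\<lambda>x. f' x v)"
  shows "Ck_on (Suc k) S f"
proof -
  have "Ck_on k S (\<lambda>x. D f x v)" for v
    by (rule Ck_on_cong[OF assms(1) _ assms(3)[of v]]) (simp add: D_eq[OF assms(2)])
  then show ?thesis using assms(2) by (auto intro: differentiableI)
qed

lemma Ck_on_SucD: "Ck_on (Suc k) S f \<Longrightarrow> Ck_on k S f"
proof (induction k arbitrary: f)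
  case 0
  then show ?case
    by (auto intro!: differentiable_imp_continuous_on simp: differentiable_on_def differentiable_at_withinI)
next
  case (Suc k)
  from Suc.prems have "\<forall>x\<in>S. f differentiable (at x)" "\<forall>v. Ck_on (Suc k) S (\<lambda>x. D f x v)"
    by simp_all
  then show ?case using Suc.IH by simp
qed

lemma Ck_on_subset: "Ck_on k S f \<Longrightarrow> U \<subseteq> S \<Longrightarrow> Ck_on k U f"
  by (induction k arbitrary: f) (auto intro: continuous_on_subset)

lemma Ck_on_local:
  assumes "\<And>x. x \<in> S \<Longrightarrow> \<exists>U. open U \<and> x \<in> U \<and> Ck_on k U f"
  shows "Ck_on k S f"
  using assms
proof (induction k arbitrary: f)
  case 0
  then have "isCont f x" if "x \<in> S" for x
    using that continuous_on_eq_continuous_at by fastforce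
  then show ?case by (simp add: continuous_at_imp_continuous_on)
next
  case (Suc k)
  have "f differentiable (at x)" if "x \<in> S" for x using Suc.prems[OF that] by auto
  moreover have "Ck_on k S (\<lambda>x. D f x v)" for v
    by (rule Suc.IH) (use Suc.prems in fastforce)
  ultimately show ?case by simp
qed

lemma Ck_on_const: "Ck_on k S (\<lambda>x. c)"
  by (induction k arbitrary: c) auto

lemma Ck_on_bounded_linear:
  assumes "open S" "bounded_linear L" "Ck_on k S f"
  shows "Ck_on k S (\<lambda>x. L (f x))"
  using assms(3)
proof (induction k arbitrary: f)
  case 0
  then show ?case using assms(2) by (simp add: bounded_linear.continuous_on)
next
  case (Suc k)
  have "Ck_on k S (\<lambda>x. L (D f x v))" for v using Suc by simp
  moreover have "((\<lambda>x. L (f x)) has_derivative (\<lambda>v. L (D f x v))) (at x)" if "x \<in> S" for x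
    using Suc.prems that bounded_linear.has_derivative[OF assms(2) D_works] by auto
  ultimately show ?case by (rule Ck_on_SucI[OF assms(1), rotated])
qed

lemma Ck_on_add:
  assumes "open S" "Ck_on k S f" "Ck_on k S g"
  shows "Ck_on k S (\<lambda>x. f x + g x)"
  using assms(2,3)
proof (induction k arbitrary: f g)
  case 0
  then show ?case by (simp add: continuous_on_add)
next
  case (Suc k)
  have "Ck_on k S (\<lambda>x. D f x v + D g x v)" for v using Suc by simp
  moreover have "((\<lambda>x. f x + g x) has_derivative (\<lambda>v. D f x v + D g x v)) (at x)" if "x \<in> S" for x
    using Suc.prems that by (auto intro!: has_derivative_add D_works)
  ultimately show ?case by (rule Ck_on_SucI[OF assms(1), rotated])
qed

lemma Ck_on_sum:
  assumes "open S" "\<And>i. i \<in> I \<Longrightarrow> Ck_on k S (f i)"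
  shows "Ck_on k S (\<lambda>x. \<Sum>i\<in>I. f i x)"
  using assms(2) by (induction I rule: infinite_finite_induct) (auto intro: Ck_on_const Ck_on_add[OF assms(1)])

lemma Ck_on_bilinear:
  assumes "open S" "bounded_bilinear b" "Ck_on k S f" "Ck_on k S g"
  shows "Ck_on k S (\<lambda>x. b (f x) (g x))"
  using assms(3,4)
proof (induction k arbitrary: f g)
  case 0
  then show ?case using assms(2) by (simp add: bounded_bilinear.continuous_on)
next
  case (Suc k)
  have f: "Ck_on k S f" and g: "Ck_on k S g" using Suc.prems Ck_on_SucD by blast+
  have "Ck_on k S (\<lambda>x. b (f x) (D g x v) + b (D f x v) (g x))" for v
    by (rule Ck_on_add[OF assms(1)]; rule Suc.IH) (use Suc.prems f g in auto)
  moreover have "((\<lambda>x. b (f x) (g x)) has_derivative (\<lambda>v. b (f x) (D g x v) + b (D f x v) (g x))) (at x)"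
    if "x \<in> S" for x
    using Suc.prems that by (auto intro!: bounded_bilinear.FDERIV[OF assms(2)] D_works)
  ultimately show ?case by (rule Ck_on_SucI[OF assms(1), rotated])
qed

text \<open>The derivative of a composition is expanded in the basis, as a sum of products to which the
  induction hypothesis and the product rule apply.\<close>

lemma Ck_on_compose:
  fixes f :: "'d::euclidean_space \<Rightarrow> 'e::euclidean_space"
  assumes "open S" "open U" "\<And>x. x \<in> S \<Longrightarrow> f x \<in> U" "Ck_on k S f" "Ck_on k U g"
  shows "Ck_on k S (\<lambda>x. g (f x))"
  using assms(4,5)
proof (induction k arbitrary: g)
  case 0
  then show ?case using assms(3) by (auto intro: continuous_on_compose2[of U g S f])
next
  case (Suc k)
  have f: "Ck_on k S f" using Suc.prems Ck_on_SucD by blast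
  have der: "((\<lambda>x. g (f x)) has_derivative (\<lambda>v. \<Sum>b\<in>Basis. (D f x v \<bullet> b) *\<^sub>R D g (f x) b)) (at x)"
    if x: "x \<in> S" for x
  proof -
    have fd: "(f has_derivative D f x) (at x)" and gd: "(g has_derivative D g (f x)) (at (f x))"
      using Suc.prems x assms(3) by (auto intro!: D_works)
    have lin: "linear (D g (f x))" using gd has_derivative_linear by blast
    have "D g (f x) (D f x v) = (\<Sum>b\<in>Basis. (D f x v \<bullet> b) *\<^sub>R D g (f x) b)" for v
      by (subst euclidean_representation[of "D f x v", symmetric])
        (simp add: linear_sum[OF lin] linear_scale[OF lin])
    then show ?thesis using diff_chain_at[OF fd gd] by (simp add: o_def)
  qed
  show ?case
  proof (rule Ck_on_SucI[OF assms(1) der])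
    fix v
    have "Ck_on k S (\<lambda>x. D g (f x) b)" for b by (rule Suc.IH) (use Suc.prems f in auto)
    moreover have "Ck_on k S (\<lambda>x. D f x v \<bullet> b)" for b
      by (rule Ck_on_bounded_linear[OF assms(1) bounded_linear_inner_left]) (use Suc.prems in auto)
    ultimately show "Ck_on k S (\<lambda>x. \<Sum>b\<in>Basis. (D f x v \<bullet> b) *\<^sub>R D g (f x) b)"
      by (intro Ck_on_sum Ck_on_bilinear[OF _ bounded_bilinear_scaleR] assms(1))
  qed
qed

lemma smooth_on_cong:
  "open S \<Longrightarrow> (\<And>x. x \<in> S \<Longrightarrow> f x = g x) \<Longrightarrow> smooth_on S f \<Longrightarrow> smooth_on S g"
  unfolding smooth_on_def using Ck_on_cong by blast

lemma smooth_on_subset: "smooth_on S f \<Longrightarrow> U \<subseteq> S \<Longrightarrow> smooth_on U f"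
  unfolding smooth_on_def using Ck_on_subset by blast

lemma smooth_on_local:
  "(\<And>x. x \<in> S \<Longrightarrow> \<exists>U. open U \<and> x \<in> U \<and> smooth_on U f) \<Longrightarrow> smooth_on S f"
  unfolding smooth_on_def by (intro allI Ck_on_local) blast

lemma smooth_on_bounded_linear:
  "open S \<Longrightarrow> bounded_linear L \<Longrightarrow> smooth_on S f \<Longrightarrow> smooth_on S (\<lambda>x. L (f x))"
  unfolding smooth_on_def using Ck_on_bounded_linear by blast

lemma smooth_on_scaleR_left: "open S \<Longrightarrow> smooth_on S f \<Longrightarrow> smooth_on S (\<lambda>x. f x *\<^sub>R b)"
  by (rule smooth_on_bounded_linear[OF _ bounded_linear_scaleR_left])

lemma smooth_on_add: "open S \<Longrightarrow> smooth_on S f \<Longrightarrow> smooth_on S g \<Longrightarrow> smooth_on S (\<lambda>x. f x + g x)"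
  unfolding smooth_on_def using Ck_on_add by blast

lemma smooth_on_minus: "open S \<Longrightarrow> smooth_on S f \<Longrightarrow> smooth_on S (\<lambda>x. - f x)"
  by (rule smooth_on_bounded_linear[OF _ bounded_linear_minus[OF bounded_linear_ident]])

lemma smooth_on_diff: "open S \<Longrightarrow> smooth_on S f \<Longrightarrow> smooth_on S g \<Longrightarrow> smooth_on S (\<lambda>x. f x - g x)"
  using smooth_on_add[of S f "\<lambda>x. - g x"] smooth_on_minus[of S g] by simp

lemma smooth_on_sum:
  "open S \<Longrightarrow> (\<And>i. i \<in> I \<Longrightarrow> smooth_on S (f i)) \<Longrightarrow> smooth_on S (\<lambda>x. \<Sum>i\<in>I. f i x)"
  unfolding smooth_on_def by (blast intro: Ck_on_sum)

lemma smooth_on_compose: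
  fixes f :: "'d::euclidean_space \<Rightarrow> 'e::euclidean_space"
  shows "open S \<Longrightarrow> open U \<Longrightarrow> (\<And>x. x \<in> S \<Longrightarrow> f x \<in> U) \<Longrightarrow> smooth_on S f \<Longrightarrow> smooth_on U g \<Longrightarrow>
    smooth_on S (\<lambda>x. g (f x))"
  unfolding smooth_on_def using Ck_on_compose by blast

lemma smooth_on_D: "smooth_on S f \<Longrightarrow> smooth_on S (\<lambda>x. D f x v)"
  unfolding smooth_on_def by (metis Ck_on.simps(2))

lemma smooth_on_differentiable: "smooth_on S f \<Longrightarrow> x \<in> S \<Longrightarrow> f differentiable (at x)"
  unfolding smooth_on_def by (metis Ck_on.simps(2))

lemma smooth_on_has_derivative: "smooth_on S f \<Longrightarrow> x \<in> S \<Longrightarrow> (f has_derivative D f x) (at x)"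
  by (rule D_works[OF smooth_on_differentiable])

lemma smooth_on_continuous: "smooth_on S f \<Longrightarrow> continuous_on S f"
  unfolding smooth_on_def by (metis Ck_on.simps(1))

lemma linear_D: "f differentiable (at x) \<Longrightarrow> linear (D f x)"
  using D_works has_derivative_linear by blast

lemma linear_basis_expansion:
  fixes L :: "'e::euclidean_space \<Rightarrow> 'b::real_normed_vector"
  assumes "linear L"
  shows "L v = (\<Sum>b\<in>Basis. (v \<bullet> b) *\<^sub>R L b)"
  by (subst euclidean_representation[of v, symmetric])
    (simp add: linear_sum[OF assms] linear_scale[OF assms])

text \<open>Linear maps that depend on a point are represented as curried functions rather than as elements
  of a normed space, as all tensors of the definitions are. Smoothness for constant arguments then
  extends to arguments that are themselves smooth functions.\<close>

lemma Ck_on_linear_family: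
  fixes Y :: "'d::euclidean_space \<Rightarrow> 'e::euclidean_space"
  assumes "open S" "\<And>x. x \<in> S \<Longrightarrow> linear (B x)" "\<And>v. Ck_on k S (\<lambda>x. B x v)" "Ck_on k S Y"
  shows "Ck_on k S (\<lambda>x. B x (Y x))"
proof (rule Ck_on_cong[OF assms(1)])
  show "Ck_on k S (\<lambda>x. \<Sum>b\<in>Basis. (Y x \<bullet> b) *\<^sub>R B x b)"
    by (intro Ck_on_sum Ck_on_bilinear[OF _ bounded_bilinear_scaleR] assms
      Ck_on_bounded_linear[OF _ bounded_linear_inner_left])
  show "(\<Sum>b\<in>Basis. (Y x \<bullet> b) *\<^sub>R B x b) = B x (Y x)" if "x \<in> S" for x
    using linear_basis_expansion[OF assms(2)[OF that]] by metis
qed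

lemma smooth_on_linear_family:
  fixes Y :: "'d::euclidean_space \<Rightarrow> 'e::euclidean_space"
  assumes "open S" "\<And>x. x \<in> S \<Longrightarrow> linear (B x)" "\<And>v. smooth_on S (\<lambda>x. B x v)" "smooth_on S Y"
  shows "smooth_on S (\<lambda>x. B x (Y x))"
  using assms Ck_on_linear_family[of S B _ Y] unfolding smooth_on_def by blast

lemma smooth_on_bilinear_family:
  fixes Y :: "'d::euclidean_space \<Rightarrow> 'e::euclidean_space" and Z :: "'d \<Rightarrow> 'g::euclidean_space"
  assumes S: "open S" and B: "\<And>x. x \<in> S \<Longrightarrow> bilinear (B x)" "\<And>v w. smooth_on S (\<lambda>x. B x v w)"
    and "smooth_on S Y" "smooth_on S Z"
  shows "smooth_on S (\<lambda>x. B x (Y x) (Z x))"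
proof -
  have "smooth_on S (\<lambda>x. B x v (Z x))" for v
    by (rule smooth_on_linear_family) (use assms in \<open>auto simp: bilinear_def\<close>)
  then show ?thesis
    by (rule smooth_on_linear_family[where B = "\<lambda>x v. B x v (Z x)", rotated 2])
      (use assms in \<open>auto simp: bilinear_def\<close>)
qed

lemma linear_derivative_family:
  assumes S: "open S" "x \<in> S" and B: "\<And>y. y \<in> S \<Longrightarrow> linear (B y)"
    and B': "\<And>v. ((\<lambda>y. B y v) has_derivative (\<lambda>u. B' u v)) (at x)"
  shows "linear (B' u)"
proof (rule linearI)
  fix v w and r :: real
  have "((\<lambda>y. B y v + B y w) has_derivative (\<lambda>u. B' u v + B' u w)) (at x)"
    by (intro has_derivative_add B')
  then have "((\<lambda>y. B y (v + w)) has_derivative (\<lambda>u. B' u v + B' u w)) (at x)"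
    by (rule has_derivative_transform_within_open[OF _ S]) (simp add: linear_add[OF B])
  then show "B' u (v + w) = B' u v + B' u w"
    using has_derivative_unique[OF _ B'] by metis
  have "((\<lambda>y. r *\<^sub>R B y v) has_derivative (\<lambda>u. r *\<^sub>R B' u v)) (at x)"
    by (intro has_derivative_scaleR_right B')
  then have "((\<lambda>y. B y (r *\<^sub>R v)) has_derivative (\<lambda>u. r *\<^sub>R B' u v)) (at x)"
    by (rule has_derivative_transform_within_open[OF _ S]) (simp add: linear_scale[OF B])
  then show "B' u (r *\<^sub>R v) = r *\<^sub>R B' u v"
    using has_derivative_unique[OF _ B'] by metis
qed

lemma linear_D_family:
  assumes "open S" "x \<in> S" "\<And>y. y \<in> S \<Longrightarrow> linear (B y)" "\<And>v. smooth_on S (\<lambda>y. B y v)"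
  shows "linear (\<lambda>v. D (\<lambda>y. B y v) x u)"
  by (rule linear_derivative_family[where B' = "\<lambda>u v. D (\<lambda>y. B y v) x u" and S = S and B = B])
    (use assms in \<open>auto intro: smooth_on_has_derivative\<close>)

lemma has_derivative_linear_family:
  fixes Y :: "'d::euclidean_space \<Rightarrow> 'e::euclidean_space"
  assumes S: "open S" "x \<in> S" and B: "\<And>y. y \<in> S \<Longrightarrow> linear (B y)"
    and B': "\<And>v. ((\<lambda>y. B y v) has_derivative (\<lambda>u. B' u v)) (at x)"
    and Y: "(Y has_derivative Y') (at x)"
  shows "((\<lambda>y. B y (Y y)) has_derivative (\<lambda>u. B' u (Y x) + B x (Y' u))) (at x)"
proof -
  have lin': "linear (B' u)" for u
    by (rule linear_derivative_family[OF S B B'])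
  have "((\<lambda>y. \<Sum>b\<in>Basis. (Y y \<bullet> b) *\<^sub>R B y b) has_derivative
    (\<lambda>u. \<Sum>b\<in>Basis. (Y x \<bullet> b) *\<^sub>R B' u b + (Y' u \<bullet> b) *\<^sub>R B x b)) (at x)"
    by (intro has_derivative_sum has_derivative_scaleR B' has_derivative_inner_left Y)
  then have "((\<lambda>y. \<Sum>b\<in>Basis. (Y y \<bullet> b) *\<^sub>R B y b) has_derivative
    (\<lambda>u. B' u (Y x) + B x (Y' u))) (at x)"
    by (simp add: sum.distrib linear_basis_expansion[OF lin', of _ "Y x"]
      linear_basis_expansion[OF B[OF S(2)], of "Y' _"])
  then show ?thesis
    by (rule has_derivative_transform_within_open[OF _ S]) (metis linear_basis_expansion B)
qed

lemma has_derivative_bilinear_family: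
  fixes Y :: "'d::euclidean_space \<Rightarrow> 'e::euclidean_space" and Z :: "'d \<Rightarrow> 'g::euclidean_space"
  assumes S: "open S" "x \<in> S" and B: "\<And>y. y \<in> S \<Longrightarrow> bilinear (B y)"
    and B': "\<And>v w. ((\<lambda>y. B y v w) has_derivative (\<lambda>u. B' u v w)) (at x)"
    and Y: "(Y has_derivative Y') (at x)" and Z: "(Z has_derivative Z') (at x)"
  shows "((\<lambda>y. B y (Y y) (Z y)) has_derivative
    (\<lambda>u. B' u (Y x) (Z x) + B x (Y x) (Z' u) + B x (Y' u) (Z x))) (at x)"
proof -
  have "((\<lambda>y. B y v (Z y)) has_derivative (\<lambda>u. B' u v (Z x) + B x v (Z' u))) (at x)" for v
    by (rule has_derivative_linear_family[OF S]) (use assms in \<open>auto simp: bilinear_def\<close>)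
  from has_derivative_linear_family[where B = "\<lambda>y v. B y v (Z y)", OF S _ this Y] show ?thesis
    using B by (simp add: bilinear_def add.assoc)
qed

text \<open>Both iterated derivatives are limits of the same second difference quotient.\<close>

lemma D_commute_real:
  fixes f :: "'e::euclidean_space \<Rightarrow> real"
  assumes S: "open S" "x \<in> S" and f: "smooth_on S f"
  shows "D (\<lambda>y. D f y v) x u = D (\<lambda>y. D f y u) x v"
proof (rule ccontr)
  assume neq: "D (\<lambda>y. D f y v) x u \<noteq> D (\<lambda>y. D f y u) x v"
  define e where "e = \<bar>D (\<lambda>y. D f y v) x u - D (\<lambda>y. D f y u) x v\<bar> / 2"
  have e: "e > 0" using neq by (simp add: e_def)
  define \<Delta> where "\<Delta> t u v = f (x + t *\<^sub>R u + t *\<^sub>R v) - f (x + t *\<^sub>R u) - f (x + t *\<^sub>R v) + f x" for t u v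
  have near: "\<exists>\<xi>. norm (\<xi> - x) \<le> t * (norm u + norm v) \<and> \<Delta> t u v = t * t * D (\<lambda>y. D f y u) \<xi> v"
    if t: "t > 0" and ball: "cball x (t * (norm u + norm v)) \<subseteq> S" for t u v
  proof -
    have inS: "x + a *\<^sub>R u + b *\<^sub>R v \<in> S" and nrm: "norm (a *\<^sub>R u + b *\<^sub>R v) \<le> t * (norm u + norm v)"
      if "0 \<le> a" "a \<le> t" "0 \<le> b" "b \<le> t" for a b
    proof -
      have "norm (a *\<^sub>R u + b *\<^sub>R v) \<le> a * norm u + b * norm v"
        using norm_triangle_ineq[of "a *\<^sub>R u" "b *\<^sub>R v"] that by simp
      also have "\<dots> \<le> t * norm u + t * norm v"
        using that by (intro add_mono mult_right_mono) auto
      finally show *: "norm (a *\<^sub>R u + b *\<^sub>R v) \<le> t * (norm u + norm v)" by (simp add: algebra_simps)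
      have "dist x (x + a *\<^sub>R u + b *\<^sub>R v) = norm (a *\<^sub>R u + b *\<^sub>R v)"
        using dist_norm[of "x + (a *\<^sub>R u + b *\<^sub>R v)" x] by (simp add: dist_commute add.assoc)
      then show "x + a *\<^sub>R u + b *\<^sub>R v \<in> S" using ball * by (auto simp: subset_eq)
    qed
    have line: "((\<lambda>s. F (p + s *\<^sub>R w)) has_real_derivative D F (p + s *\<^sub>R w) w) (at s)"
      if "smooth_on S F" "p + s *\<^sub>R w \<in> S" for F p s w
    proof -
      have 1: "((\<lambda>s. p + s *\<^sub>R w) has_derivative (\<lambda>h. h *\<^sub>R w)) (at s)"
        by (auto intro!: derivative_eq_intros)
      have 2: "(F has_derivative D F (p + s *\<^sub>R w)) (at (p + s *\<^sub>R w))"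
        by (rule smooth_on_has_derivative[OF that])
      have "linear (D F (p + s *\<^sub>R w))" using 2 has_derivative_linear by blast
      then show ?thesis using diff_chain_at[OF 1 2]
        by (simp add: has_field_derivative_def o_def linear_scale mult.commute[of _ "D F (p + s *\<^sub>R w) w"])
    qed
    note d1 = line[OF f] and d2 = line[OF smooth_on_D[OF f]]
    have "\<exists>s. s > 0 \<and> s < t \<and> (f ((x + t *\<^sub>R v) + t *\<^sub>R u) - f (x + t *\<^sub>R u)) - (f ((x + t *\<^sub>R v) + 0 *\<^sub>R u) - f (x + 0 *\<^sub>R u))
       = (t - 0) * (D f ((x + t *\<^sub>R v) + s *\<^sub>R u) u - D f (x + s *\<^sub>R u) u)"
    proof (rule MVT2[where f = "\<lambda>s. f ((x + t *\<^sub>R v) + s *\<^sub>R u) - f (x + s *\<^sub>R u)"])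
      fix s assume s: "0 \<le> s" "s \<le> t"
      have "x + t *\<^sub>R v + s *\<^sub>R u \<in> S" "x + s *\<^sub>R u \<in> S"
        using inS[of s t] inS[of s 0] s t by (simp_all add: add_ac)
      then show "((\<lambda>s. f (x + t *\<^sub>R v + s *\<^sub>R u) - f (x + s *\<^sub>R u)) has_real_derivative
          D f (x + t *\<^sub>R v + s *\<^sub>R u) u - D f (x + s *\<^sub>R u) u) (at s)"
        by (intro DERIV_diff d1)
    qed (use t in auto)
    then obtain s where s: "s > 0" "s < t"
      and seq: "\<Delta> t u v = t * (D f ((x + s *\<^sub>R u) + t *\<^sub>R v) u - D f ((x + s *\<^sub>R u) + 0 *\<^sub>R v) u)"
      by (auto simp: \<Delta>_def add_ac algebra_simps)
    have "\<exists>r. r > 0 \<and> r < t \<and> D f ((x + s *\<^sub>R u) + t *\<^sub>R v) u - D f ((x + s *\<^sub>R u) + 0 *\<^sub>R v) u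
       = (t - 0) * D (\<lambda>y. D f y u) ((x + s *\<^sub>R u) + r *\<^sub>R v) v"
      by (rule MVT2[where f = "\<lambda>r. D f ((x + s *\<^sub>R u) + r *\<^sub>R v) u"])
        (use t s inS[of s] in \<open>auto intro!: d2\<close>)
    then obtain r where r: "r > 0" "r < t"
      and req: "\<Delta> t u v = t * (t * D (\<lambda>y. D f y u) (x + s *\<^sub>R u + r *\<^sub>R v) v)"
      using seq by auto
    show ?thesis
      by (rule exI[of _ "x + s *\<^sub>R u + r *\<^sub>R v"]) (use req nrm[of s r] s r in \<open>auto simp: add.assoc\<close>)
  qed
  have cont: "isCont (\<lambda>y. D (\<lambda>y. D f y u) y v) x" for u v
    using smooth_on_continuous[OF smooth_on_D[OF smooth_on_D[OF f]]] S continuous_on_eq_continuous_at by blast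
  obtain d1 where d1: "d1 > 0" "\<And>y. norm (y - x) < d1 \<Longrightarrow> \<bar>D (\<lambda>y. D f y u) y v - D (\<lambda>y. D f y u) x v\<bar> < e"
    using cont[of u v] e unfolding continuous_at_eps_delta dist_norm real_norm_def by metis
  obtain d2 where d2: "d2 > 0" "\<And>y. norm (y - x) < d2 \<Longrightarrow> \<bar>D (\<lambda>y. D f y v) y u - D (\<lambda>y. D f y v) x u\<bar> < e"
    using cont[of v u] e unfolding continuous_at_eps_delta dist_norm real_norm_def by metis
  obtain d3 where d3: "d3 > 0" "cball x d3 \<subseteq> S" using S open_contains_cball by blast
  define n where "n = norm u + norm v + 1"
  have n: "n > 0" by (simp add: n_def add_nonneg_pos)
  define t where "t = min d1 (min d2 d3) / n"
  have t: "t > 0" using d1 d2 d3 n by (simp add: t_def)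
  have tn: "t * (norm u + norm v) < min d1 (min d2 d3)"
  proof -
    have "t * (norm u + norm v) < t * n" using t by (simp add: n_def)
    also have "\<dots> = min d1 (min d2 d3)" using n by (simp add: t_def)
    finally show ?thesis .
  qed
  then have cb: "cball x (t * (norm u + norm v)) \<subseteq> S" using d3 by force
  obtain \<xi> where \<xi>: "norm (\<xi> - x) \<le> t * (norm u + norm v)" "\<Delta> t u v = t * t * D (\<lambda>y. D f y u) \<xi> v"
    using near[OF t cb] by blast
  obtain \<eta> where \<eta>: "norm (\<eta> - x) \<le> t * (norm u + norm v)" "\<Delta> t v u = t * t * D (\<lambda>y. D f y v) \<eta> u"
    using near[OF t, of v u] cb by (auto simp: add.commute)
  have "\<Delta> t u v = \<Delta> t v u" by (simp add: \<Delta>_def add_ac)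
  then have "D (\<lambda>y. D f y u) \<xi> v = D (\<lambda>y. D f y v) \<eta> u" using \<xi>(2) \<eta>(2) t by simp
  moreover have "\<bar>D (\<lambda>y. D f y u) \<xi> v - D (\<lambda>y. D f y u) x v\<bar> < e" using d1(2) \<xi>(1) tn by simp
  moreover have "\<bar>D (\<lambda>y. D f y v) \<eta> u - D (\<lambda>y. D f y v) x u\<bar> < e" using d2(2) \<eta>(1) tn by simp
  ultimately show False unfolding e_def by argo
qed

lemma D_inner:
  assumes "f differentiable (at x)"
  shows "D (\<lambda>y. f y \<bullet> b) x u = D f x u \<bullet> b"
  using D_eq[OF has_derivative_inner_left[OF D_works[OF assms]]] by simp

lemma D_commute:
  fixes f :: "'e::euclidean_space \<Rightarrow> 'b::euclidean_space"
  assumes S: "open S" "x \<in> S" and f: "smooth_on S f"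
  shows "D (\<lambda>y. D f y v) x u = D (\<lambda>y. D f y u) x v"
proof (rule euclidean_eqI)
  fix b :: 'b assume "b \<in> Basis"
  have 1: "D (\<lambda>y. D f y v) x u \<bullet> b = D (\<lambda>y. D (\<lambda>y. f y \<bullet> b) y v) x u" for u v
  proof -
    have "D (\<lambda>y. D f y v) x u \<bullet> b = D (\<lambda>y. D f y v \<bullet> b) x u"
      using D_inner smooth_on_differentiable[OF smooth_on_D[OF f] S(2)] by metis
    also have "\<dots> = D (\<lambda>y. D (\<lambda>y. f y \<bullet> b) y v) x u"
    proof (rule arg_cong[where f = "\<lambda>F. F u"], rule frechet_derivative_transform_within_open[OF _ S])
      show "(\<lambda>y. D f y v \<bullet> b) differentiable at x"
        using has_derivative_inner_left[OF smooth_on_has_derivative[OF smooth_on_D[OF f] S(2)]] differentiableI by blast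
      show "D f y v \<bullet> b = D (\<lambda>y. f y \<bullet> b) y v" if "y \<in> S" for y
        using D_inner[OF smooth_on_differentiable[OF f that]] by metis
    qed
    finally show ?thesis .
  qed
  have "smooth_on S (\<lambda>y. f y \<bullet> b)"
    using smooth_on_bounded_linear[OF S(1) bounded_linear_inner_left f] .
  from D_commute_real[OF S this] show "D (\<lambda>y. D f y v) x u \<bullet> b = D (\<lambda>y. D f y u) x v \<bullet> b"
    unfolding 1 .
qed


text \<open>A factor that vanishes at the point needs only a continuous cofactor there.\<close>

lemma has_derivative_scaleR_zero:
  fixes f :: "'e::real_normed_vector \<Rightarrow> real" and g :: "'e \<Rightarrow> 'b::real_normed_vector"
  assumes f: "(f has_derivative f') (at x)" "f x = 0" and g: "isCont g x"
  shows "((\<lambda>y. f y *\<^sub>R g y) has_derivative (\<lambda>u. f' u *\<^sub>R g x)) (at x)"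
  unfolding has_derivative_iff_norm
proof
  have bl: "bounded_linear f'" using f(1) has_derivative_bounded_linear by blast
  then show "bounded_linear (\<lambda>u. f' u *\<^sub>R g x)" by (rule bounded_linear_scaleR_const)
  obtain K where K: "\<And>u. \<bar>f' u\<bar> \<le> norm u * K" using bounded_linear.bounded[OF bl] by auto
  have lim1: "((\<lambda>y. \<bar>f y - f' (y - x)\<bar> / norm (y - x)) \<longlongrightarrow> 0) (at x)"
    using f by (simp add: has_derivative_iff_norm)
  have g': "(g \<longlongrightarrow> g x) (at x)" using g by (simp add: isCont_def)
  have lim: "((\<lambda>y. \<bar>f y - f' (y - x)\<bar> / norm (y - x) * norm (g y) + K * norm (g y - g x)) \<longlongrightarrow> 0) (at x)"
    by (rule tendsto_eq_intros lim1 g' refl)+ auto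
  show "((\<lambda>y. norm (f y *\<^sub>R g y - f x *\<^sub>R g x - f' (y - x) *\<^sub>R g x) / norm (y - x)) \<longlongrightarrow> 0) (at x)"
  proof (rule Lim_null_comparison[OF _ lim], rule eventually_at_filter[THEN iffD2], rule always_eventually, intro allI impI)
    fix y assume "y \<noteq> x"
    then have n: "norm (y - x) > 0" by simp
    have "f y *\<^sub>R g y - f x *\<^sub>R g x - f' (y - x) *\<^sub>R g x
      = (f y - f' (y - x)) *\<^sub>R g y + f' (y - x) *\<^sub>R (g y - g x)" by (simp add: f(2) algebra_simps)
    then have "norm (f y *\<^sub>R g y - f x *\<^sub>R g x - f' (y - x) *\<^sub>R g x)
      \<le> \<bar>f y - f' (y - x)\<bar> * norm (g y) + \<bar>f' (y - x)\<bar> * norm (g y - g x)"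
      by (metis norm_scaleR norm_triangle_ineq)
    also have "\<dots> \<le> \<bar>f y - f' (y - x)\<bar> * norm (g y) + (norm (y - x) * K) * norm (g y - g x)"
      by (intro add_left_mono mult_right_mono K) simp
    finally show "norm (norm (f y *\<^sub>R g y - f x *\<^sub>R g x - f' (y - x) *\<^sub>R g x) / norm (y - x))
      \<le> \<bar>f y - f' (y - x)\<bar> / norm (y - x) * norm (g y) + K * norm (g y - g x)"
      using n by (simp add: field_simps)
  qed
qed

text \<open>Near \<open>x\<close> the maps \<open>L y\<close> are bounded below uniformly, so their inverses are continuous; the identity
  \<open>L\<^sub>y\<inverse> v = L\<^sub>x\<inverse> v - L\<^sub>y\<inverse> (L\<^sub>y L\<^sub>x\<inverse> v - v)\<close> then gives the derivative, whose formula
  reduces each order of differentiability to the preceding one.\<close>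

lemma
  fixes L :: "'d::euclidean_space \<Rightarrow> 'e::euclidean_space \<Rightarrow> 'e"
  assumes S: "open S" and lin: "\<And>x. x \<in> S \<Longrightarrow> linear (L x)" and inj: "\<And>x. x \<in> S \<Longrightarrow> inj (L x)"
    and sm: "\<And>v. smooth_on S (\<lambda>x. L x v)"
  shows inverse_linear_family_linear: "x \<in> S \<Longrightarrow> linear (inv (L x))"
    and inverse_linear_family_smooth: "smooth_on S (\<lambda>x. inv (L x) v)"
proof -
  define I where "I x = inv (L x)" for x
  have bij: "bij (L x)" if "x \<in> S" for x
    using linear_injective_imp_surjective[OF lin inj] inj that by (auto simp: bij_def)
  have LI: "L x (I x v) = v" and IL: "I x (L x v) = v" if "x \<in> S" for x v
    using bij[OF that] by (simp_all add: I_def bij_is_surj surj_f_inv_f bij_is_inj)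
  have I_lin: "linear (I x)" if x: "x \<in> S" for x
  proof (rule linearI)
    show "I x (u + v) = I x u + I x v" for u v
      using IL[OF x, of "I x u + I x v"] by (simp add: linear_add[OF lin[OF x]] LI[OF x])
    show "I x (r *\<^sub>R v) = r *\<^sub>R I x v" for r v
      using IL[OF x, of "r *\<^sub>R I x v"] by (simp add: linear_scale[OF lin[OF x]] LI[OF x])
  qed
  then show "x \<in> S \<Longrightarrow> linear (inv (L x))" by (simp add: I_def)
  have L_cont: "isCont (\<lambda>y. L y v) x" if "x \<in> S" for x v
    using smooth_on_continuous[OF sm] S that continuous_on_eq_continuous_at by blast
  have cont: "isCont (\<lambda>y. I y v) x" if x: "x \<in> S" for x v
  proof -
    obtain c where c: "c > 0" "\<And>u. c * norm u \<le> norm (L x u)"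
      using linear_inj_bounded_below_pos[OF lin inj] x by (metis mult.commute)
    have "((\<lambda>y. \<Sum>b\<in>Basis. norm (L y b - L x b)) \<longlongrightarrow> (\<Sum>b\<in>Basis. norm (L x b - L x b))) (at x)"
      by (intro tendsto_intros L_cont[OF x, unfolded isCont_def])
    then have "\<forall>\<^sub>F y in at x. (\<Sum>b\<in>Basis. norm (L y b - L x b)) < c / 2"
      using c(1) by (intro order_tendstoD) auto
    moreover have "\<forall>\<^sub>F y in at x. y \<in> S" using S x eventually_at_in_open' by blast
    ultimately have ev: "\<forall>\<^sub>F y in at x. norm (I y v - I x v) \<le> (2 / c) * norm (L y (I x v) - v)"
    proof eventually_elim
      case (elim y)
      have "c / 2 * norm u \<le> norm (L y u)" for u
      proof -
        have "norm (L y u - L x u) = norm (\<Sum>b\<in>Basis. (u \<bullet> b) *\<^sub>R (L y b - L x b))"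
          using linear_basis_expansion[OF lin[OF elim(2)], of u] linear_basis_expansion[OF lin[OF x], of u]
          by (simp add: scaleR_right_diff_distrib sum_subtractf)
        also have "\<dots> \<le> (\<Sum>b\<in>Basis. norm u * norm (L y b - L x b))"
          by (rule sum_norm_le) (auto intro!: mult_right_mono Basis_le_norm)
        also have "\<dots> \<le> norm u * (c / 2)"
          unfolding sum_distrib_left[symmetric] using elim(1) by (intro mult_left_mono) auto
        finally have "norm (L y u - L x u) \<le> norm u * (c / 2)" .
        moreover have "norm (L x u) \<le> norm (L y u) + norm (L y u - L x u)"
          by (metis norm_minus_commute norm_triangle_sub)
        ultimately show ?thesis using c(2)[of u] by (simp add: field_simps)
      qed
      from this[of "I y v - I x v"] have "c / 2 * norm (I y v - I x v) \<le> norm (v - L y (I x v))"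
        by (simp add: linear_diff[OF lin[OF elim(2)]] LI[OF elim(2)])
      then show ?case using c(1) by (simp add: field_simps norm_minus_commute)
    qed
    have "((\<lambda>y. (2 / c) * norm (L y (I x v) - v)) \<longlongrightarrow> (2 / c) * norm (L x (I x v) - v)) (at x)"
      by (intro tendsto_intros L_cont[OF x, unfolded isCont_def])
    then have "((\<lambda>y. (2 / c) * norm (L y (I x v) - v)) \<longlongrightarrow> 0) (at x)" by (simp add: LI[OF x])
    from Lim_null_comparison[OF ev this] show ?thesis unfolding isCont_def by (simp add: LIM_zero_iff)
  qed
  \<comment> \<open>the usual formula \<open>(L\<inverse>)' = - L\<inverse> L' L\<inverse>\<close>\<close>
  have der: "((\<lambda>y. I y v) has_derivative (\<lambda>u. - I x (D (\<lambda>y. L y (I x v)) x u))) (at x)" if x: "x \<in> S" for x v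
  proof -
    let ?w = "I x v"
    have "((\<lambda>y. ((L y ?w - v) \<bullet> b) *\<^sub>R I y b) has_derivative (\<lambda>u. (D (\<lambda>y. L y ?w) x u \<bullet> b) *\<^sub>R I x b)) (at x)" for b
      by (rule has_derivative_scaleR_zero[OF _ _ cont[OF x]])
        (auto intro!: derivative_eq_intros smooth_on_has_derivative[OF sm x] simp: LI[OF x])
    from has_derivative_diff[OF has_derivative_const[of ?w] has_derivative_sum[OF this]]
    have "((\<lambda>y. ?w - (\<Sum>b\<in>Basis. ((L y ?w - v) \<bullet> b) *\<^sub>R I y b)) has_derivative
      (\<lambda>u. - (\<Sum>b\<in>Basis. (D (\<lambda>y. L y ?w) x u \<bullet> b) *\<^sub>R I x b))) (at x)"
      by simp
    then have *: "((\<lambda>y. ?w - (\<Sum>b\<in>Basis. ((L y ?w - v) \<bullet> b) *\<^sub>R I y b)) has_derivative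
      (\<lambda>u. - I x (D (\<lambda>y. L y (I x v)) x u))) (at x)"
      by (simp add: linear_basis_expansion[OF I_lin[OF x], symmetric])
    show ?thesis
    proof (rule has_derivative_transform_within_open[OF * S x])
      fix y assume y: "y \<in> S"
      show "?w - (\<Sum>b\<in>Basis. ((L y ?w - v) \<bullet> b) *\<^sub>R I y b) = I y v"
        by (simp add: linear_basis_expansion[OF I_lin[OF y], symmetric] linear_diff[OF I_lin[OF y]] IL[OF y])
    qed
  qed
  have "\<forall>v. Ck_on k S (\<lambda>x. I x v)" for k
  proof (induction k)
    case 0
    show ?case using cont by (simp add: continuous_at_imp_continuous_on)
  next
    case (Suc k)
    have "Ck_on k S (\<lambda>x. - I x (D (\<lambda>y. L y (I x v)) x u))" for v u
    proof -
      have "Ck_on k S (\<lambda>x. D (\<lambda>y. L y (I x v)) x u)"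
        by (rule Ck_on_linear_family[where B = "\<lambda>x w. D (\<lambda>y. L y w) x u", OF S])
          (use Suc smooth_on_D[OF sm] linear_D_family[OF S _ lin sm] in \<open>auto simp: smooth_on_def\<close>)
      then have "Ck_on k S (\<lambda>x. I x (D (\<lambda>y. L y (I x v)) x u))"
        by (rule Ck_on_linear_family[where B = I, OF S I_lin, rotated 2]) (use Suc in auto)
      then show ?thesis
        by (rule Ck_on_bounded_linear[OF S bounded_linear_minus[OF bounded_linear_ident]])
    qed
    then show ?case by (intro allI Ck_on_SucI[OF S der])
  qed
  then show "smooth_on S (\<lambda>x. inv (L x) v)" by (simp add: smooth_on_def I_def)
qed

section \<open>Traces and non-degenerate forms\<close>

lemma lin_trace_add: "lin_trace (\<lambda>x. f x + g x) = lin_trace f + lin_trace g"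
  by (simp add: lin_trace_def inner_add_left sum.distrib)

lemma lin_trace_scaleR: "lin_trace (\<lambda>x. r *\<^sub>R f x) = r * lin_trace f"
  by (simp add: lin_trace_def sum_distrib_left)

lemma lin_trace_minus: "lin_trace (\<lambda>x. - f x) = - lin_trace f"
  using lin_trace_scaleR[of "-1" f] by simp

lemma lin_trace_diff: "lin_trace (\<lambda>x. f x - g x) = lin_trace f - lin_trace g"
  using lin_trace_add[of f "\<lambda>x. - g x"] by (simp add: lin_trace_minus)

lemma lin_trace_ident: "lin_trace (\<lambda>x::'e::euclidean_space. x) = DIM('e)"
  by (simp add: lin_trace_def)

lemma lin_trace_rank_one:
  assumes "linear \<omega>" shows "lin_trace (\<lambda>x. \<omega> x *\<^sub>R v) = \<omega> v"
  by (subst linear_basis_expansion[OF assms, of v]) (simp add: lin_trace_def mult.commute)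

lemma lin_trace_commute:
  fixes f :: "'a::euclidean_space \<Rightarrow> 'b::euclidean_space" and g :: "'b \<Rightarrow> 'a"
  assumes "linear f" "linear g"
  shows "lin_trace (\<lambda>x. g (f x)) = lin_trace (\<lambda>y. f (g y))"
proof -
  have "g (f b) \<bullet> b = (\<Sum>c\<in>Basis. (f b \<bullet> c) * (g c \<bullet> b))" for b
    by (subst linear_basis_expansion[OF assms(2)]) (simp add: inner_sum_left)
  moreover have "f (g c) \<bullet> c = (\<Sum>b\<in>Basis. (f b \<bullet> c) * (g c \<bullet> b))" for c
    by (subst linear_basis_expansion[OF assms(1)]) (simp add: inner_sum_left mult.commute)
  ultimately have "lin_trace (\<lambda>x. g (f x)) = (\<Sum>b\<in>Basis. \<Sum>c\<in>Basis. (f b \<bullet> c) * (g c \<bullet> b))"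
    and "lin_trace (\<lambda>y. f (g y)) = (\<Sum>c\<in>Basis. \<Sum>b\<in>Basis. (f b \<bullet> c) * (g c \<bullet> b))"
    by (simp_all only: lin_trace_def)
  then show ?thesis by (simp only:) (rule sum.swap)
qed

definition gram :: "('e::euclidean_space \<Rightarrow> 'e \<Rightarrow> real) \<Rightarrow> 'e \<Rightarrow> 'e" where
  "gram h u = (\<Sum>b\<in>Basis. h u b *\<^sub>R b)"

locale nondegenerate_form =
  fixes h :: "'e::euclidean_space \<Rightarrow> 'e \<Rightarrow> real"
  assumes bil: "bilinear h" and sym: "h u v = h v u"
    and nondeg: "(\<And>v. h u v = 0) \<Longrightarrow> u = 0"
begin

lemma h_linear: "linear (h u)" "linear (\<lambda>u. h u v)" using bil by (auto simp: bilinear_def)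

lemmas h_simps = bilinear_ladd[OF bil] bilinear_radd[OF bil] bilinear_lsub[OF bil] bilinear_rsub[OF bil]
  bilinear_lmul[OF bil] bilinear_rmul[OF bil] bilinear_lneg[OF bil] bilinear_rneg[OF bil]
  bilinear_lzero[OF bil] bilinear_rzero[OF bil]

lemma h_eqI:
  assumes "\<And>w. h u w = h v w" shows "u = v"
  using nondeg[of "u - v"] assms by (simp add: h_simps)

abbreviation H :: "'e \<Rightarrow> 'e" where "H \<equiv> gram h"

lemma gram_inner: "H u \<bullet> v = h u v"
  by (subst linear_basis_expansion[OF h_linear(1)])
    (simp add: gram_def inner_sum_left inner_commute[of v] mult.commute)

lemma gram_linear: "linear H"
  by (rule linearI; rule euclidean_eqI) (simp_all add: gram_inner inner_add_left h_simps)

lemma gram_inj: "inj H"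
  using nondeg gram_inner gram_linear by (metis inner_zero_left linear_injective_0)

lemma gram_bij: "bij H"
  using linear_injective_imp_surjective[OF gram_linear gram_inj] gram_inj by (simp add: bij_def)

lemma representation:
  assumes "linear \<omega>"
  shows "\<exists>x. \<forall>w. h x w = \<omega> w"
proof -
  obtain x where "H x = (\<Sum>b\<in>Basis. \<omega> b *\<^sub>R b)" using gram_bij by (metis bij_pointE)
  then have "h x w = \<omega> w" for w
    by (subst linear_basis_expansion[OF assms])
      (simp add: gram_inner[symmetric] inner_sum_left inner_commute[of w] mult.commute)
  then show ?thesis by blast
qed

text \<open>A skew operator is the composition of the symmetric inverse Gram operator with an operator that
  is skew for the Euclidean inner product.\<close>

lemma skew_trace_zero:
  assumes f: "linear f" and skew: "\<And>x y. h (f x) y = - h x (f y)"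
  shows "lin_trace f = 0"
proof -
  define K where "K = inv H"
  have HK: "H (K v) = v" and KH: "K (H v) = v" for v
    using gram_bij by (simp_all add: K_def bij_is_surj surj_f_inv_f bij_is_inj)
  have K: "linear K"
  proof (rule linearI)
    show "K (u + v) = K u + K v" for u v
      using KH[of "K u + K v"] by (simp add: linear_add[OF gram_linear] HK)
    show "K (r *\<^sub>R v) = r *\<^sub>R K v" for r v
      using KH[of "r *\<^sub>R K v"] by (simp add: linear_scale[OF gram_linear] HK)
  qed
  have K_sym: "K u \<bullet> v = u \<bullet> K v" for u v
    using gram_inner[of "K u" "K v"] gram_inner[of "K v" "K u"] sym by (simp add: HK inner_commute)
  have 1: "lin_trace f = (\<Sum>b\<in>Basis. H (f b) \<bullet> K b)"
    unfolding lin_trace_def by (rule sum.cong) (simp_all add: K_sym[symmetric] KH)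
  have "lin_trace f = lin_trace (\<lambda>x. K (H (f x)))" by (simp add: KH)
  also have "\<dots> = lin_trace (\<lambda>y. H (f (K y)))"
    by (rule lin_trace_commute[OF linear_compose[OF f gram_linear, unfolded o_def] K])
  also have "\<dots> = (\<Sum>b\<in>Basis. - (H (f b) \<bullet> K b))"
    unfolding lin_trace_def
  proof (rule sum.cong[OF refl])
    fix b :: 'e
    show "H (f (K b)) \<bullet> b = - (H (f b) \<bullet> K b)"
      unfolding gram_inner skew[of "K b"] by (simp add: sym[of "K b"])
  qed
  finally show ?thesis using 1 by (simp add: sum_negf)
qed

text \<open>A maximal positive subspace \<open>P\<close> has a negative complement \<open>N\<close>. The involution exchanges
  positive and negative vectors, so the image of \<open>N\<close> is positive and the image of \<open>P\<close> meets \<open>P\<close>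
  trivially; both together give equal dimensions.\<close>

lemma neutral_form_if_anti_isometric_involution:
  assumes J: "linear J" and JJ: "\<And>v. J (J v) = v" and anti: "\<And>u v. h (J u) (J v) = - h u v"
  shows "neutral_form h"
proof -
  define PD where "PD P \<longleftrightarrow> subspace P \<and> (\<forall>x\<in>P. x \<noteq> 0 \<longrightarrow> h x x > 0)" for P
  have "PD {0}" by (simp add: PD_def)
  moreover have "\<forall>P. PD P \<longrightarrow> dim P < DIM('e) + 1" by (simp add: dim_subset_UNIV less_Suc_eq_le)
  ultimately obtain P where P: "PD P" and max: "\<And>P'. PD P' \<Longrightarrow> dim P' \<le> dim P"
    using ex_has_greatest_nat[of PD "{0}" dim "DIM('e) + 1"] by blast
  have subP: "subspace P" and posP: "\<And>x. x \<in> P \<Longrightarrow> x \<noteq> 0 \<Longrightarrow> h x x > 0" using P by (auto simp: PD_def)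
  define N where "N = {y. \<forall>x\<in>P. h x y = 0}"
  have subN: "subspace N" unfolding N_def subspace_def by (auto simp: h_simps)
  have injJ: "inj J" using JJ by (metis injI)
  have "N = {y \<in> UNIV. \<forall>x\<in>H ` P. orthogonal x y}"
    by (auto simp: N_def orthogonal_def gram_inner)
  moreover have "subspace (H ` P)" using linear_subspace_image[OF gram_linear subP] .
  moreover have "dim (H ` P) = dim P" 
    by (rule dim_image_eq[OF gram_linear inj_on_subset[OF gram_inj subset_UNIV]])
  ultimately have dimN: "dim N + dim P = DIM('e)"
    using dim_subspace_orthogonal_to_vectors[of "H ` P" UNIV] by simp
  have PN: "P \<inter> N = {0}"
  proof -
    have "x = 0" if "x \<in> P" "x \<in> N" for x
      using that posP[of x] by (force simp: N_def)
    then show ?thesis using subspace_0[OF subP] subspace_0[OF subN] by auto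
  qed
  let ?S = "{x + y | x y. x \<in> P \<and> y \<in> N}"
  have "dim ?S = DIM('e)"
    using dim_sums_Int[OF subP subN] dimN PN by simp
  then have "span ?S = UNIV" by (simp only: dim_eq_full)
  moreover have "span ?S = ?S" by (rule span_eq_iff[THEN iffD2, OF subspace_sums[OF subP subN]])
  ultimately have sumUNIV: "?S = UNIV" by (simp only:)
  then have decomp: "\<exists>x\<in>P. \<exists>y\<in>N. v = x + y" for v by blast
  \<comment> \<open>otherwise \<open>y\<close> could be added to \<open>P\<close>\<close>
  have semi: "h y y \<le> 0" if y: "y \<in> N" for y
  proof (rule ccontr)
    assume "\<not> h y y \<le> 0"
    then have pos: "h y y > 0" by simp
    then have "y \<noteq> 0" using h_simps by force
    let ?P = "{a + b | a b. a \<in> P \<and> b \<in> span {y}}"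
    have "h (a + b) (a + b) > 0" if "a \<in> P" "b \<in> span {y}" "a + b \<noteq> 0" for a b
    proof -
      obtain t where b: "b = t *\<^sub>R y" using \<open>b \<in> span {y}\<close> by (auto simp: span_singleton)
      have "h a y = 0" using y that(1) by (simp add: N_def)
      then have "h (a + b) (a + b) = h a a + t * t * h y y"
        by (simp add: b h_simps sym[of y a])
      moreover have "h a a \<ge> 0" using posP[OF that(1)] h_simps by (cases "a = 0") (auto simp: less_imp_le)
      moreover have "t * t * h y y \<ge> 0" using pos by simp
      moreover have "t * t * h y y > 0" if "t \<noteq> 0"
        using that pos by (auto simp: zero_less_mult_iff linorder_neq_iff)
      then have "h a a > 0 \<or> t * t * h y y > 0"
        using posP[OF that(1)] that(3) b by (cases "a = 0") auto
      ultimately show ?thesis by linarith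
    qed
    then have "PD ?P" unfolding PD_def using subspace_sums[OF subP subspace_span, of "{y}"] by auto
    then have "dim ?P \<le> dim P" by (rule max)
    moreover have "span {y} \<subseteq> N" by (rule span_minimal) (use y subN in auto)
    then have "P \<inter> span {y} = {0}" using PN subspace_0[OF subP] span_0 by blast
    then have "dim ?P = dim P + 1"
      using dim_sums_Int[OF subP subspace_span, of "{y}"] \<open>y \<noteq> 0\<close> by simp
    ultimately show False by simp
  qed
  have negN: "h y y < 0" if y: "y \<in> N" "y \<noteq> 0" for y
  proof (rule ccontr)
    assume "\<not> h y y < 0"
    then have 0: "h y y = 0" using semi[OF y(1)] by simp
    obtain v where v: "h y v \<noteq> 0" using nondeg y(2) by blast
    obtain a z where az: "a \<in> P" "z \<in> N" "v = a + z" using decomp by blast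
    have "h y a = 0" using az(1) y(1) sym by (simp add: N_def)
    then have yz: "h y z \<noteq> 0" using v az(3) by (simp add: h_simps)
    define t where "t = (1 - h z z) / (2 * h y z)"
    have "t *\<^sub>R y + z \<in> N" using subN y(1) az(2) by (simp add: subspace_add subspace_scale)
    then have "h (t *\<^sub>R y + z) (t *\<^sub>R y + z) \<le> 0" by (rule semi)
    moreover have "h (t *\<^sub>R y + z) (t *\<^sub>R y + z) = 2 * t * h y z + h z z"
      using 0 by (simp add: h_simps sym[of z y])
    moreover have "2 * t * h y z = 1 - h z z" using yz by (simp add: t_def)
    ultimately show False by simp
  qed
  have dimJ: "dim (J ` X) = dim X" for X
    by (rule dim_image_eq[OF J inj_on_subset[OF injJ subset_UNIV]])
  have "PD (J ` N)" unfolding PD_def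
    using linear_subspace_image[OF J subN] negN linear_0[OF J] by (auto simp: anti)
  then have "dim N \<le> dim P" using max dimJ by metis
  moreover have "dim P \<le> dim N"
  proof -
    have "P \<inter> J ` P = {0}"
    proof -
      have "x = 0" if "x \<in> P" "x \<in> J ` P" for x
      proof (rule ccontr)
        assume "x \<noteq> 0"
        obtain w where w: "w \<in> P" "x = J w" using \<open>x \<in> J ` P\<close> by blast
        then have "w \<noteq> 0" using \<open>x \<noteq> 0\<close> linear_0[OF J] by auto
        have "h x x = - h w w" using w by (simp add: anti)
        then show False using posP[OF w(1) \<open>w \<noteq> 0\<close>] posP[OF that(1) \<open>x \<noteq> 0\<close>] by simp
      qed
      moreover have "0 \<in> J ` P" using subspace_0[OF subP] linear_0[OF J] by (metis imageI)
      ultimately show ?thesis using subspace_0[OF subP] by blast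
    qed
    then have "dim {x + y | x y. x \<in> P \<and> y \<in> J ` P} = dim P + dim P"
      using dim_sums_Int[OF subP linear_subspace_image[OF J subP]] dimJ[of P] by simp
    then have "dim P + dim P \<le> DIM('e)"
      using dim_subset_UNIV[of "{x + y | x y. x \<in> P \<and> y \<in> J ` P}"] by (simp only:)
    then show ?thesis using dimN by simp
  qed
  ultimately have "dim P = dim N" by simp
  then show ?thesis unfolding neutral_form_def
    using subP subN decomp posP negN by (intro exI[of _ P] exI[of _ N]) (auto simp: N_def)
qed

end

section \<open>The Levi-Civita connection of a metric in a coordinate patch\<close>

locale metric_patch =
  fixes V :: "'e::euclidean_space set" and G :: "'e \<Rightarrow> 'e \<Rightarrow> 'e \<Rightarrow> real"
  assumes open_V: "open V"
    and bil: "z \<in> V \<Longrightarrow> bilinear (G z)"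
    and sym: "z \<in> V \<Longrightarrow> G z u v = G z v u"
    and nondeg: "z \<in> V \<Longrightarrow> (\<And>v. G z u v = 0) \<Longrightarrow> u = 0"
    and smooth: "smooth_on V (\<lambda>z. G z u v)"
begin

lemma G_form: "z \<in> V \<Longrightarrow> nondegenerate_form (G z)"
  by unfold_locales (use bil sym nondeg in auto)

lemmas G_linear = nondegenerate_form.h_linear[OF G_form]
lemmas G_simps = nondegenerate_form.h_simps[OF G_form]
lemmas G_eqI = nondegenerate_form.h_eqI[OF G_form]

text \<open>Raising an index preserves smoothness.\<close>

lemma smooth_representing_field:
  assumes S: "open S" "S \<subseteq> V" and \<omega>: "\<And>w. smooth_on S (\<lambda>z. \<omega> z w)"
    and X: "\<And>z w. z \<in> S \<Longrightarrow> G z (X z) w = \<omega> z w"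
  shows "smooth_on S X"
proof -
  have form: "nondegenerate_form (G z)" if "z \<in> S" for z using G_form S(2) that by blast
  note lin = nondegenerate_form.gram_linear[OF form] and inj = nondegenerate_form.gram_inj[OF form]
  have sm: "smooth_on S (\<lambda>z. gram (G z) v)" for v
    unfolding gram_def by (intro smooth_on_sum smooth_on_scaleR_left smooth_on_subset[OF smooth] S)
  have "smooth_on S (\<lambda>z. inv (gram (G z)) (\<Sum>b\<in>Basis. \<omega> z b *\<^sub>R b))"
  proof (rule smooth_on_linear_family[where B = "\<lambda>z. inv (gram (G z))", OF S(1)])
    show "linear (inv (gram (G z)))" if "z \<in> S" for z
      by (rule inverse_linear_family_linear[where L = "\<lambda>z. gram (G z)", OF S(1) lin inj sm that])
    show "smooth_on S (\<lambda>z. inv (gram (G z)) v)" for v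
      by (rule inverse_linear_family_smooth[where L = "\<lambda>z. gram (G z)", OF S(1) lin inj sm])
    show "smooth_on S (\<lambda>z. \<Sum>b\<in>Basis. \<omega> z b *\<^sub>R b)"
      by (intro smooth_on_sum smooth_on_scaleR_left \<omega> S(1))
  qed
  moreover have "inv (gram (G z)) (\<Sum>b\<in>Basis. \<omega> z b *\<^sub>R b) = X z" if z: "z \<in> S" for z
    unfolding X[OF z, symmetric] gram_def[symmetric] by (rule inv_f_f[OF inj[OF z]])
  ultimately show ?thesis by (rule smooth_on_cong[OF S(1), rotated])
qed

abbreviation DG :: "'e \<Rightarrow> 'e \<Rightarrow> 'e \<Rightarrow> 'e \<Rightarrow> real" where
  "DG z u v w \<equiv> D (\<lambda>y. G y v w) z u"

lemma DG_linear:
  assumes "z \<in> V"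
  shows "linear (\<lambda>u. DG z u v w)" "linear (\<lambda>v. DG z u v w)" "linear (\<lambda>w. DG z u v w)"
  using linear_D[OF smooth_on_differentiable[OF smooth assms]]
    linear_D_family[OF open_V assms G_linear(2) smooth] linear_D_family[OF open_V assms G_linear(1) smooth]
  by auto

lemma DG_sym: "z \<in> V \<Longrightarrow> DG z u v w = DG z u w v"
  using frechet_derivative_transform_within_open[OF smooth_on_differentiable[OF smooth] open_V] sym by metis

text \<open>Koszul's formula determines the connection, and its solution satisfies all the conditions.\<close>

lemma christoffel_unique:
  assumes z: "z \<in> V" and "\<And>u v. \<Gamma> u v = \<Gamma> v u"
    and "\<And>u v w. DG z u v w = G z (\<Gamma> u v) w + G z v (\<Gamma> u w)"
  shows "2 * G z (\<Gamma> u v) w = DG z u v w + DG z v u w - DG z w u v"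
proof -
  have 1: "G z v (\<Gamma> u w) = G z (\<Gamma> w u) v" and 2: "G z u (\<Gamma> v w) = G z u (\<Gamma> w v)"
    and 3: "\<Gamma> v u = \<Gamma> u v"
    using assms(2) sym[OF z] by metis+
  have "DG z u v w = G z (\<Gamma> u v) w + G z v (\<Gamma> u w)" by (rule assms(3))
  moreover have "DG z v u w = G z (\<Gamma> v u) w + G z u (\<Gamma> v w)" by (rule assms(3))
  moreover have "DG z w u v = G z (\<Gamma> w u) v + G z u (\<Gamma> w v)" by (rule assms(3))
  ultimately show ?thesis unfolding 1 2 3 by linarith
qed

lemma ex_christoffel:
  assumes z: "z \<in> V"
  shows "\<exists>!\<Gamma>. bilinear \<Gamma> \<and> (\<forall>u v. \<Gamma> u v = \<Gamma> v u) \<and>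
     (\<forall>u v w. DG z u v w = G z (\<Gamma> u v) w + G z v (\<Gamma> u w))"
proof (rule ex_ex1I)
  define K where "K u v w = (DG z u v w + DG z v u w - DG z w u v) / 2" for u v w
  note dl = DG_linear[OF z]
  note dls = dl[THEN linear_add] dl[THEN linear_scale]
  have "linear (K u v)" for u v
    unfolding K_def by (rule linearI) (simp_all add: dls algebra_simps add_divide_distrib diff_divide_distrib)
  then have "\<forall>u v. \<exists>x. \<forall>w. G z x w = K u v w" using nondegenerate_form.representation[OF G_form[OF z]]
    by blast
  then obtain \<Gamma> where \<Gamma>: "\<And>u v w. G z (\<Gamma> u v) w = K u v w" by metis
  note s = G_simps[OF z]
  have "\<Gamma> u v = \<Gamma> v u" for u v
  proof (rule G_eqI[OF z])
    show "G z (\<Gamma> u v) w = G z (\<Gamma> v u) w" for w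
      using DG_sym[OF z, where u = w and v = u and w = v] by (simp add: \<Gamma> K_def)
  qed
  moreover have "\<Gamma> u (v + w) = \<Gamma> u v + \<Gamma> u w" for u v w
    by (rule G_eqI[OF z]) (simp add: \<Gamma> s K_def dls add_divide_distrib diff_divide_distrib)
  moreover have "\<Gamma> u (r *\<^sub>R v) = r *\<^sub>R \<Gamma> u v" for u v r
    by (rule G_eqI[OF z]) (simp add: \<Gamma> s K_def dls algebra_simps add_divide_distrib diff_divide_distrib)
  ultimately have "bilinear \<Gamma>" "\<And>u v. \<Gamma> u v = \<Gamma> v u"
    unfolding bilinear_def linear_iff by metis+
  moreover have "DG z u v w = G z (\<Gamma> u v) w + G z v (\<Gamma> u w)" for u v w
    using DG_sym[OF z, where u = u and v = v and w = w]
      DG_sym[OF z, where u = v and v = u and w = w]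
      DG_sym[OF z, where u = w and v = u and w = v]
    by (simp add: sym[OF z, of v "\<Gamma> u w"] \<Gamma> K_def field_simps)
  ultimately show "\<exists>\<Gamma>. bilinear \<Gamma> \<and> (\<forall>u v. \<Gamma> u v = \<Gamma> v u) \<and>
     (\<forall>u v w. DG z u v w = G z (\<Gamma> u v) w + G z v (\<Gamma> u w))" by blast
next
  fix \<Gamma> \<Delta>
  assume 1: "bilinear \<Gamma> \<and> (\<forall>u v. \<Gamma> u v = \<Gamma> v u) \<and>
     (\<forall>u v w. DG z u v w = G z (\<Gamma> u v) w + G z v (\<Gamma> u w))"
   and 2: "bilinear \<Delta> \<and> (\<forall>u v. \<Delta> u v = \<Delta> v u) \<and>
     (\<forall>u v w. DG z u v w = G z (\<Delta> u v) w + G z v (\<Delta> u w))"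
  have "2 * G z (\<Gamma> u v) w = 2 * G z (\<Delta> u v) w" for u v w
    using christoffel_unique[OF z, of \<Gamma> u v w] christoffel_unique[OF z, of \<Delta> u v w] 1 2 by simp
  then have "\<Gamma> u v = \<Delta> u v" for u v by (intro G_eqI[OF z]) simp
  then show "\<Gamma> = \<Delta>" by blast
qed

abbreviation \<Gamma> :: "'e \<Rightarrow> 'e \<Rightarrow> 'e \<Rightarrow> 'e" where "\<Gamma> \<equiv> christoffel G"

lemma christoffel_eqI:
  assumes "z \<in> V" "bilinear \<Delta>" "\<And>u v. \<Delta> u v = \<Delta> v u"
    "\<And>u v w. DG z u v w = G z (\<Delta> u v) w + G z v (\<Delta> u w)"
  shows "\<Gamma> z = \<Delta>"
  unfolding christoffel_def by (rule the1_equality[OF ex_christoffel[OF assms(1)]]) (use assms(2-4) in blast)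

lemma
  assumes "z \<in> V"
  shows \<Gamma>_bilinear: "bilinear (\<Gamma> z)" and \<Gamma>_sym: "\<Gamma> z u v = \<Gamma> z v u"
    and metric_compatible: "DG z u v w = G z (\<Gamma> z u v) w + G z v (\<Gamma> z u w)"
proof -
  have "bilinear (\<Gamma> z) \<and> (\<forall>u v. \<Gamma> z u v = \<Gamma> z v u) \<and>
     (\<forall>u v w. DG z u v w = G z (\<Gamma> z u v) w + G z v (\<Gamma> z u w))"
    unfolding christoffel_def by (rule theI'[OF ex_christoffel[OF assms]])
  then show "bilinear (\<Gamma> z)" "\<Gamma> z u v = \<Gamma> z v u"
    "DG z u v w = G z (\<Gamma> z u v) w + G z v (\<Gamma> z u w)" by blast+
qed

lemma \<Gamma>_linear: "z \<in> V \<Longrightarrow> linear (\<Gamma> z u)" "z \<in> V \<Longrightarrow> linear (\<lambda>u. \<Gamma> z u v)"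
  using \<Gamma>_bilinear by (auto simp: bilinear_def)

lemmas \<Gamma>_simps = bilinear_ladd[OF \<Gamma>_bilinear] bilinear_radd[OF \<Gamma>_bilinear] bilinear_lsub[OF \<Gamma>_bilinear]
  bilinear_rsub[OF \<Gamma>_bilinear] bilinear_lmul[OF \<Gamma>_bilinear] bilinear_rmul[OF \<Gamma>_bilinear]
  bilinear_lneg[OF \<Gamma>_bilinear] bilinear_rneg[OF \<Gamma>_bilinear]
  bilinear_lzero[OF \<Gamma>_bilinear] bilinear_rzero[OF \<Gamma>_bilinear]

lemma \<Gamma>_smooth: "smooth_on V (\<lambda>z. \<Gamma> z u v)"
proof (rule smooth_representing_field[OF open_V order_refl, where \<omega> = "\<lambda>z w. (1/2) *\<^sub>R (DG z u v w + DG z v u w - DG z w u v)"])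
  fix w
  have "smooth_on V (\<lambda>z. DG z u v w)" for u v w by (rule smooth_on_D[OF smooth])
  note * = smooth_on_diff[OF open_V smooth_on_add[OF open_V this this] this]
  show "smooth_on V (\<lambda>z. (1/2) *\<^sub>R (DG z u v w + DG z v u w - DG z w u v))"
    by (rule smooth_on_bounded_linear[OF open_V bounded_linear_scaleR_right *])
next
  show "G z (\<Gamma> z u v) w = (1/2) *\<^sub>R (DG z u v w + DG z v u w - DG z w u v)" if "z \<in> V" for z w
    using christoffel_unique[OF that \<Gamma>_sym[OF that] metric_compatible[OF that], of u v w] by simp
qed

abbreviation D\<Gamma> :: "'e \<Rightarrow> 'e \<Rightarrow> 'e \<Rightarrow> 'e \<Rightarrow> 'e" where
  "D\<Gamma> z u v w \<equiv> D (\<lambda>y. \<Gamma> y v w) z u"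

lemma D\<Gamma>_linear:
  assumes "z \<in> V"
  shows "linear (\<lambda>u. D\<Gamma> z u v w)" "linear (\<lambda>v. D\<Gamma> z u v w)" "linear (\<lambda>w. D\<Gamma> z u v w)"
  using linear_D[OF smooth_on_differentiable[OF \<Gamma>_smooth assms]]
    linear_D_family[OF open_V assms \<Gamma>_linear(2) \<Gamma>_smooth] linear_D_family[OF open_V assms \<Gamma>_linear(1) \<Gamma>_smooth]
  by auto

lemma D\<Gamma>_sym: "z \<in> V \<Longrightarrow> D\<Gamma> z u v w = D\<Gamma> z u w v"
  using frechet_derivative_transform_within_open[OF smooth_on_differentiable[OF \<Gamma>_smooth] open_V] \<Gamma>_sym
    by metis

text \<open>The tangent fields of a submanifold are fields along its inclusion \<open>f\<close> and need not extend to
  the ambient patch; hence this form of metric compatibility.\<close>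

lemma metric_compatible_along:
  fixes f :: "'d::euclidean_space \<Rightarrow> 'e"
  assumes S: "open S" "x \<in> S" "\<And>y. y \<in> S \<Longrightarrow> f y \<in> V"
    and f: "(f has_derivative f') (at x)"
    and Y: "(Y has_derivative Y') (at x)" and Z: "(Z has_derivative Z') (at x)"
  shows "((\<lambda>y. G (f y) (Y y) (Z y)) has_derivative
    (\<lambda>u. G (f x) (Y' u + \<Gamma> (f x) (f' u) (Y x)) (Z x) +
         G (f x) (Y x) (Z' u + \<Gamma> (f x) (f' u) (Z x)))) (at x)"
proof -
  have x: "f x \<in> V" using S by simp
  have "((\<lambda>y. G (f y) v w) has_derivative (\<lambda>u. DG (f x) (f' u) v w)) (at x)" for v w
    using diff_chain_at[OF f smooth_on_has_derivative[OF smooth x]] by (simp add: o_def)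
  from has_derivative_bilinear_family[where B = "\<lambda>y. G (f y)", OF S(1,2) _ this Y Z] S(3) bil
  have "((\<lambda>y. G (f y) (Y y) (Z y)) has_derivative (\<lambda>u. DG (f x) (f' u) (Y x) (Z x)
     + G (f x) (Y x) (Z' u) + G (f x) (Y' u) (Z x))) (at x)" by simp
  then show ?thesis
    by (simp add: metric_compatible[OF x] G_simps[OF x] algebra_simps)
qed

lemma has_derivative_\<Gamma>_along:
  fixes f :: "'d::euclidean_space \<Rightarrow> 'e"
  assumes S: "open S" "x \<in> S" "\<And>y. y \<in> S \<Longrightarrow> f y \<in> V"
    and f: "(f has_derivative f') (at x)"
    and Y: "(Y has_derivative Y') (at x)" and Z: "(Z has_derivative Z') (at x)"
  shows "((\<lambda>y. \<Gamma> (f y) (Y y) (Z y)) has_derivative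
    (\<lambda>u. D\<Gamma> (f x) (f' u) (Y x) (Z x) + \<Gamma> (f x) (Y x) (Z' u) + \<Gamma> (f x) (Y' u) (Z x))) (at x)"
proof -
  have x: "f x \<in> V" using S by simp
  have "((\<lambda>y. \<Gamma> (f y) v w) has_derivative (\<lambda>u. D\<Gamma> (f x) (f' u) v w)) (at x)" for v w
    using diff_chain_at[OF f smooth_on_has_derivative[OF \<Gamma>_smooth x]] by (simp add: o_def)
  from has_derivative_bilinear_family[where B = "\<lambda>y. \<Gamma> (f y)", OF S(1,2) _ this Y Z] S(3) \<Gamma>_bilinear
  show ?thesis by simp
qed

lemma cov_deriv_const: "cov_deriv G u (\<lambda>_. w) z = \<Gamma> z u w"
  by (simp add: cov_deriv_def)

lemma curvature_eq:
  "curvature G z u v w = D\<Gamma> z u v w - D\<Gamma> z v u w + \<Gamma> z u (\<Gamma> z v w) - \<Gamma> z v (\<Gamma> z u w)"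
proof -
  have "cov_deriv G v (\<lambda>_. w) = (\<lambda>y. \<Gamma> y v w)" for v w by (rule ext) (rule cov_deriv_const)
  then show ?thesis unfolding curvature_def by (simp add: cov_deriv_def)
qed

text \<open>The second derivatives of the metric coefficients are symmetric; what is not symmetric in their
  expression by the connection is the curvature.\<close>

lemma curvature_skew:
  assumes z: "z \<in> V"
  shows "G z (curvature G z u v w) x = - G z w (curvature G z u v x)"
proof -
  have 1: "((\<lambda>y. G y (\<Gamma> y v w) x + G y w (\<Gamma> y v x)) has_derivative
    (\<lambda>u. G z (D\<Gamma> z u v w + \<Gamma> z u (\<Gamma> z v w)) x + G z (\<Gamma> z v w) (\<Gamma> z u x)
       + (G z (\<Gamma> z u w) (\<Gamma> z v x) + G z w (D\<Gamma> z u v x + \<Gamma> z u (\<Gamma> z v x))))) (at z)" for v w x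
  proof (intro has_derivative_add)
    note d = smooth_on_has_derivative[OF \<Gamma>_smooth z] has_derivative_const
    show "((\<lambda>y. G y (\<Gamma> y v w) x) has_derivative
      (\<lambda>u. G z (D\<Gamma> z u v w + \<Gamma> z u (\<Gamma> z v w)) x + G z (\<Gamma> z v w) (\<Gamma> z u x))) (at z)"
      using metric_compatible_along[OF open_V z _ has_derivative_ident d(1)[of v w] d(2)[of x]] by simp
    show "((\<lambda>y. G y w (\<Gamma> y v x)) has_derivative
      (\<lambda>u. G z (\<Gamma> z u w) (\<Gamma> z v x) + G z w (D\<Gamma> z u v x + \<Gamma> z u (\<Gamma> z v x)))) (at z)"
      using metric_compatible_along[OF open_V z _ has_derivative_ident d(2)[of w] d(1)[of v x]] by simp
  qed
  have "((\<lambda>y. DG y v w x) has_derivative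
    (\<lambda>u. G z (D\<Gamma> z u v w + \<Gamma> z u (\<Gamma> z v w)) x + G z (\<Gamma> z v w) (\<Gamma> z u x)
       + (G z (\<Gamma> z u w) (\<Gamma> z v x) + G z w (D\<Gamma> z u v x + \<Gamma> z u (\<Gamma> z v x))))) (at z)" for v
    by (rule has_derivative_transform_within_open[OF 1 open_V z]) (simp add: metric_compatible)
  note 2 = D_eq[OF this]
  have "D (\<lambda>y. DG y v w x) z u = D (\<lambda>y. DG y u w x) z v"
    by (rule D_commute[OF open_V z smooth])
  then show ?thesis unfolding 2 by (simp add: curvature_eq G_simps[OF z])
qed

lemma curvature_algebraic:
  assumes z: "z \<in> V"
  shows "algebraic_curvature_tensor (G z) (curvature G z)"
proof -
  note dl = D\<Gamma>_linear[OF z]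
  note dls = dl[THEN linear_add] dl[THEN linear_scale] \<Gamma>_simps[OF z]
  have "curvature G z u v w + curvature G z v w u + curvature G z w u v = 0" for u v w
  proof -
    have "D\<Gamma> z u w v = D\<Gamma> z u v w" "D\<Gamma> z v w u = D\<Gamma> z v u w" "D\<Gamma> z w v u = D\<Gamma> z w u v"
      by (rule D\<Gamma>_sym[OF z])+
    moreover have "\<Gamma> z w v = \<Gamma> z v w" "\<Gamma> z w u = \<Gamma> z u w" "\<Gamma> z v u = \<Gamma> z u v"
      by (rule \<Gamma>_sym[OF z])+
    ultimately show ?thesis unfolding curvature_eq by simp
  qed
  moreover have "bilinear (\<lambda>u v. curvature G z u v w)" for w
    unfolding bilinear_def linear_iff by (simp add: curvature_eq dls algebra_simps)
  moreover have "linear (curvature G z u v)" for u v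
    unfolding linear_iff by (simp add: curvature_eq dls algebra_simps)
  moreover have "curvature G z u v w = - curvature G z v u w" for u v w
    by (simp add: curvature_eq)
  ultimately show ?thesis
    unfolding algebraic_curvature_tensor_def using curvature_skew[OF z] by blast
qed

end

section \<open>Para-quaternionic algebra\<close>

text \<open>The generators are named instead of indexed, so that the table of all their products, which
  follows from \<open>k = i j = - j i\<close>, can be used for rewriting.\<close>

locale pq_triple =
  fixes a b c :: real and i j k :: "'e::euclidean_space \<Rightarrow> 'e"
  assumes signs: "(a, b, c) \<in> {(-1, 1, 1), (1, -1, 1), (1, 1, -1)}"
    and i_lin: "linear i" and j_lin: "linear j" and k_lin: "linear k"
    and ii: "i (i v) = a *\<^sub>R v" and jj: "j (j v) = b *\<^sub>R v" and kk: "k (k v) = c *\<^sub>R v"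
    and ij: "i (j v) = k v" and ji: "j (i v) = - k v"
begin

lemmas lin_simps = i_lin[THEN linear_add] j_lin[THEN linear_add] k_lin[THEN linear_add]
  i_lin[THEN linear_diff] j_lin[THEN linear_diff] k_lin[THEN linear_diff]
  i_lin[THEN linear_neg] j_lin[THEN linear_neg] k_lin[THEN linear_neg]
  i_lin[THEN linear_scale] j_lin[THEN linear_scale] k_lin[THEN linear_scale]
  i_lin[THEN linear_0] j_lin[THEN linear_0] k_lin[THEN linear_0]

lemma sq_signs: "a * a = 1" "b * b = 1" "c * c = 1" "c = - (a * b)"
  using signs by auto

lemma ik: "i (k v) = a *\<^sub>R j v" by (metis ij ii)
lemma kj: "k (j v) = b *\<^sub>R i v" by (metis ij jj i_lin linear_scale)
lemma jk: "j (k v) = - (b *\<^sub>R i v)" by (metis ij ji kj)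
lemma ki: "k (i v) = - (a *\<^sub>R j v)"
proof -
  have "k (i v) = i (j (i v))" by (simp add: ij)
  then show ?thesis by (simp add: ji lin_simps ik)
qed

lemmas table = ii jj kk ij ji ik kj jk ki

lemma trace_i: "lin_trace i = 0" and trace_j: "lin_trace j = 0" and trace_k: "lin_trace k = 0"
proof -
  note l = i_lin j_lin k_lin
  have "lin_trace (\<lambda>v. i (k v)) = lin_trace (\<lambda>v. k (i v))" by (rule lin_trace_commute[OF l(3,1)])
  then have "a * lin_trace j = 0" by (simp add: table lin_trace_scaleR lin_trace_minus)
  then show "lin_trace j = 0" using sq_signs(1) by auto
  have "lin_trace (\<lambda>v. k (j v)) = lin_trace (\<lambda>v. j (k v))" by (rule lin_trace_commute[OF l(2,3)])
  then have "b * lin_trace i = 0" by (simp add: table lin_trace_scaleR lin_trace_minus)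
  then show "lin_trace i = 0" using sq_signs(2) by auto
  have "lin_trace (\<lambda>v. i (j v)) = lin_trace (\<lambda>v. j (i v))" by (rule lin_trace_commute[OF l(2,1)])
  then show "lin_trace k = 0" by (simp add: table lin_trace_minus)
qed

definition comb :: "real \<Rightarrow> real \<Rightarrow> real \<Rightarrow> 'e \<Rightarrow> 'e" where
  "comb x y z v = x *\<^sub>R i v + y *\<^sub>R j v + z *\<^sub>R k v"

lemma comb_trace:
  "lin_trace (\<lambda>v. i (comb x y z v)) = a * x * DIM('e)"
  "lin_trace (\<lambda>v. j (comb x y z v)) = b * y * DIM('e)"
  "lin_trace (\<lambda>v. k (comb x y z v)) = c * z * DIM('e)"
  by (simp_all add: comb_def lin_simps table lin_trace_add lin_trace_diff lin_trace_scaleR lin_trace_minus trace_i trace_j trace_k lin_trace_ident)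

text \<open>The anticommutator with a generator extracts its coefficient, so an element of the span that
  vanishes on the quaternionic line through a vector is zero.\<close>

lemma comb_eq_zero:
  assumes "v \<noteq> 0" "comb x y z v = 0" "comb x y z (i v) = 0" "comb x y z (j v) = 0" "comb x y z (k v) = 0"
  shows "x = 0" "y = 0" "z = 0"
proof -
  have "i (comb x y z v) + comb x y z (i v) = (2 * a * x) *\<^sub>R v"
    "j (comb x y z v) + comb x y z (j v) = (2 * b * y) *\<^sub>R v"
    "k (comb x y z v) + comb x y z (k v) = (2 * c * z) *\<^sub>R v"
    by (simp_all add: comb_def lin_simps table algebra_simps flip: scaleR_2)
  then show "x = 0" "y = 0" "z = 0" using assms sq_signs by (auto simp: lin_simps)
qed

end

definition triple_span :: "('e::euclidean_space \<Rightarrow> 'e) \<Rightarrow> ('e \<Rightarrow> 'e) \<Rightarrow> ('e \<Rightarrow> 'e) \<Rightarrow> ('e \<Rightarrow> 'e) set" where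
  "triple_span i j k = {(\<lambda>v. x *\<^sub>R i v + y *\<^sub>R j v + z *\<^sub>R k v) | x y z. True}"

lemma endo_span_eq_triple_span: "endo_span J = triple_span (J 1) (J 2) (J 3)"
proof -
  have 1: "(\<lambda>v. \<Sum>\<alpha>\<in>{1, 2, 3}. f \<alpha> *\<^sub>R J \<alpha> v) = (\<lambda>v. f 1 *\<^sub>R J 1 v + f 2 *\<^sub>R J 2 v + f 3 *\<^sub>R J 3 v)" for f
    by (simp add: add.assoc)
  have 2: "(\<lambda>v. x *\<^sub>R J 1 v + y *\<^sub>R J 2 v + z *\<^sub>R J 3 v) =
      (\<lambda>v. \<Sum>\<alpha>\<in>{1, 2, 3}. (if \<alpha> = 1 then x else if \<alpha> = 2 then y else z) *\<^sub>R J \<alpha> v)" for x y z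
    unfolding 1 by simp
  show ?thesis
  proof (intro set_eqI iffI)
    fix E assume "E \<in> endo_span J"
    then obtain f where "E = (\<lambda>v. \<Sum>\<alpha>\<in>{1, 2, 3}. f \<alpha> *\<^sub>R J \<alpha> v)" unfolding endo_span_def by blast
    then show "E \<in> triple_span (J 1) (J 2) (J 3)" unfolding 1 triple_span_def by blast
  next
    fix E assume "E \<in> triple_span (J 1) (J 2) (J 3)"
    then obtain x y z where "E = (\<lambda>v. x *\<^sub>R J 1 v + y *\<^sub>R J 2 v + z *\<^sub>R J 3 v)"
      unfolding triple_span_def by blast
    then show "E \<in> endo_span J" unfolding 2 endo_span_def
      by (intro CollectI exI[of _ "\<lambda>\<alpha>. if \<alpha> = 1 then x else if \<alpha> = 2 then y else z"]) (simp only:)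
  qed
qed

lemma pq_basis_iff_triple:
  "pq_basis \<epsilon> J \<longleftrightarrow> pq_triple (\<epsilon> 1) (\<epsilon> 2) (\<epsilon> 3) (J 1) (J 2) (J 3)"
proof
  assume "pq_basis \<epsilon> J"
  then have 1: "(\<epsilon> 1, \<epsilon> 2, \<epsilon> 3) \<in> {(-1, 1, 1), (1, -1, 1), (1, 1, -1)}"
    and 2: "\<And>\<alpha>. \<alpha> \<in> {1, 2, 3} \<Longrightarrow> linear (J \<alpha>) \<and> (\<forall>v. J \<alpha> (J \<alpha> v) = \<epsilon> \<alpha> *\<^sub>R v)"
    and 3: "\<And>\<alpha> \<beta> v. \<alpha> \<in> {1, 2, 3} \<Longrightarrow> \<beta> \<in> {1, 2, 3} \<Longrightarrow> \<alpha> \<noteq> \<beta> \<Longrightarrow> J \<alpha> (J \<beta> v) = - J \<beta> (J \<alpha> v)"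
    and 4: "\<And>v. J 3 v = J 1 (J 2 v)"
    unfolding pq_basis_def by blast+
  have 5: "J 2 (J 1 v) = - J 1 (J 2 v)" for v by (rule 3) simp_all
  show "pq_triple (\<epsilon> 1) (\<epsilon> 2) (\<epsilon> 3) (J 1) (J 2) (J 3)"
  proof (rule pq_triple.intro)
    show "(\<epsilon> 1, \<epsilon> 2, \<epsilon> 3) \<in> {(-1, 1, 1), (1, -1, 1), (1, 1, -1)}" by (rule 1)
    show "linear (J 1)" "linear (J 2)" "linear (J 3)" using 2[of 1] 2[of 2] 2[of 3] by blast+
    show "J 1 (J 1 v) = \<epsilon> 1 *\<^sub>R v" "J 2 (J 2 v) = \<epsilon> 2 *\<^sub>R v" for v
      using 2[of 1] 2[of 2] by blast+
    show "J 3 (J 3 v) = \<epsilon> 3 *\<^sub>R v" for v using 2[of 3] by blast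
    show "J 1 (J 2 v) = J 3 v" for v by (rule 4[symmetric])
    show "J 2 (J 1 v) = - J 3 v" for v by (simp only: 4 5)
  qed
next
  assume "pq_triple (\<epsilon> 1) (\<epsilon> 2) (\<epsilon> 3) (J 1) (J 2) (J 3)"
  then interpret pq_triple "\<epsilon> 1" "\<epsilon> 2" "\<epsilon> 3" "J 1" "J 2" "J 3" .
  show "pq_basis \<epsilon> J" unfolding pq_basis_def
    using signs i_lin j_lin k_lin by (simp add: table del: One_nat_def)
qed

lemma triple_span_closed:
  assumes "E \<in> triple_span i j k" "F \<in> triple_span i j k"
  shows "(\<lambda>v. E v + F v) \<in> triple_span i j k" "(\<lambda>v. E v - F v) \<in> triple_span i j k"
    "(\<lambda>v. r *\<^sub>R E v) \<in> triple_span i j k"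
proof -
  obtain x y z x' y' z' where E: "E = (\<lambda>v. x *\<^sub>R i v + y *\<^sub>R j v + z *\<^sub>R k v)"
    and F: "F = (\<lambda>v. x' *\<^sub>R i v + y' *\<^sub>R j v + z' *\<^sub>R k v)"
    using assms by (auto simp: triple_span_def)
  show "(\<lambda>v. E v + F v) \<in> triple_span i j k" unfolding triple_span_def E F
    by (intro CollectI exI[of _ "x + x'"] exI[of _ "y + y'"] exI[of _ "z + z'"]) (simp add: algebra_simps)
  show "(\<lambda>v. E v - F v) \<in> triple_span i j k" unfolding triple_span_def E F
    by (intro CollectI exI[of _ "x - x'"] exI[of _ "y - y'"] exI[of _ "z - z'"]) (simp add: algebra_simps)
  show "(\<lambda>v. r *\<^sub>R E v) \<in> triple_span i j k" unfolding triple_span_def E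
    by (intro CollectI exI[of _ "r * x"] exI[of _ "r * y"] exI[of _ "r * z"]) (simp add: algebra_simps)
qed

lemma triple_span_generators: "i \<in> triple_span i j k" "j \<in> triple_span i j k" "k \<in> triple_span i j k"
proof -
  show "i \<in> triple_span i j k" unfolding triple_span_def
    by (rule CollectI, rule exI[of _ 1], rule exI[of _ 0], rule exI[of _ 0]) simp
  show "j \<in> triple_span i j k" unfolding triple_span_def
    by (rule CollectI, rule exI[of _ 0], rule exI[of _ 1], rule exI[of _ 0]) simp
  show "k \<in> triple_span i j k" unfolding triple_span_def
    by (rule CollectI, rule exI[of _ 0], rule exI[of _ 0], rule exI[of _ 1]) simp
qed

lemma (in pq_triple) triple_span_linear:
  assumes "E \<in> triple_span i j k" shows "linear E"
  using assms by (auto simp: triple_span_def linear_iff lin_simps algebra_simps)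

lemma (in pq_triple) triple_span_expand:
  assumes "E \<in> triple_span i j k"
  shows "E v = (a * lin_trace (\<lambda>v. i (E v)) / DIM('e)) *\<^sub>R i v + (b * lin_trace (\<lambda>v. j (E v)) / DIM('e)) *\<^sub>R j v
    + (c * lin_trace (\<lambda>v. k (E v)) / DIM('e)) *\<^sub>R k v"
proof -
  obtain x y z where E: "E = comb x y z"
    using assms by (auto simp: triple_span_def comb_def[abs_def])
  show ?thesis unfolding E comb_trace
    using sq_signs(1-3) by (simp add: comb_def mult.assoc[symmetric])
qed

text \<open>The tensor \<open>\<Sum> \<epsilon>\<^sub>\<alpha> J\<^sub>\<alpha> \<otimes> J\<^sub>\<alpha>\<close> is proportional to the inverse of the trace form on the span,
  so it does not depend on the adapted basis. Here it is contracted with an arbitrary bilinear map \<open>\<beta>\<close>.\<close>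

lemma casimir_independent:
  fixes \<beta> :: "('e::euclidean_space \<Rightarrow> 'e) \<Rightarrow> ('e \<Rightarrow> 'e) \<Rightarrow> 'b::real_vector"
  assumes t: "pq_triple a b c i j k" and t': "pq_triple a' b' c' i' j' k'"
    and eq: "triple_span i j k = triple_span i' j' k'"
    and l: "\<And>x y z p q r F. \<beta> (\<lambda>v. x *\<^sub>R p v + y *\<^sub>R q v + z *\<^sub>R r v) F = x *\<^sub>R \<beta> p F + y *\<^sub>R \<beta> q F + z *\<^sub>R \<beta> r F"
    and r: "\<And>x y z p q r F. \<beta> F (\<lambda>v. x *\<^sub>R p v + y *\<^sub>R q v + z *\<^sub>R r v) = x *\<^sub>R \<beta> F p + y *\<^sub>R \<beta> F q + z *\<^sub>R \<beta> F r"
  shows "a *\<^sub>R \<beta> i i + b *\<^sub>R \<beta> j j + c *\<^sub>R \<beta> k k = a' *\<^sub>R \<beta> i' i' + b' *\<^sub>R \<beta> j' j' + c' *\<^sub>R \<beta> k' k'"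
proof -
  interpret t: pq_triple a b c i j k by (rule t)
  interpret t': pq_triple a' b' c' i' j' k' by (rule t')
  define \<tau> where "\<tau> E F = lin_trace (\<lambda>v. E (F v)) / DIM('e)" for E F :: "'e \<Rightarrow> 'e"
  have \<tau>: "\<tau> E F = \<tau> F E" if "linear E" "linear F" for E F
    unfolding \<tau>_def using lin_trace_commute[OF that] by simp
  have expand: "E = (\<lambda>v. (a * \<tau> i E) *\<^sub>R i v + (b * \<tau> j E) *\<^sub>R j v + (c * \<tau> k E) *\<^sub>R k v)"
    if "E \<in> triple_span i j k" for E
    unfolding \<tau>_def times_divide_eq_right by (rule ext) (rule t.triple_span_expand[OF that])
  have expand': "E = (\<lambda>v. (a' * \<tau> i' E) *\<^sub>R i' v + (b' * \<tau> j' E) *\<^sub>R j' v + (c' * \<tau> k' E) *\<^sub>R k' v)"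
    if "E \<in> triple_span i j k" for E
    unfolding \<tau>_def times_divide_eq_right by (rule ext) (rule t'.triple_span_expand[OF that[unfolded eq]])
  note gen = triple_span_generators[where i = i and j = j and k = k]
  note gen' = triple_span_generators[where i = i' and j = j' and k = k', folded eq]
  have 1: "\<beta> F E = (a * \<tau> i E) *\<^sub>R \<beta> F i + (b * \<tau> j E) *\<^sub>R \<beta> F j + (c * \<tau> k E) *\<^sub>R \<beta> F k"
    if "E \<in> triple_span i j k" for E F
    by (subst expand[OF that]) (rule r)
  have 2: "\<beta> E F = (a' * \<tau> i' E) *\<^sub>R \<beta> i' F + (b' * \<tau> j' E) *\<^sub>R \<beta> j' F + (c' * \<tau> k' E) *\<^sub>R \<beta> k' F"
    if "E \<in> triple_span i j k" for E F
    by (subst expand'[OF that]) (rule l)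
  note lin = t.i_lin t.j_lin t.k_lin t'.i_lin t'.j_lin t'.k_lin
  show ?thesis
    unfolding 1[OF gen'(1)] 1[OF gen'(2)] 1[OF gen'(3)] 2[OF gen(1)] 2[OF gen(2)] 2[OF gen(3)]
      \<tau>[OF lin(4,1)] \<tau>[OF lin(4,2)] \<tau>[OF lin(4,3)] \<tau>[OF lin(5,1)] \<tau>[OF lin(5,2)] \<tau>[OF lin(5,3)]
      \<tau>[OF lin(6,1)] \<tau>[OF lin(6,2)] \<tau>[OF lin(6,3)]
    by (simp add: scaleR_right_distrib mult.commute mult.left_commute add_ac)
qed

section \<open>Curvature tensors over the para-quaternionic algebra\<close>

lemma algebraic_curvatureD:
  assumes "algebraic_curvature_tensor h R"
  shows "bilinear (\<lambda>u v. R u v w)" "linear (R u v)" "R u v w = - R v u w"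
    "h (R u v w) x = - h w (R u v x)" "R u v w + R v w u + R w u v = 0"
  using assms unfolding algebraic_curvature_tensor_def by blast+

lemma algebraic_curvature_linear:
  assumes "algebraic_curvature_tensor h R"
  shows "linear (\<lambda>u. R u v w)" "linear (\<lambda>v. R u v w)"
  using algebraic_curvatureD(1)[OF assms] by (auto simp: bilinear_def)

lemma (in nondegenerate_form) curvature_pair_symmetry:
  assumes R: "algebraic_curvature_tensor h R"
  shows "h (R u v w) x = h (R w x u) v"
proof -
  define K where "K u v w x = h (R u v w) x" for u v w x
  have K1: "K u v w x = - K v u w x" for u v w x
    unfolding K_def using algebraic_curvatureD(3)[OF R, of u v w] by (simp add: h_simps)
  have K2: "K u v w x = - K u v x w" for u v w x
    unfolding K_def algebraic_curvatureD(4)[OF R, of u v w x] by (simp add: sym)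
  have K3: "K u v w x + K v w u x + K w u v x = 0" for u v w x
    unfolding K_def using algebraic_curvatureD(5)[OF R, of u v w] by (metis h_simps(1) h_simps(9))
  have "K u v w x = K w x u v"
    using K3[of u v w x] K3[of v w x u] K3[of w x u v] K3[of x u v w]
      K2[of w x v u] K2[of u v x w] K2[of v w u x] K2[of x u w v]
      K1[of u w x v] K2[of w u x v] K1[of v x u w] K2[of x v u w] by linarith
  then show ?thesis by (simp add: K_def)
qed

locale pq_form = nondegenerate_form h + pq_triple a b c i j k
  for h :: "'e::euclidean_space \<Rightarrow> 'e \<Rightarrow> real" and a b c :: real and i j k :: "'e \<Rightarrow> 'e" +
  assumes i_skew: "h (i u) v = - h u (i v)" and j_skew: "h (j u) v = - h u (j v)"
    and k_skew: "h (k u) v = - h u (k v)"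
begin

lemma neutral: "neutral_form h"
proof -
  have "\<exists>J. linear J \<and> (\<forall>v. J (J v) = v) \<and> (\<forall>u v. h (J u) v = - h u (J v))"
    using signs
  proof (elim insertE emptyE)
    assume "(a, b, c) = (- 1, 1, 1)"
    then show ?thesis using j_lin jj j_skew by (intro exI[of _ j]) auto
  next
    assume "(a, b, c) = (1, - 1, 1)"
    then show ?thesis using i_lin ii i_skew by (intro exI[of _ i]) auto
  next
    assume "(a, b, c) = (1, 1, - 1)"
    then show ?thesis using i_lin ii i_skew by (intro exI[of _ i]) auto
  qed
  then obtain J where "linear J" "\<And>v. J (J v) = v" "\<And>u v. h (J u) v = - h u (J v)" by blast
  then show ?thesis by (intro neutral_form_if_anti_isometric_involution[of J]) auto
qed

text \<open>The two parts of the model curvature tensor: \<open>q\<close> takes values in the span of the generators,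
  \<open>w\<close> in their commutant.\<close>

definition q :: "'e \<Rightarrow> 'e \<Rightarrow> 'e \<Rightarrow> 'e" where
  "q X Y Z = (a * h (i X) Y) *\<^sub>R i Z + (b * h (j X) Y) *\<^sub>R j Z + (c * h (k X) Y) *\<^sub>R k Z"

definition w :: "'e \<Rightarrow> 'e \<Rightarrow> 'e \<Rightarrow> 'e" where
  "w X Y Z = wedge h X Y Z - (a *\<^sub>R wedge h (i X) (i Y) Z + b *\<^sub>R wedge h (j X) (j Y) Z + c *\<^sub>R wedge h (k X) (k Y) Z)"

definition model :: "'e \<Rightarrow> 'e \<Rightarrow> 'e \<Rightarrow> 'e" where
  "model X Y Z = (1/2) *\<^sub>R q X Y Z + (1/4) *\<^sub>R w X Y Z"

lemma w_commutes:
  assumes "e \<in> {i, j, k}"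
  shows "w X Y (e Z) = e (w X Y Z)"
  unfolding w_def wedge_def using assms signs
  by (elim insertE emptyE)
    (simp_all add: i_skew j_skew k_skew table lin_simps h_simps, (simp_all add: algebra_simps)?)

lemma model_commutator:
  assumes "e \<in> {i, j, k}"
  shows "model X Y (e Z) - e (model X Y Z) = (1/2) *\<^sub>R (q X Y (e Z) - e (q X Y Z))"
proof -
  have "linear e" using assms i_lin j_lin k_lin by auto
  then show ?thesis
    unfolding model_def w_commutes[OF assms] by (simp add: linear_add linear_scale algebra_simps)
qed

lemma q_commutator_in_span:
  assumes "e \<in> {i, j, k}"
  shows "(\<lambda>Z. q X Y (e Z) - e (q X Y Z)) \<in> triple_span i j k"
proof -
  have "(\<lambda>Z. q X Y (i Z) - i (q X Y Z)) = (\<lambda>Z. 0 *\<^sub>R i Z + (2 * c * h (k X) Y * - a) *\<^sub>R j Z + (- 2 * b * h (j X) Y) *\<^sub>R k Z)"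
    by (rule ext) (simp add: q_def table lin_simps algebra_simps flip: scaleR_2)
  moreover have "(\<lambda>Z. q X Y (j Z) - j (q X Y Z)) = (\<lambda>Z. (2 * c * h (k X) Y * b) *\<^sub>R i Z + 0 *\<^sub>R j Z + (2 * a * h (i X) Y) *\<^sub>R k Z)"
    by (rule ext) (simp add: q_def table lin_simps algebra_simps flip: scaleR_2)
  moreover have "(\<lambda>Z. q X Y (k Z) - k (q X Y Z)) = (\<lambda>Z. (- 2 * b * h (j X) Y * b) *\<^sub>R i Z + (2 * a * h (i X) Y * a) *\<^sub>R j Z + 0 *\<^sub>R k Z)"
    by (rule ext) (simp add: q_def table lin_simps algebra_simps flip: scaleR_2)
  ultimately show ?thesis using assms unfolding triple_span_def by blast
qed

lemma q_bilinear: "bilinear (\<lambda>X Y. q X Y Z)"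
  unfolding bilinear_def linear_iff by (simp add: q_def lin_simps h_simps algebra_simps)

lemma model_algebraic: "algebraic_curvature_tensor h model"
proof -
  have "bilinear (\<lambda>X Y. model X Y Z)" for Z unfolding bilinear_def linear_iff
    by (simp add: model_def q_def w_def wedge_def lin_simps h_simps algebra_simps)
  moreover have "linear (model X Y)" for X Y unfolding linear_iff
    by (simp add: model_def q_def w_def wedge_def lin_simps h_simps algebra_simps)
  moreover have "model X Y Z = - model Y X Z" for X Y Z
  proof -
    have "h (i X) Y = - h (i Y) X" "h (j X) Y = - h (j Y) X" "h (k X) Y = - h (k Y) X"
      using i_skew[of X Y] j_skew[of X Y] k_skew[of X Y] by (simp_all add: sym[of X])
    then show ?thesis by (simp add: model_def q_def w_def wedge_def algebra_simps)
  qed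
  moreover have "h (model X Y Z) U = - h Z (model X Y U)" for X Y Z U
    by (simp add: model_def q_def w_def wedge_def lin_simps h_simps i_skew[of Z U] j_skew[of Z U] k_skew[of Z U] sym[of Z])
      (simp add: field_simps)
  moreover have "model X Y Z + model Y Z X + model Z X Y = 0" for X Y Z
  proof -
    have anti: "h (i u) v = - h (i v) u" "h (j u) v = - h (j v) u" "h (k u) v = - h (k v) u" for u v
      unfolding i_skew[of u] j_skew[of u] k_skew[of u] by (simp_all add: sym[of u])
    have s: "h (i Y) X = - h (i X) Y" "h (i Z) X = - h (i X) Z" "h (i Z) Y = - h (i Y) Z"
      "h (j Y) X = - h (j X) Y" "h (j Z) X = - h (j X) Z" "h (j Z) Y = - h (j Y) Z"
      "h (k Y) X = - h (k X) Y" "h (k Z) X = - h (k X) Z" "h (k Z) Y = - h (k Y) Z"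
      "h Y X = h X Y" "h Z X = h X Z" "h Z Y = h Y Z"
      by (rule anti sym)+
    show ?thesis by (simp add: model_def q_def w_def wedge_def s algebra_simps flip: scaleR_2)
  qed
  ultimately show ?thesis unfolding algebraic_curvature_tensor_def by blast
qed

lemma model_ricci: "ricci_contraction model Y Z = (DIM('e) / 4 + 2) * h Y Z"
proof -
  have t: "lin_trace (\<lambda>u. (r * h (f u) v) *\<^sub>R x) = r * h (f x) v" if "linear f" for f r v x
  proof (rule lin_trace_rank_one)
    show "linear (\<lambda>u. r * h (f u) v)"
      using that by (auto simp: linear_iff h_simps algebra_simps)
  qed
  note t' = t[OF i_lin] t[OF j_lin] t[OF k_lin] t[OF linear_id, unfolded id_def]
  have "lin_trace (\<lambda>X. model X Y Z) =
    lin_trace (\<lambda>X. (1/2) *\<^sub>R ((a * h (i X) Y) *\<^sub>R i Z + (b * h (j X) Y) *\<^sub>R j Z + (c * h (k X) Y) *\<^sub>R k Z)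
     + (1/4) *\<^sub>R (h Y Z *\<^sub>R X - (1 * h X Z) *\<^sub>R Y
       - ((a * h (i Y) Z) *\<^sub>R i X - (a * h (i X) Z) *\<^sub>R i Y
        + ((b * h (j Y) Z) *\<^sub>R j X - (b * h (j X) Z) *\<^sub>R j Y)
        + ((c * h (k Y) Z) *\<^sub>R k X - (c * h (k X) Z) *\<^sub>R k Y))))"
    by (rule arg_cong[where f = lin_trace], rule ext)
      (simp add: model_def q_def w_def wedge_def algebra_simps)
  also have "\<dots> = (1/2) * (a * h (i (i Z)) Y + b * h (j (j Z)) Y + c * h (k (k Z)) Y)
    + (1/4) * (h Y Z * DIM('e) - h Y Z + a * h (i (i Y)) Z + b * h (j (j Y)) Z + c * h (k (k Y)) Z)"
    unfolding lin_trace_add lin_trace_diff lin_trace_scaleR t' trace_i trace_j trace_k lin_trace_ident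
    by simp
  also have "\<dots> = (DIM('e) / 4 + 2) * h Y Z"
    using sq_signs(1-3) by (simp add: table h_simps mult.assoc[symmetric] sym[of Z Y] field_simps)
  finally show ?thesis by (simp add: ricci_contraction_def)
qed

text \<open>The trace of the Bianchi identity makes the Ricci form symmetric, since curvature operators are
  trace-free. They remain trace-free after composition with \<open>i\<close>, as this anticommutes with \<open>j\<close>; so
  the trace of the Bianchi identity composed with \<open>i\<close>, in which \<open>i\<close> can be moved to another argument
  by the pair symmetry, makes the Ricci form skew as well.\<close>

lemma commuting_ricci_zero:
  assumes W: "algebraic_curvature_tensor h W"
    and comm: "\<And>X Y Z. W X Y (i Z) = i (W X Y Z)" "\<And>X Y Z. W X Y (j Z) = j (W X Y Z)"
  shows "ricci_contraction W Y Z = 0"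
proof -
  note lin = algebraic_curvatureD(2)[OF W] algebraic_curvature_linear[OF W]
  define Ric where "Ric Y Z = lin_trace (\<lambda>X. W X Y Z)" for Y Z
  have move: "W (i X) Y Z = - W X (i Y) Z" for X Y Z
  proof (rule h_eqI)
    fix U
    have "h (W (i X) Y Z) U = h (i (W Z U X)) Y"
      by (simp add: curvature_pair_symmetry[OF W, of "i X"] comm)
    also have "\<dots> = - h (W X (i Y) Z) U"
      by (simp add: i_skew curvature_pair_symmetry[OF W, of X])
    finally show "h (W (i X) Y Z) U = h (- W X (i Y) Z) U" by (simp add: h_simps)
  qed
  have ric_i: "lin_trace (\<lambda>X. i (W X Y Z)) = - Ric (i Y) Z" for Y Z
    using lin_trace_commute[OF lin(2) i_lin, of Y Z] by (simp add: move lin_trace_minus Ric_def)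
  have bianchi: "W X Y Z = W X Z Y - W Y Z X" for X Y Z
    using algebraic_curvatureD(5)[OF W, of X Y Z] algebraic_curvatureD(3)[OF W, of Z X Y]
    by (simp add: algebra_simps eq_neg_iff_add_eq_0)
  have tr_i: "lin_trace (\<lambda>X. i (W Y Z X)) = 0" for Y Z
  proof -
    have "lin_trace (\<lambda>X. j (j (i (W Y Z X)))) = lin_trace (\<lambda>X. j (i (W Y Z (j X))))"
    proof (rule lin_trace_commute[where f = "\<lambda>X. j (i (W Y Z X))" and g = j, OF _ j_lin])
      show "linear (\<lambda>X. j (i (W Y Z X)))"
        by (simp add: linear_iff lin_simps linear_add[OF lin(1)] linear_scale[OF lin(1)])
    qed
    then have "b * lin_trace (\<lambda>X. i (W Y Z X)) = - b * lin_trace (\<lambda>X. i (W Y Z X))"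
      by (simp add: comm table lin_simps lin_trace_minus lin_trace_scaleR)
    then show ?thesis using sq_signs(2) by auto
  qed
  have tr: "lin_trace (W Y Z) = 0" for Y Z
    by (rule skew_trace_zero[OF lin(1)]) (rule algebraic_curvatureD(4)[OF W])
  have Ric_i: "Ric (i Y) Z = Ric (i Z) Y" for Y Z
  proof -
    have "(\<lambda>X. i (W X Y Z)) = (\<lambda>X. i (W X Z Y) - i (W Y Z X))"
      by (rule ext) (simp only: bianchi[of _ Y Z] lin_simps)
    then have "lin_trace (\<lambda>X. i (W X Y Z)) = lin_trace (\<lambda>X. i (W X Z Y) - i (W Y Z X))" by simp
    then show ?thesis by (simp add: lin_trace_diff ric_i tr_i)
  qed
  have Ric_i': "Ric Y (i Z) = - Ric (i Y) Z" for Y Z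
    using ric_i[of Y Z] by (simp add: Ric_def comm)
  have Ric_scale: "Ric (r *\<^sub>R Y) Z = r * Ric Y Z" "Ric Y (r *\<^sub>R Z) = r * Ric Y Z" for r Y Z
    by (simp_all add: Ric_def linear_scale[OF lin(1)] linear_scale[OF lin(3)] lin_trace_scaleR)
  have "Ric Z (i Y) = - Ric (i Y) Z" for Y Z using Ric_i Ric_i' by metis
  from this[of Z "a *\<^sub>R i Y"] have skew: "Ric Z Y = - Ric Y Z"
    using sq_signs(1) by (simp add: lin_simps table)
  have "Ric Y Z = lin_trace (\<lambda>X. W X Z Y - W Y Z X)" unfolding Ric_def
    by (rule arg_cong[where f = lin_trace], rule ext) (rule bianchi)
  then have "Ric Y Z = Ric Z Y" by (simp add: lin_trace_diff tr Ric_def)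
  with skew show ?thesis by (simp add: Ric_def ricci_contraction_def)
qed

text \<open>If only the part with values in the span fails to commute with the generators, and it does so
  as in the model, then the difference to the model is of the type demanded in dimension four.\<close>

lemma curvature_decomposition:
  assumes R: "algebraic_curvature_tensor h R"
    and comm: "\<And>X Y Z e. e \<in> {i, j, k} \<Longrightarrow> R X Y (e Z) - e (R X Y Z) = \<kappa> *\<^sub>R (q X Y (e Z) - e (q X Y Z))"
  defines "W \<equiv> \<lambda>X Y Z. R X Y Z - (2 * \<kappa>) *\<^sub>R model X Y Z"
  shows "algebraic_curvature_tensor h W" "ricci_contraction W Y Z = 0" "invariant_tensor (triple_span i j k) W"
proof -
  note M = model_algebraic
  show alg: "algebraic_curvature_tensor h W"
    unfolding algebraic_curvature_tensor_def
  proof (intro conjI allI)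
    show "bilinear (\<lambda>u v. W u v w)" for w
      using algebraic_curvatureD(1)[OF R, of w] algebraic_curvatureD(1)[OF M, of w]
      unfolding bilinear_def linear_iff W_def by (simp add: algebra_simps)
    show "linear (W u v)" for u v
      using algebraic_curvatureD(2)[OF R, of u v] algebraic_curvatureD(2)[OF M, of u v]
      unfolding linear_iff W_def by (simp add: algebra_simps)
    show "W u v w = - W v u w" for u v w
      using algebraic_curvatureD(3)[OF R, of u v w] algebraic_curvatureD(3)[OF M, of u v w]
      unfolding W_def by simp
    show "h (W u v w) x = - h w (W u v x)" for u v w x
      using algebraic_curvatureD(4)[OF R, of u v w x] algebraic_curvatureD(4)[OF M, of u v w x]
      unfolding W_def by (simp add: h_simps)
    show "W u v w + W v w u + W w u v = 0" for u v w
    proof -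
      have "W u v w + W v w u + W w u v = (R u v w + R v w u + R w u v) -
        (2 * \<kappa>) *\<^sub>R (model u v w + model v w u + model w u v)" unfolding W_def by (simp add: algebra_simps)
      then show ?thesis using algebraic_curvatureD(5)[OF R] algebraic_curvatureD(5)[OF M] by simp
    qed
  qed
  have W_comm: "W X Y (e Z) = e (W X Y Z)" if "e \<in> {i, j, k}" for X Y Z e
  proof -
    have "linear e" using that i_lin j_lin k_lin by auto
    then have "W X Y (e Z) - e (W X Y Z) = (R X Y (e Z) - e (R X Y Z)) - (2 * \<kappa>) *\<^sub>R (model X Y (e Z) - e (model X Y Z))"
      unfolding W_def by (simp add: linear_diff linear_scale algebra_simps)
    also have "\<dots> = 0" unfolding comm[OF that] model_commutator[OF that] by simp
    finally show ?thesis by simp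
  qed
  show "ricci_contraction W Y Z = 0"
    by (rule commuting_ricci_zero[OF alg W_comm W_comm]) auto
  have move: "W (e X) Y Z = - W X (e Y) Z" if e: "e \<in> {i, j, k}" for e X Y Z
  proof (rule h_eqI)
    fix U
    have skew: "h (e u) v = - h u (e v)" for u v using e i_skew j_skew k_skew by auto
    have "h (W (e X) Y Z) U = h (e (W Z U X)) Y"
      by (simp add: curvature_pair_symmetry[OF alg, of "e X"] W_comm[OF e])
    also have "\<dots> = - h (W X (e Y) Z) U"
      by (simp add: skew curvature_pair_symmetry[OF alg, of X])
    finally show "h (W (e X) Y Z) U = h (- W X (e Y) Z) U" by (simp add: h_simps)
  qed
  note lin = algebraic_curvatureD(2)[OF alg] algebraic_curvature_linear[OF alg]
  note ls = lin[THEN linear_add] lin[THEN linear_scale]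
  show "invariant_tensor (triple_span i j k) W"
    unfolding invariant_tensor_def triple_span_def
    by (auto simp: ls W_comm move algebra_simps)
qed

text \<open>Only the model contributes to the scalar curvature. In dimension four its Ricci form is \<open>3 h\<close>, so
  the scalar curvature is \<open>12 \<nu>\<close>, and 12 is the normalising factor \<open>4 n (n + 2)\<close> for \<open>n = 1\<close>.\<close>

lemma reduced_scal_eq:
  assumes Gz: "G z = h" and dim: "DIM('e) = 4"
    and W: "algebraic_curvature_tensor h W" "\<And>v w. ricci_contraction W v w = 0"
    and R: "\<And>X Y Z. curvature G z X Y Z = \<nu> *\<^sub>R model X Y Z + W X Y Z"
  shows "reduced_scal G z = \<nu>"
proof -
  have ric: "ricci_contraction (curvature G z) v w = 3 * \<nu> * h v w" for v w
    using W(2)[of v w] model_ricci[of v w] dim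
    unfolding ricci_contraction_def R by (simp add: lin_trace_add lin_trace_scaleR)
  have "(THE L. linear L \<and> (\<forall>v w. h (L v) w = 3 * \<nu> * h v w)) = (\<lambda>v. (3 * \<nu>) *\<^sub>R v)"
  proof (rule the_equality)
    show "linear (\<lambda>v. (3 * \<nu>) *\<^sub>R v) \<and> (\<forall>v w. h ((3 * \<nu>) *\<^sub>R v) w = 3 * \<nu> * h v w)"
      by (simp add: h_simps linear_iff algebra_simps)
    fix L assume L: "linear L \<and> (\<forall>v w. h (L v) w = 3 * \<nu> * h v w)"
    show "L = (\<lambda>v. (3 * \<nu>) *\<^sub>R v)"
      by (rule ext, rule h_eqI) (use L in \<open>simp add: h_simps\<close>)
  qed
  then have "scal G z = 12 * \<nu>"
    unfolding scal_def Gz ric using dim by (simp add: lin_trace_scaleR[of _ "\<lambda>v. v"] lin_trace_ident)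
  then show ?thesis by (simp add: reduced_scal_def dim Let_def)
qed

text \<open>For a non-null vector the four vectors are orthogonal and non-null.\<close>

lemma spanning_vector:
  assumes dim: "DIM('e) = 4"
  obtains x where "h x x \<noteq> 0" "span {x, i x, j x, k x} = UNIV"
proof -
  have "\<exists>x. h x x \<noteq> 0"
  proof (rule ccontr)
    assume "\<nexists>x. h x x \<noteq> 0"
    then have 0: "h x x = 0" for x by blast
    have "h x y = 0" for x y
      using 0[of "x + y"] 0[of x] 0[of y] by (simp add: h_simps sym[of y x])
    then have "x = 0" for x using nondeg by blast
    then show False using nonempty_Basis nonzero_Basis by blast
  qed
  then obtain x where x: "h x x \<noteq> 0" by blast
  have skew0: "h (i y) y = 0" "h (j y) y = 0" "h (k y) y = 0" for y
    using i_skew[of y y] j_skew[of y y] k_skew[of y y] sym[of y] by (simp_all add: eq_neg_iff_add_eq_0)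
  have skew1: "h y (i y) = 0" "h y (j y) = 0" "h y (k y) = 0" for y
    using skew0 sym by metis+
  have notin: "u \<notin> span B" if "h u u \<noteq> 0" "\<And>y. y \<in> B \<Longrightarrow> h u y = 0" for u B
  proof
    assume "u \<in> span B"
    then have "h u u = 0" 
    proof (rule span_induct[where P = "\<lambda>y. h u y = 0"])
      show "subspace {y. h u y = 0}" by (auto simp: subspace_def h_simps)
    qed (use that(2) in auto)
    then show False using that(1) by simp
  qed
  have n: "h (i x) (i x) \<noteq> 0" "h (j x) (j x) \<noteq> 0" "h (k x) (k x) \<noteq> 0"
    using x sq_signs by (auto simp: i_skew j_skew k_skew table h_simps)
  have o: "h (i x) (j x) = 0" "h (i x) (k x) = 0" "h (j x) (k x) = 0"
    by (simp_all add: i_skew j_skew table h_simps skew1)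
  have grow: "independent (insert u B) \<and> card (insert u B) = Suc (card B)"
    if "u \<notin> span B" "independent B" "finite B" for u and B :: "'e set"
    using that by (auto simp: independent_insert span_base)
  have "x \<notin> span {i x, j x, k x}" by (rule notin[OF x]) (use skew1 in auto)
  moreover have "i x \<notin> span {j x, k x}" by (rule notin[OF n(1)]) (use o in auto)
  moreover have "j x \<notin> span {k x}" by (rule notin[OF n(2)]) (use o in auto)
  moreover have "k x \<notin> span {}" by (rule notin[OF n(3)]) auto
  ultimately have "independent {x, i x, j x, k x} \<and> card {x, i x, j x, k x} = 4"
    using grow[of "k x" "{}"] grow[of "j x" "{k x}"] grow[of "i x" "{j x, k x}"]
      grow[of x "{i x, j x, k x}"] by simp
  then have ind: "independent {x, i x, j x, k x}" and card: "card {x, i x, j x, k x} = 4" by blast+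
  have "UNIV \<subseteq> span {x, i x, j x, k x}"
    by (rule card_ge_dim_independent[OF subset_UNIV ind]) (simp add: card dim)
  with x show ?thesis using that by blast
qed

text \<open>A non-degenerate curvature-invariant quaternionic line \<open>T\<close> with a non-zero normal vector forces
  the commutators on \<open>T\<close> to be those of the model. The operators \<open>n \<mapsto> R X n Y\<close> on the normal space
  are, by the pair symmetry and the first Bianchi identity, all determined by \<open>P n = R x n x\<close> for one
  spanning vector \<open>x\<close>, and tangential curvatures are
  \<open>R (p x) (q x) = p P q - q P p\<close> on normal vectors. So the component of \<open>P\<close> commuting
  with the generators, which is four times smaller than \<open>P + \<Sum> \<epsilon>\<^sub>\<alpha> J\<^sub>\<alpha> P J\<^sub>\<alpha>\<close>, determines the
  commutators; these lie in the span of the generators, hence it is a scalar.\<close>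

lemma mixed_curvature:
  assumes R: "algebraic_curvature_tensor h R"
    and comm: "\<And>X Y e. e \<in> {i, j, k} \<Longrightarrow> (\<lambda>Z. R X Y (e Z) - e (R X Y Z)) \<in> triple_span i j k"
    and T: "subspace T" "\<And>t e. e \<in> {i, j, k} \<Longrightarrow> t \<in> T \<Longrightarrow> e t \<in> T"
    and x: "x \<in> T" "h x x \<noteq> 0" "T \<subseteq> span {x, i x, j x, k x}"
    and closed: "\<And>X Y Z. X \<in> T \<Longrightarrow> Y \<in> T \<Longrightarrow> Z \<in> T \<Longrightarrow> R X Y Z \<in> T"
    and decomp: "\<And>v. \<exists>t\<in>T. \<forall>s\<in>T. h (v - t) s = 0"
    and n0: "n0 \<noteq> 0" "\<And>t. t \<in> T \<Longrightarrow> h n0 t = 0"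
  shows "\<exists>\<kappa>. \<forall>X\<in>T. \<forall>Y\<in>T. \<forall>Z. \<forall>e\<in>{i, j, k}.
    R X Y (e Z) - e (R X Y Z) = \<kappa> *\<^sub>R (q X Y (e Z) - e (q X Y Z))"
proof -
  note lin = algebraic_curvatureD(2)[OF R] algebraic_curvature_linear[OF R]
  note pair = curvature_pair_symmetry[OF R]
  define N where "N = {n. \<forall>t\<in>T. h n t = 0}"
  have N: "n \<in> N \<longleftrightarrow> (\<forall>t\<in>T. h n t = 0)" for n by (simp add: N_def)
  have skew: "h (e u) v = - h u (e v)" and elin: "linear e" if "e \<in> {i, j, k}" for e u v
    using that i_skew j_skew k_skew i_lin j_lin k_lin by auto
  have eN: "e n \<in> N" if "e \<in> {i, j, k}" "n \<in> N" for e n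
    using that T(2) by (auto simp: N skew)
  have subN: "subspace N" by (auto simp: subspace_def N h_simps)
  have split: "\<exists>t\<in>T. \<exists>n\<in>N. v = t + n" for v
  proof -
    obtain t where "t \<in> T" "\<forall>s\<in>T. h (v - t) s = 0" using decomp by blast
    then show ?thesis by (intro bexI[of _ t] bexI[of _ "v - t"]) (auto simp: N)
  qed
  have TN: "u = 0" if "u \<in> T" "u \<in> N" for u
  proof (rule nondeg)
    fix v
    obtain t n where "t \<in> T" "n \<in> N" "v = t + n" using split by blast
    then show "h u v = 0" using that sym[of u n] by (simp add: N h_simps)
  qed
  have RN: "R X n Y \<in> N" if "X \<in> T" "Y \<in> T" "n \<in> N" for X Y n
  proof -
    have "h (R X n Y) t = 0" if t: "t \<in> T" for t
      using closed[OF \<open>Y \<in> T\<close> t \<open>X \<in> T\<close>] \<open>n \<in> N\<close> pair[of X n Y t] sym[of n] by (simp add: N)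
    then show ?thesis by (simp add: N)
  qed
  have comm0: "R X n (e Z) = e (R X n Z)" if X: "X \<in> T" and n: "n \<in> N" and e: "e \<in> {i, j, k}" for X n e Z
  proof -
    obtain \<alpha> \<beta> \<gamma> where E: "(\<lambda>Z. R X n (e Z) - e (R X n Z)) = comb \<alpha> \<beta> \<gamma>"
      using comm[OF e, of X n] by (auto simp: triple_span_def comb_def[abs_def])
    have "comb \<alpha> \<beta> \<gamma> t = 0" if t: "t \<in> T" for t
    proof (rule TN)
      show "comb \<alpha> \<beta> \<gamma> t \<in> T" unfolding comb_def
        using T(2)[OF _ t] by (intro subspace_add[OF T(1)] subspace_scale[OF T(1)]) auto
      show "comb \<alpha> \<beta> \<gamma> t \<in> N" unfolding E[symmetric]
        by (rule subspace_diff[OF subN RN[OF X T(2)[OF e t] n] eN[OF e RN[OF X t n]]])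
    qed
    moreover have "x \<noteq> 0" using x(2) h_simps by force
    ultimately have "\<alpha> = 0" "\<beta> = 0" "\<gamma> = 0" using comb_eq_zero[of x \<alpha> \<beta> \<gamma>] x(1) T(2) by auto
    then show ?thesis using fun_cong[OF E, of Z] by (simp add: comb_def)
  qed
  have move: "R (e X) n Y = - R X (e n) Y" if e: "e \<in> {i, j, k}" and X: "X \<in> T" and Y: "Y \<in> T" and n: "n \<in> N"
    for e X Y n
  proof (rule h_eqI)
    fix v
    obtain t n' where v: "t \<in> T" "n' \<in> N" "v = t + n'" using split by blast
    have "h (R (e X) n Y) t = 0" "h (R X (e n) Y) t = 0"
      using RN[OF T(2)[OF e X] Y n] RN[OF X Y eN[OF e n]] v(1) by (auto simp: N)
    moreover have "h (R (e X) n Y) n' = - h (R X (e n) Y) n'"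
      using pair[of "e X" n Y n'] pair[of X "e n" Y n'] by (simp add: comm0[OF Y v(2) e] skew[OF e])
    ultimately show "h (R (e X) n Y) v = h (- R X (e n) Y) v" by (simp add: v(3) h_simps)
  qed
  have bianchi: "R X Y n = R X n Y - R Y n X" for X Y n
    using algebraic_curvatureD(5)[OF R, of X Y n] algebraic_curvatureD(3)[OF R, of n X Y]
    by (simp add: algebra_simps eq_neg_iff_add_eq_0)
  define P where "P n = R x n x" for n
  have P_lin: "linear P" unfolding P_def by (rule lin(3))
  note P_simps = P_lin[THEN linear_add] P_lin[THEN linear_diff] P_lin[THEN linear_neg] P_lin[THEN linear_scale]
  have PN: "P n \<in> N" if "n \<in> N" for n unfolding P_def by (rule RN[OF x(1) x(1) that])
  have gens: "i \<in> {i, j, k}" "j \<in> {i, j, k}" "k \<in> {i, j, k}" by auto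
  note gN = eN[OF gens(1)] eN[OF gens(2)] eN[OF gens(3)]
  \<comment> \<open>tangential curvature on normal vectors in terms of \<open>P\<close>\<close>
  have A: "R x (e x) n = e (P n) + P (e n)" "R (e x) x n = - (e (P n) + P (e n))"
    "R (e x) (f x) n = e (P (f n)) - f (P (e n))" "R x x n = 0"
    if e: "e \<in> {i, j, k}" and f: "f \<in> {i, j, k}" and n: "n \<in> N" for e f n
  proof -
    note xT = x(1)
    show 1: "R x (e x) n = e (P n) + P (e n)"
      unfolding bianchi[of x "e x"] by (simp add: comm0[OF xT n e] move[OF e xT xT n] P_def)
    show "R (e x) x n = - (e (P n) + P (e n))"
      using algebraic_curvatureD(3)[OF R, of "e x" x n] 1 by simp
    show "R (e x) (f x) n = e (P (f n)) - f (P (e n))"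
      unfolding bianchi[of "e x" "f x"]
      by (simp add: comm0[OF T(2)[OF e xT] n f] comm0[OF T(2)[OF f xT] n e] move[OF e xT xT n] move[OF f xT xT n]
        linear_neg[OF elin[OF e]] linear_neg[OF elin[OF f]] P_def)
    show "R x x n = 0" using bianchi[of x x n] by simp
  qed
  note A' = A(1)[OF gens(1) gens(1)] A(1)[OF gens(2) gens(2)] A(1)[OF gens(3) gens(3)]
    A(2)[OF gens(1) gens(1)] A(2)[OF gens(2) gens(2)] A(2)[OF gens(3) gens(3)]
    A(3)[OF gens(1) gens(1)] A(3)[OF gens(1) gens(2)] A(3)[OF gens(1) gens(3)]
    A(3)[OF gens(2) gens(1)] A(3)[OF gens(2) gens(2)] A(3)[OF gens(2) gens(3)]
    A(3)[OF gens(3) gens(1)] A(3)[OF gens(3) gens(2)] A(3)[OF gens(3) gens(3)]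
    A(4)[OF gens(1) gens(1)]
  \<comment> \<open>on normal vectors the commutator with \<open>j\<close> of the operator for the pair \<open>x\<close>, \<open>i x\<close> anticommutes
     with \<open>i\<close> and \<open>j\<close>; so it is a multiple of \<open>k\<close>\<close>
  obtain \<alpha> \<beta> \<gamma> where E: "(\<lambda>Z. R x (i x) (j Z) - j (R x (i x) Z)) = comb \<alpha> \<beta> \<gamma>"
    using comm[OF gens(2), of x "i x"] by (auto simp: triple_span_def comb_def[abs_def])
  have E': "comb \<alpha> \<beta> \<gamma> n = i (P (j n)) + P (k n) - j (i (P n)) - j (P (i n))" if n: "n \<in> N" for n
    unfolding E[symmetric] by (simp add: A' n gN table lin_simps)
  have n0N: "n0 \<in> N" using n0 by (simp add: N)
  have "i (comb \<alpha> \<beta> \<gamma> n0) + comb \<alpha> \<beta> \<gamma> (i n0) = 0"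
    by (simp add: E' n0N gN table lin_simps P_simps)
  then have "\<alpha> = 0" using sq_signs(1) n0(1)
    by (simp add: comb_def lin_simps table algebra_simps flip: scaleR_2) auto
  have "j (comb \<alpha> \<beta> \<gamma> n0) + comb \<alpha> \<beta> \<gamma> (j n0) = 0"
    by (simp add: E' n0N gN table lin_simps P_simps)
  then have "\<beta> = 0" using sq_signs(2) n0(1)
    by (simp add: comb_def lin_simps table algebra_simps flip: scaleR_2) auto
  have scalar: "P n + a *\<^sub>R i (P (i n)) + b *\<^sub>R j (P (j n)) + c *\<^sub>R k (P (k n)) = \<gamma> *\<^sub>R n" if n: "n \<in> N" for n
  proof -
    have "comb \<alpha> \<beta> \<gamma> (c *\<^sub>R k n) = \<gamma> *\<^sub>R n"
      using sq_signs(3) by (simp add: comb_def \<open>\<alpha> = 0\<close> \<open>\<beta> = 0\<close> lin_simps table)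
    moreover have "c *\<^sub>R k n \<in> N" by (rule subspace_scale[OF subN gN(3)[OF n]])
    ultimately have "\<gamma> *\<^sub>R n = i (P (j (c *\<^sub>R k n))) + P (k (c *\<^sub>R k n)) - j (i (P (c *\<^sub>R k n))) - j (P (i (c *\<^sub>R k n)))"
      using E' by metis
    then show ?thesis using signs
      by (elim insertE emptyE) (simp_all add: table lin_simps P_simps algebra_simps)
  qed
  \<comment> \<open>from comparison with the model at the pair \<open>x\<close>, \<open>i x\<close>, where \<open>q x (i x) = - h x x i\<close>\<close>
  define \<kappa> where "\<kappa> = - \<gamma> / (2 * h x x)"
  have \<gamma>: "\<gamma> = - (\<kappa> * h x x) - \<kappa> * h x x" using x(2) by (simp add: \<kappa>_def)
  have h0: "h (i x) x = 0" "h (j x) x = 0" "h (k x) x = 0"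
    using i_skew[of x x] j_skew[of x x] k_skew[of x x] sym[of x] by (simp_all add: eq_neg_iff_add_eq_0)
  have h0': "h x (i x) = 0" "h x (j x) = 0" "h x (k x) = 0" using h0 sym by metis+
  have Q: "q x x Z = 0" "q (i x) (i x) Z = 0" "q (j x) (j x) Z = 0" "q (k x) (k x) Z = 0"
    "q x (i x) Z = - (h x x *\<^sub>R i Z)" "q x (j x) Z = - (h x x *\<^sub>R j Z)" "q x (k x) Z = - (h x x *\<^sub>R k Z)"
    "q (i x) x Z = h x x *\<^sub>R i Z" "q (j x) x Z = h x x *\<^sub>R j Z" "q (k x) x Z = h x x *\<^sub>R k Z"
    "q (i x) (j x) Z = - (h x x *\<^sub>R k Z)" "q (i x) (k x) Z = - ((a * h x x) *\<^sub>R j Z)" "q (j x) (k x) Z = (b * h x x) *\<^sub>R i Z"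
    "q (j x) (i x) Z = h x x *\<^sub>R k Z" "q (k x) (i x) Z = (a * h x x) *\<^sub>R j Z" "q (k x) (j x) Z = - ((b * h x x) *\<^sub>R i Z)"
    for Z
    unfolding q_def using signs by (elim insertE emptyE; simp add: i_skew j_skew k_skew table h_simps h0 h0')+
  have basic: "R X Y (e n) - e (R X Y n) = \<kappa> *\<^sub>R (q X Y (e n) - e (q X Y n))"
    if n: "n \<in> N" and e: "e \<in> {i, j, k}" and X: "X \<in> {x, i x, j x, k x}" and Y: "Y \<in> {x, i x, j x, k x}"
      for X Y e n
  proof -
    \<comment> \<open>the scalar identity at \<open>n\<close>, \<open>k n\<close>, \<open>j n\<close>, \<open>i n\<close>, solved for the terms starting with \<open>k P\<close>\<close>
    note sq = sq_signs(1-3)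
    have sq': "b * c * (b * c) = 1" "a * c * (a * c) = 1" using signs by auto
    have 1: "P n + a *\<^sub>R i (P (i n)) + b *\<^sub>R j (P (j n)) + c *\<^sub>R k (P (k n)) = \<gamma> *\<^sub>R n"
      by (rule scalar[OF n])
    have 2: "P (k n) + i (P (j n)) - j (P (i n)) + k (P n) = \<gamma> *\<^sub>R k n"
      using scalar[OF gN(3)[OF n]] by (simp add: table lin_simps P_simps sq)
    have 3: "P (j n) + a *\<^sub>R i (P (k n)) + j (P n) + (b * c) *\<^sub>R k (P (i n)) = \<gamma> *\<^sub>R j n"
      using scalar[OF gN(2)[OF n]] by (simp add: table lin_simps P_simps sq mult.commute)
    have 4: "P (i n) + i (P n) - b *\<^sub>R j (P (k n)) - (a * c) *\<^sub>R k (P (j n)) = \<gamma> *\<^sub>R i n"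
      using scalar[OF gN(1)[OF n]] by (simp add: table lin_simps P_simps sq mult.commute)
    have s: "k (P (k n)) = c *\<^sub>R (\<gamma> *\<^sub>R n - P n - a *\<^sub>R i (P (i n)) - b *\<^sub>R j (P (j n)))"
      "k (P n) = \<gamma> *\<^sub>R k n - P (k n) - i (P (j n)) + j (P (i n))"
      "k (P (i n)) = (b * c) *\<^sub>R (\<gamma> *\<^sub>R j n - P (j n) - a *\<^sub>R i (P (k n)) - j (P n))"
      "k (P (j n)) = (a * c) *\<^sub>R (P (i n) + i (P n) - b *\<^sub>R j (P (k n)) - \<gamma> *\<^sub>R i n)"
      unfolding 1[symmetric] 2[symmetric] 3[symmetric] 4[symmetric] by (simp_all add: sq sq' algebra_simps)
    consider "a = -1" "b = 1" "c = 1" | "a = 1" "b = -1" "c = 1" | "a = 1" "b = 1" "c = -1"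
      using signs by auto
    then have "\<forall>X\<in>{x, i x, j x, k x}. \<forall>Y\<in>{x, i x, j x, k x}. \<forall>e\<in>{i, j, k}.
      R X Y (e n) - e (R X Y n) = \<kappa> *\<^sub>R (q X Y (e n) - e (q X Y n))"
    proof cases
      case 1
      show ?thesis
        by (simp only: Set.ball_simps simp_thms Q A' n gN table lin_simps P_simps s)
          (simp add: 1 \<gamma> algebra_simps flip: scaleR_2)
    next
      case 2
      show ?thesis
        by (simp only: Set.ball_simps simp_thms Q A' n gN table lin_simps P_simps s)
          (simp add: 2 \<gamma> algebra_simps flip: scaleR_2)
    next
      case 3
      show ?thesis
        by (simp only: Set.ball_simps simp_thms Q A' n gN table lin_simps P_simps s)
          (simp add: 3 \<gamma> algebra_simps flip: scaleR_2)
    qed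
    then show ?thesis using X Y e by blast
  qed
  show ?thesis
  proof (intro exI ballI allI)
    fix X Y Z e assume X: "X \<in> T" and Y: "Y \<in> T" and e: "e \<in> {i, j, k}"
    have normal: "R X Y (e n) - e (R X Y n) = \<kappa> *\<^sub>R (q X Y (e n) - e (q X Y n))" if n: "n \<in> N" for n
    proof (rule bilinear_eq[where f = "\<lambda>X Y. R X Y (e n) - e (R X Y n)" and
        g = "\<lambda>X Y. \<kappa> *\<^sub>R (q X Y (e n) - e (q X Y n))"])
      show "bilinear (\<lambda>X Y. R X Y (e n) - e (R X Y n))"
        using algebraic_curvatureD(1)[OF R, of "e n"] algebraic_curvatureD(1)[OF R, of n]
        unfolding bilinear_def linear_iff
        by (simp add: linear_add[OF elin[OF e]] linear_scale[OF elin[OF e]] algebra_simps)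
      show "bilinear (\<lambda>X Y. \<kappa> *\<^sub>R (q X Y (e n) - e (q X Y n)))"
        using q_bilinear[of "e n"] q_bilinear[of n] unfolding bilinear_def linear_iff
        by (simp add: linear_add[OF elin[OF e]] linear_scale[OF elin[OF e]] algebra_simps)
    qed (use x(3) X Y basic[OF n e] in auto)
    have "(\<lambda>Z. (R X Y (e Z) - e (R X Y Z)) - \<kappa> *\<^sub>R (q X Y (e Z) - e (q X Y Z))) \<in> triple_span i j k"
      by (rule triple_span_closed(2)[OF comm[OF e] triple_span_closed(3)]) (rule q_commutator_in_span[OF e])+
    then obtain r s t where F: "(\<lambda>Z. (R X Y (e Z) - e (R X Y Z)) - \<kappa> *\<^sub>R (q X Y (e Z) - e (q X Y Z))) = comb r s t"
      by (auto simp: triple_span_def comb_def[abs_def])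
    have "comb r s t n = 0" if "n \<in> N" for n unfolding F[symmetric] by (simp add: normal[OF that])
    note z = this[OF n0N] this[OF gN(1)[OF n0N]] this[OF gN(2)[OF n0N]] this[OF gN(3)[OF n0N]]
    have "r = 0" "s = 0" "t = 0" by (rule comb_eq_zero[OF n0(1) z])+
    then show "R X Y (e Z) - e (R X Y Z) = \<kappa> *\<^sub>R (q X Y (e Z) - e (q X Y Z))"
      using fun_cong[OF F, of Z] by (simp add: comb_def)
  qed
qed

end

section \<open>Parallel para-quaternionic structures\<close>

lemma endo_span_closed:
  assumes "E \<in> endo_span J" "F \<in> endo_span J"
  shows "(\<lambda>v. E v + F v) \<in> endo_span J" "(\<lambda>v. E v - F v) \<in> endo_span J" "(\<lambda>v. r *\<^sub>R E v) \<in> endo_span J"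
  using triple_span_closed[of E "J 1" "J 2" "J 3" F] assms unfolding endo_span_eq_triple_span by blast+

lemma endo_span_scaleR: "E \<in> endo_span J \<Longrightarrow> (\<lambda>v. r *\<^sub>R E v) \<in> endo_span J"
  using endo_span_closed(3) .

lemma endo_span_generator: "\<alpha> \<in> {1, 2, 3} \<Longrightarrow> J \<alpha> \<in> endo_span J"
  unfolding endo_span_eq_triple_span using triple_span_generators by blast

lemma pq_basis_linear: "pq_basis \<epsilon> J \<Longrightarrow> \<alpha> \<in> {1, 2, 3} \<Longrightarrow> linear (J \<alpha>)"
  unfolding pq_basis_def by blast

context metric_patch
begin

lemma cov_deriv_endo_eq:
  "cov_deriv_endo G u E y w = D (\<lambda>y. E y w) y u + \<Gamma> y u (E y w) - E y (\<Gamma> y u w)"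
  by (simp add: cov_deriv_endo_def cov_deriv_def)

lemma cov_deriv_endo_smooth:
  assumes E: "\<And>y. y \<in> V \<Longrightarrow> linear (E y)" "\<And>w. smooth_on V (\<lambda>y. E y w)"
  shows "smooth_on V (\<lambda>y. cov_deriv_endo G u E y w)"
  unfolding cov_deriv_endo_eq
proof (rule smooth_on_diff[OF open_V smooth_on_add[OF open_V]])
  show "smooth_on V (\<lambda>y. D (\<lambda>y. E y w) y u)" by (rule smooth_on_D[OF E(2)])
  show "smooth_on V (\<lambda>y. \<Gamma> y u (E y w))"
    by (rule smooth_on_linear_family[where B = "\<lambda>y. \<Gamma> y u", OF open_V \<Gamma>_linear(1) \<Gamma>_smooth E(2)])
  show "smooth_on V (\<lambda>y. E y (\<Gamma> y u w))"
    by (rule smooth_on_linear_family[where B = E, OF open_V E \<Gamma>_smooth])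
qed

text \<open>In a coordinate frame the covariant derivatives commute up to the curvature, which acts on
  endomorphisms by commutators.\<close>

lemma ricci_identity:
  assumes E: "\<And>y. y \<in> V \<Longrightarrow> linear (E y)" "\<And>w. smooth_on V (\<lambda>y. E y w)" and z: "z \<in> V"
  shows "cov_deriv_endo G u (cov_deriv_endo G v E) z w - cov_deriv_endo G v (cov_deriv_endo G u E) z w
    = curvature G z u v (E z w) - E z (curvature G z u v w)"
proof -
  have "((\<lambda>y. cov_deriv_endo G v E y w) has_derivative
     (\<lambda>u. D (\<lambda>y. D (\<lambda>y. E y w) y v) z u
        + (D\<Gamma> z u v (E z w) + \<Gamma> z v (D (\<lambda>y. E y w) z u))
        - (D (\<lambda>y. E y (\<Gamma> z v w)) z u + E z (D\<Gamma> z u v w)))) (at z)" for v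
    unfolding cov_deriv_endo_eq
  proof (intro has_derivative_diff has_derivative_add)
    show "((\<lambda>y. D (\<lambda>y. E y w) y v) has_derivative D (\<lambda>y. D (\<lambda>y. E y w) y v) z) (at z)"
      by (rule smooth_on_has_derivative[OF smooth_on_D[OF E(2)] z])
    show "((\<lambda>y. \<Gamma> y v (E y w)) has_derivative (\<lambda>u. D\<Gamma> z u v (E z w) + \<Gamma> z v (D (\<lambda>y. E y w) z u))) (at z)"
      by (rule has_derivative_linear_family[where B = "\<lambda>y. \<Gamma> y v"
        and B' = "\<lambda>u w. D\<Gamma> z u v w", OF open_V z \<Gamma>_linear(1)])
        (auto intro: smooth_on_has_derivative[OF \<Gamma>_smooth z] smooth_on_has_derivative[OF E(2) z])
    show "((\<lambda>y. E y (\<Gamma> y v w)) has_derivative (\<lambda>u. D (\<lambda>y. E y (\<Gamma> z v w)) z u + E z (D\<Gamma> z u v w))) (at z)"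
      by (rule has_derivative_linear_family[where B = E and B' = "\<lambda>u w. D (\<lambda>y. E y w) z u", OF open_V z E(1)])
        (auto intro: smooth_on_has_derivative[OF \<Gamma>_smooth z] smooth_on_has_derivative[OF E(2) z])
  qed
  note 1 = D_eq[OF this]
  have 2: "D (\<lambda>y. D (\<lambda>y. E y w) y v) z u = D (\<lambda>y. D (\<lambda>y. E y w) y u) z v"
    by (rule D_commute[OF open_V z E(2)])
  note Es = E(1)[OF z, THEN linear_add] E(1)[OF z, THEN linear_diff]
  show ?thesis
    by (simp add: cov_deriv_endo_eq[of u "cov_deriv_endo G v E"] cov_deriv_endo_eq[of v "cov_deriv_endo G u E"] 1 2)
      (simp add: cov_deriv_endo_eq curvature_eq \<Gamma>_simps[OF z] Es)
qed

end

locale pq_patch = metric_patch V G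
  for V :: "'e::euclidean_space set" and G :: "'e \<Rightarrow> 'e \<Rightarrow> 'e \<Rightarrow> real" +
  fixes \<epsilon> :: "nat \<Rightarrow> real" and J :: "'e \<Rightarrow> nat \<Rightarrow> 'e \<Rightarrow> 'e"
  assumes basis: "z \<in> V \<Longrightarrow> pq_basis \<epsilon> (J z)"
    and J_smooth: "\<alpha> \<in> {1, 2, 3} \<Longrightarrow> smooth_on V (\<lambda>y. J y \<alpha> v)"
    and J_skew: "z \<in> V \<Longrightarrow> \<alpha> \<in> {1, 2, 3} \<Longrightarrow> G z (J z \<alpha> u) v = - G z u (J z \<alpha> v)"
    and parallel: "(\<And>w. smooth_on V (\<lambda>y. E y w)) \<Longrightarrow> (\<And>y. y \<in> V \<Longrightarrow> E y \<in> endo_span (J y)) \<Longrightarrow>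
      z \<in> V \<Longrightarrow> cov_deriv_endo G u E z \<in> endo_span (J z)"
begin

lemma J_linear: "z \<in> V \<Longrightarrow> \<alpha> \<in> {1, 2, 3} \<Longrightarrow> linear (J z \<alpha>)"
  using pq_basis_linear[OF basis] .

lemma form: "z \<in> V \<Longrightarrow> pq_form (G z) (\<epsilon> 1) (\<epsilon> 2) (\<epsilon> 3) (J z 1) (J z 2) (J z 3)"
proof (rule pq_form.intro)
  assume z: "z \<in> V"
  show "nondegenerate_form (G z)" by (rule G_form[OF z])
  show "pq_triple (\<epsilon> 1) (\<epsilon> 2) (\<epsilon> 3) (J z 1) (J z 2) (J z 3)"
    using basis[OF z] unfolding pq_basis_iff_triple .
  show "pq_form_axioms (G z) (J z 1) (J z 2) (J z 3)"
    by (rule pq_form_axioms.intro; rule J_skew[OF z]) auto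
qed

lemma cov_deriv_J_in_span: "z \<in> V \<Longrightarrow> \<alpha> \<in> {1, 2, 3} \<Longrightarrow> cov_deriv_endo G u (\<lambda>y. J y \<alpha>) z \<in> endo_span (J z)"
  by (rule parallel) (auto intro: J_smooth endo_span_generator)

lemma curvature_commutator_in_span:
  assumes z: "z \<in> V" and \<alpha>: "\<alpha> \<in> {1, 2, 3}"
  shows "(\<lambda>w. curvature G z u v (J z \<alpha> w) - J z \<alpha> (curvature G z u v w)) \<in> endo_span (J z)"
proof -
  have "cov_deriv_endo G u (cov_deriv_endo G v (\<lambda>y. J y \<alpha>)) z \<in> endo_span (J z)" for u v
    by (rule parallel[OF cov_deriv_endo_smooth cov_deriv_J_in_span])
      (use J_linear J_smooth \<alpha> z in auto)
  from endo_span_closed(2)[OF this[of u v] this[of v u]]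
  have "(\<lambda>w. cov_deriv_endo G u (cov_deriv_endo G v (\<lambda>y. J y \<alpha>)) z w
    - cov_deriv_endo G v (cov_deriv_endo G u (\<lambda>y. J y \<alpha>)) z w) \<in> endo_span (J z)" .
  moreover have "cov_deriv_endo G u (cov_deriv_endo G v (\<lambda>y. J y \<alpha>)) z w
    - cov_deriv_endo G v (cov_deriv_endo G u (\<lambda>y. J y \<alpha>)) z w
    = curvature G z u v (J z \<alpha> w) - J z \<alpha> (curvature G z u v w)" for w
    by (rule ricci_identity[where E = "\<lambda>y. J y \<alpha>"]) (rule J_linear J_smooth \<alpha> z | assumption)+
  ultimately show ?thesis by (simp only:)
qed

end

section \<open>Para-quaternionic submanifolds in coordinates\<close>

text \<open>Here \<open>f\<close> is the inclusion in coordinates and \<open>g\<close> the induced metric. The metric is a parameter and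
  not defined by \<open>f\<close>, because on the whole chart it is computed with varying ambient charts and agrees
  with the pullback by \<open>f\<close> only on \<open>U\<close>.\<close>

locale pq_submanifold_patch = pq_patch V G \<epsilon> J
  for V :: "'e::euclidean_space set" and G \<epsilon> J +
  fixes U :: "'f::euclidean_space set" and f :: "'f \<Rightarrow> 'e" and g :: "'f \<Rightarrow> 'f \<Rightarrow> 'f \<Rightarrow> real"
  assumes open_U: "open U" and f_smooth: "smooth_on U f"
    and f_V: "y \<in> U \<Longrightarrow> f y \<in> V" and Df_inj: "y \<in> U \<Longrightarrow> inj (D f y)"
    and g_eq: "y \<in> U \<Longrightarrow> g y u v = G (f y) (D f y u) (D f y v)"
    and g_nondeg: "y \<in> U \<Longrightarrow> (\<And>v. g y u v = 0) \<Longrightarrow> u = 0"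
    and invariant: "y \<in> U \<Longrightarrow> \<alpha> \<in> {1, 2, 3} \<Longrightarrow> J (f y) \<alpha> (D f y u) \<in> range (D f y)"
begin

lemma Df_linear: "y \<in> U \<Longrightarrow> linear (D f y)"
  by (rule linear_D[OF smooth_on_differentiable[OF f_smooth]])

lemma Df_eq_iff: "y \<in> U \<Longrightarrow> D f y u = D f y v \<longleftrightarrow> u = v"
  using Df_inj by (auto dest: injD)

lemmas Df_simps = linear_add[OF Df_linear] linear_diff[OF Df_linear] linear_neg[OF Df_linear]
  linear_scale[OF Df_linear] linear_0[OF Df_linear]

lemma smooth_pullback: "smooth_on V F \<Longrightarrow> smooth_on U (\<lambda>y. F (f y))"
  by (rule smooth_on_compose[OF open_U open_V f_V f_smooth])

sublocale M: metric_patch U g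
proof
  show "open U" by (rule open_U)
  fix z assume z: "z \<in> U"
  show "bilinear (g z)" unfolding bilinear_def linear_iff
    by (simp add: g_eq[OF z] Df_simps[OF z] G_simps[OF f_V[OF z]])
  show "g z u v = g z v u" for u v
    unfolding g_eq[OF z] by (rule sym[OF f_V[OF z]])
  show "(\<And>v. g z u v = 0) \<Longrightarrow> u = 0" for u by (rule g_nondeg[OF z])
next
  fix u v
  have "smooth_on U (\<lambda>y. G (f y) (D f y u) (D f y v))"
    by (rule smooth_on_bilinear_family[where B = "\<lambda>y. G (f y)", OF open_U])
      (auto intro: bil f_V smooth_pullback[OF smooth] smooth_on_D[OF f_smooth])
  then show "smooth_on U (\<lambda>z. g z u v)"
    by (rule smooth_on_cong[OF open_U, rotated]) (simp add: g_eq)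
qed

definition JM :: "'f \<Rightarrow> nat \<Rightarrow> 'f \<Rightarrow> 'f" where
  "JM y \<alpha> u = inv (D f y) (J (f y) \<alpha> (D f y u))"

lemma Df_JM: "y \<in> U \<Longrightarrow> \<alpha> \<in> {1, 2, 3} \<Longrightarrow> D f y (JM y \<alpha> u) = J (f y) \<alpha> (D f y u)"
  unfolding JM_def using invariant by (rule f_inv_into_f)

lemma JM_smooth: "\<alpha> \<in> {1, 2, 3} \<Longrightarrow> smooth_on U (\<lambda>y. JM y \<alpha> v)"
proof (rule M.smooth_representing_field[OF open_U order_refl, where \<omega> = "\<lambda>y w. G (f y) (J (f y) \<alpha> (D f y v)) (D f y w)"])
  fix w assume \<alpha>: "\<alpha> \<in> {1, 2, 3}"
  have "smooth_on U (\<lambda>y. J (f y) \<alpha> (D f y v))"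
    by (rule smooth_on_linear_family[where B = "\<lambda>y. J (f y) \<alpha>",
      OF open_U J_linear[OF f_V \<alpha>] smooth_pullback[OF J_smooth[OF \<alpha>]] smooth_on_D[OF f_smooth]])
  then show "smooth_on U (\<lambda>y. G (f y) (J (f y) \<alpha> (D f y v)) (D f y w))"
    by (rule smooth_on_bilinear_family[where B = "\<lambda>y. G (f y)", OF open_U _ smooth_pullback[OF smooth] _
      smooth_on_D[OF f_smooth], rotated]) (rule bil[OF f_V])
qed (simp add: g_eq Df_JM)

lemma JM_triple:
  assumes y: "y \<in> U"
  shows "pq_triple (\<epsilon> 1) (\<epsilon> 2) (\<epsilon> 3) (JM y 1) (JM y 2) (JM y 3)"
proof -
  interpret t: pq_triple "\<epsilon> 1" "\<epsilon> 2" "\<epsilon> 3" "J (f y) 1" "J (f y) 2" "J (f y) 3"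
    using basis[OF f_V[OF y]] unfolding pq_basis_iff_triple .
  have lin: "linear (JM y \<alpha>)" if \<alpha>: "\<alpha> \<in> {1, 2, 3}" for \<alpha>
  proof (rule linearI)
    note l = J_linear[OF f_V[OF y] \<alpha>]
    show "JM y \<alpha> (u + v) = JM y \<alpha> u + JM y \<alpha> v" for u v
      unfolding Df_eq_iff[OF y, symmetric] by (simp add: Df_JM[OF y \<alpha>] Df_simps[OF y] linear_add[OF l])
    show "JM y \<alpha> (r *\<^sub>R v) = r *\<^sub>R JM y \<alpha> v" for r v
      unfolding Df_eq_iff[OF y, symmetric] by (simp add: Df_JM[OF y \<alpha>] Df_simps[OF y] linear_scale[OF l])
  qed
  have i: "D f y (JM y 1 u) = J (f y) 1 (D f y u)" and j: "D f y (JM y 2 u) = J (f y) 2 (D f y u)"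
    and k: "D f y (JM y 3 u) = J (f y) 3 (D f y u)" for u
    by (rule Df_JM[OF y], blast)+
  show ?thesis
    by (rule pq_triple.intro, rule t.signs, (rule lin, blast)+;
        unfold Df_eq_iff[OF y, symmetric] Df_simps[OF y] i j k;
        rule t.ii t.jj t.kk t.ij t.ji)
qed

lemma JM_basis: "y \<in> U \<Longrightarrow> pq_basis \<epsilon> (JM y)"
  unfolding pq_basis_iff_triple by (rule JM_triple)

lemma JM_skew: "y \<in> U \<Longrightarrow> \<alpha> \<in> {1, 2, 3} \<Longrightarrow> g y (JM y \<alpha> u) v = - g y u (JM y \<alpha> v)"
  by (simp only: g_eq Df_JM J_skew f_V)

lemma JM_form: "y \<in> U \<Longrightarrow> pq_form (g y) (\<epsilon> 1) (\<epsilon> 2) (\<epsilon> 3) (JM y 1) (JM y 2) (JM y 3)"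
proof (rule pq_form.intro)
  assume y: "y \<in> U"
  show "nondegenerate_form (g y)" by (rule M.G_form[OF y])
  show "pq_triple (\<epsilon> 1) (\<epsilon> 2) (\<epsilon> 3) (JM y 1) (JM y 2) (JM y 3)" by (rule JM_triple[OF y])
  show "pq_form_axioms (g y) (JM y 1) (JM y 2) (JM y 3)"
    by (rule pq_form_axioms.intro; rule JM_skew[OF y]) auto
qed

lemma JM_span:
  assumes y: "y \<in> U"
  shows "endo_span (JM y) = {F. \<exists>E\<in>endo_span (J (f y)). \<forall>u. D f y (F u) = E (D f y u)}"
proof -
  have *: "D f y (r *\<^sub>R JM y 1 u + s *\<^sub>R JM y 2 u + t *\<^sub>R JM y 3 u)
    = r *\<^sub>R J (f y) 1 (D f y u) + s *\<^sub>R J (f y) 2 (D f y u) + t *\<^sub>R J (f y) 3 (D f y u)" for r s t u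
    using Df_JM[OF y, of 1 u] Df_JM[OF y, of 2 u] Df_JM[OF y, of 3 u] by (simp add: Df_simps[OF y])
  show ?thesis unfolding endo_span_eq_triple_span
  proof (intro set_eqI iffI)
    fix F assume "F \<in> triple_span (JM y 1) (JM y 2) (JM y 3)"
    then obtain r s t where F: "F = (\<lambda>u. r *\<^sub>R JM y 1 u + s *\<^sub>R JM y 2 u + t *\<^sub>R JM y 3 u)"
      unfolding triple_span_def by blast
    have "(\<lambda>v. r *\<^sub>R J (f y) 1 v + s *\<^sub>R J (f y) 2 v + t *\<^sub>R J (f y) 3 v)
      \<in> triple_span (J (f y) 1) (J (f y) 2) (J (f y) 3)" unfolding triple_span_def by blast
    with * show "F \<in> {F. \<exists>E\<in>triple_span (J (f y) 1) (J (f y) 2) (J (f y) 3). \<forall>u. D f y (F u) = E (D f y u)}"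
      unfolding F mem_Collect_eq by (intro bexI) auto
  next
    fix F assume "F \<in> {F. \<exists>E\<in>triple_span (J (f y) 1) (J (f y) 2) (J (f y) 3). \<forall>u. D f y (F u) = E (D f y u)}"
    then obtain r s t where F: "D f y (F u) = r *\<^sub>R J (f y) 1 (D f y u) + s *\<^sub>R J (f y) 2 (D f y u) + t *\<^sub>R J (f y) 3 (D f y u)" for u
      unfolding triple_span_def by blast
    have "F = (\<lambda>u. r *\<^sub>R JM y 1 u + s *\<^sub>R JM y 2 u + t *\<^sub>R JM y 3 u)"
      by (rule ext, subst Df_eq_iff[OF y, symmetric]) (simp only: F *)
    then show "F \<in> triple_span (JM y 1) (JM y 2) (JM y 3)" unfolding triple_span_def by blast
  qed
qed

text \<open>The ambient covariant derivative of the coordinate field \<open>v\<close> in the direction \<open>u\<close>; its normal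
  component is the second fundamental form.\<close>

definition amb :: "'f \<Rightarrow> 'f \<Rightarrow> 'f \<Rightarrow> 'e" where
  "amb y u v = D (\<lambda>y. D f y v) y u + \<Gamma> (f y) (D f y u) (D f y v)"

lemma D2f_linear:
  assumes "z \<in> U"
  shows "linear (\<lambda>u. D (\<lambda>y. D f y v) z u)" "linear (\<lambda>v. D (\<lambda>y. D f y v) z u)"
   apply (rule linear_D[OF smooth_on_differentiable[OF smooth_on_D[OF f_smooth] assms]])
  by (rule linear_D_family[where B = "\<lambda>y. D f y", OF open_U assms Df_linear smooth_on_D[OF f_smooth]])

lemma D2f_sym: "z \<in> U \<Longrightarrow> D (\<lambda>y. D f y v) z u = D (\<lambda>y. D f y u) z v"
  by (rule D_commute[OF open_U _ f_smooth])

lemma amb_sym: "z \<in> U \<Longrightarrow> amb z u v = amb z v u"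
  unfolding amb_def using D2f_sym \<Gamma>_sym[OF f_V] by metis

lemma amb_bilinear:
  assumes z: "z \<in> U" shows "bilinear (amb z)"
proof -
  note l = D2f_linear[OF z]
  show ?thesis unfolding bilinear_def linear_iff
    by (simp add: amb_def l[THEN linear_add] l[THEN linear_scale] Df_simps[OF z] \<Gamma>_simps[OF f_V[OF z]] algebra_simps)
qed

lemma has_derivative_Df_field:
  assumes z: "z \<in> U" and Y: "(Y has_derivative Y') (at z)"
  shows "((\<lambda>y. D f y (Y y)) has_derivative (\<lambda>u. D (\<lambda>y. D f y (Y z)) z u + D f z (Y' u))) (at z)"
  by (rule has_derivative_linear_family[where B = "\<lambda>y. D f y"
    and B' = "\<lambda>u v. D (\<lambda>y. D f y v) z u", OF open_U z Df_linear _ Y])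
    (auto intro: smooth_on_has_derivative[OF smooth_on_D[OF f_smooth] z])

text \<open>Differentiate \<open>D f (JM v) = J (D f v)\<close> along the submanifold.\<close>

lemma amb_JM:
  assumes z: "z \<in> U" and \<alpha>: "\<alpha> \<in> {1, 2, 3}"
  shows "amb z u (JM z \<alpha> v) + D f z (D (\<lambda>y. JM y \<alpha> v) z u)
    = J (f z) \<alpha> (amb z u v) + cov_deriv_endo G (D f z u) (\<lambda>y. J y \<alpha>) (f z) (D f z v)"
proof -
  have pz: "f z \<in> V" by (rule f_V[OF z])
  have "((\<lambda>y. D f y (JM y \<alpha> v)) has_derivative
     (\<lambda>u. D (\<lambda>y. D f y (JM z \<alpha> v)) z u + D f z (D (\<lambda>y. JM y \<alpha> v) z u))) (at z)"
    by (rule has_derivative_Df_field[OF z smooth_on_has_derivative[OF JM_smooth[OF \<alpha>] z]])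
  then have 1: "((\<lambda>y. J (f y) \<alpha> (D f y v)) has_derivative
     (\<lambda>u. D (\<lambda>y. D f y (JM z \<alpha> v)) z u + D f z (D (\<lambda>y. JM y \<alpha> v) z u))) (at z)"
    by (rule has_derivative_transform_within_open[OF _ open_U z]) (rule Df_JM[OF _ \<alpha>])
  have 2: "((\<lambda>y. J (f y) \<alpha> w) has_derivative (\<lambda>u. D (\<lambda>y. J y \<alpha> w) (f z) (D f z u))) (at z)" for w
    using diff_chain_at[OF smooth_on_has_derivative[OF f_smooth z] smooth_on_has_derivative[OF J_smooth[OF \<alpha>] pz]]
    by (simp add: o_def)
  have "((\<lambda>y. J (f y) \<alpha> (D f y v)) has_derivative
     (\<lambda>u. D (\<lambda>y. J y \<alpha> (D f z v)) (f z) (D f z u) + J (f z) \<alpha> (D (\<lambda>y. D f y v) z u))) (at z)"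
    by (rule has_derivative_linear_family[where B = "\<lambda>y. J (f y) \<alpha>", OF open_U z J_linear[OF f_V \<alpha>] 2
      smooth_on_has_derivative[OF smooth_on_D[OF f_smooth] z]])
  from has_derivative_unique[OF 1 this, THEN fun_cong, of u] show ?thesis
    by (simp add: amb_def cov_deriv_endo_eq Df_JM[OF z \<alpha>] linear_add[OF J_linear[OF pz \<alpha>]] algebra_simps)
qed

lemma range_Df_subspace: "y \<in> U \<Longrightarrow> subspace (range (D f y))"
  by (rule linear_subspace_image[OF Df_linear subspace_UNIV])

lemma endo_span_invariant:
  assumes y: "y \<in> U" and E: "E \<in> endo_span (J (f y))"
  shows "E (D f y u) \<in> range (D f y)"
proof -
  obtain r s t where "E = (\<lambda>u. r *\<^sub>R J (f y) 1 u + s *\<^sub>R J (f y) 2 u + t *\<^sub>R J (f y) 3 u)"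
    using E unfolding endo_span_eq_triple_span triple_span_def by blast
  then show ?thesis
    using invariant[OF y, of 1 u] invariant[OF y, of 2 u] invariant[OF y, of 3 u]
    by (auto intro!: subspace_add[OF range_Df_subspace[OF y]] subspace_scale[OF range_Df_subspace[OF y]])
qed

text \<open>Modulo tangent vectors \<open>amb\<close> is symmetric and, as \<open>Q\<close> is parallel and preserves the tangent
  space, bilinear over \<open>Q\<close>. Evaluating \<open>amb (J\<^sub>1 u) (J\<^sub>2 v)\<close> in two ways gives
  \<open>J\<^sub>1 J\<^sub>2 amb u v = J\<^sub>2 J\<^sub>1 amb u v\<close>, which by anticommutation is only possible if \<open>amb u v\<close> is tangent.\<close>

lemma amb_tangent:
  assumes z: "z \<in> U"
  shows "amb z u v \<in> range (D f z)"
proof -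
  let ?T = "range (D f z)"
  have pz: "f z \<in> V" by (rule f_V[OF z])
  note T = range_Df_subspace[OF z]
  interpret t: pq_triple "\<epsilon> 1" "\<epsilon> 2" "\<epsilon> 3" "J (f z) 1" "J (f z) 2" "J (f z) 3"
    using basis[OF pz] unfolding pq_basis_iff_triple .
  have JT: "J (f z) \<alpha> x \<in> ?T" if "x \<in> ?T" "\<alpha> \<in> {1, 2, 3}" for x \<alpha>
    using that invariant[OF z] by auto
  have 1: "amb z u (JM z \<alpha> v) - J (f z) \<alpha> (amb z u v) \<in> ?T" if \<alpha>: "\<alpha> \<in> {1, 2, 3}" for \<alpha> u v
  proof -
    have "amb z u (JM z \<alpha> v) - J (f z) \<alpha> (amb z u v)
      = cov_deriv_endo G (D f z u) (\<lambda>y. J y \<alpha>) (f z) (D f z v) - D f z (D (\<lambda>y. JM y \<alpha> v) z u)"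
      using amb_JM[OF z \<alpha>, of u v] by (simp add: algebra_simps)
    also have "\<dots> \<in> ?T"
      by (intro subspace_diff[OF T] endo_span_invariant[OF z cov_deriv_J_in_span[OF pz \<alpha>]] rangeI)
    finally show ?thesis .
  qed
  have 2: "amb z (JM z \<alpha> u) v - J (f z) \<alpha> (amb z u v) \<in> ?T" if \<alpha>: "\<alpha> \<in> {1, 2, 3}" for \<alpha> u v
    using 1[OF \<alpha>, of v u] by (simp only: amb_sym[OF z, of v])
  have in12: "1 \<in> {1, 2, 3::nat}" "2 \<in> {1, 2, 3::nat}" "3 \<in> {1, 2, 3::nat}" by auto
  let ?i = "J (f z) 1" and ?j = "J (f z) 2" and ?k = "J (f z) 3" and ?x = "amb z u v"
  have "?j (amb z (JM z 1 u) v - ?i ?x) \<in> ?T" by (rule JT[OF 2[OF in12(1)] in12(2)])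
  from subspace_add[OF T 1[OF in12(2), of "JM z 1 u" v] this]
  have 3: "amb z (JM z 1 u) (JM z 2 v) + ?k ?x \<in> ?T"
    by (simp only: t.lin_simps t.ji) (simp add: algebra_simps)
  have "?i (amb z u (JM z 2 v) - ?j ?x) \<in> ?T" by (rule JT[OF 1[OF in12(2)] in12(1)])
  from subspace_add[OF T 2[OF in12(1), of u "JM z 2 v"] this]
  have 4: "amb z (JM z 1 u) (JM z 2 v) - ?k ?x \<in> ?T"
    by (simp only: t.lin_simps t.ij) (simp add: algebra_simps)
  have "?k ?x = (1/2) *\<^sub>R ((amb z (JM z 1 u) (JM z 2 v) + ?k ?x) - (amb z (JM z 1 u) (JM z 2 v) - ?k ?x))"
    by (simp flip: scaleR_2)
  also have "\<dots> \<in> ?T" by (rule subspace_scale[OF T subspace_diff[OF T 3 4]])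
  finally have "?k (?k ?x) \<in> ?T" by (rule JT[OF _ in12(3)])
  then have "\<epsilon> 3 *\<^sub>R ?k (?k ?x) \<in> ?T" by (rule subspace_scale[OF T])
  then show ?thesis using t.sq_signs(3) by (simp only: t.kk) simp
qed

text \<open>As \<open>amb\<close> is tangent, it defines a connection on the submanifold; this is symmetric and
  compatible with the induced metric, hence the Levi-Civita connection.\<close>

lemma christoffel_tangential:
  assumes z: "z \<in> U"
  shows "D f z (christoffel g z u v) = amb z u v"
proof -
  have pz: "f z \<in> V" by (rule f_V[OF z])
  define \<Delta> where "\<Delta> u v = inv (D f z) (amb z u v)" for u v
  have \<Delta>: "D f z (\<Delta> u v) = amb z u v" for u v
    unfolding \<Delta>_def by (rule f_inv_into_f[OF amb_tangent[OF z]])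
  note a = amb_bilinear[OF z]
  have "christoffel g z = \<Delta>"
  proof (rule M.christoffel_eqI[OF z])
    show "bilinear \<Delta>" unfolding bilinear_def linear_iff Df_eq_iff[OF z, symmetric]
      by (simp add: \<Delta> Df_simps[OF z] bilinear_ladd[OF a] bilinear_radd[OF a] bilinear_lmul[OF a] bilinear_rmul[OF a])
    show "\<Delta> u v = \<Delta> v u" for u v by (simp add: \<Delta>_def amb_sym[OF z, of u v])
    fix u v w
    have "((\<lambda>y. G (f y) (D f y v) (D f y w)) has_derivative (\<lambda>u.
        G (f z) (D (\<lambda>y. D f y v) z u + \<Gamma> (f z) (D f z u) (D f z v)) (D f z w) +
        G (f z) (D f z v) (D (\<lambda>y. D f y w) z u + \<Gamma> (f z) (D f z u) (D f z w)))) (at z)"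
      by (rule metric_compatible_along[OF open_U z f_V])
        (auto intro: smooth_on_has_derivative[OF _ z] smooth_on_D f_smooth)
    then have "((\<lambda>y. g y v w) has_derivative (\<lambda>u.
        G (f z) (amb z u v) (D f z w) + G (f z) (D f z v) (amb z u w))) (at z)"
      unfolding amb_def by (rule has_derivative_transform_within_open[OF _ open_U z]) (simp add: g_eq)
    from D_eq[OF this] show "D (\<lambda>y. g y v w) z u = g z (\<Delta> u v) w + g z v (\<Delta> u w)"
      by (simp add: g_eq[OF z] \<Delta>)
  qed
  then show ?thesis using \<Delta> by simp
qed

text \<open>Both sides are the commutator of the covariant derivatives of the field \<open>D f w\<close> along the
  inclusion: \<open>key\<close> differentiates \<open>D f (\<Gamma> v w) = amb v w\<close> once more, and in the difference over the
  exchange of \<open>u\<close> and \<open>v\<close> only the curvature terms remain.\<close>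

lemma gauss_equation:
  assumes z: "z \<in> U"
  shows "D f z (curvature g z u v w) = curvature G (f z) (D f z u) (D f z v) (D f z w)"
proof -
  have pz: "f z \<in> V" by (rule f_V[OF z])
  note lin = Df_simps[OF z] \<Gamma>_simps[OF pz]
  note dD = smooth_on_has_derivative[OF smooth_on_D[OF f_smooth] z]
  have key: "D f z (D (\<lambda>y. christoffel g y v w) z u) + amb z u (christoffel g z v w)
    = D (\<lambda>y. D (\<lambda>y. D f y w) y v) z u + D\<Gamma> (f z) (D f z u) (D f z v) (D f z w)
      + (\<Gamma> (f z) (D f z v) (D (\<lambda>y. D f y w) z u) + \<Gamma> (f z) (D f z u) (D (\<lambda>y. D f y w) z v))
      + \<Gamma> (f z) (D (\<lambda>y. D f y v) z u) (D f z w)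
      + \<Gamma> (f z) (D f z u) (\<Gamma> (f z) (D f z v) (D f z w))" for u v
  proof -
    have "((\<lambda>y. D f y (christoffel g y v w)) has_derivative
       (\<lambda>u. D (\<lambda>y. D f y (christoffel g z v w)) z u + D f z (D (\<lambda>y. christoffel g y v w) z u))) (at z)"
      by (rule has_derivative_Df_field[OF z smooth_on_has_derivative[OF M.\<Gamma>_smooth z]])
    then have 1: "((\<lambda>y. amb y v w) has_derivative
       (\<lambda>u. D (\<lambda>y. D f y (christoffel g z v w)) z u + D f z (D (\<lambda>y. christoffel g y v w) z u))) (at z)"
      by (rule has_derivative_transform_within_open[OF _ open_U z]) (rule christoffel_tangential)
    have 2: "((\<lambda>y. amb y v w) has_derivative
       (\<lambda>u. D (\<lambda>y. D (\<lambda>y. D f y w) y v) z u +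
         (D\<Gamma> (f z) (D f z u) (D f z v) (D f z w) + \<Gamma> (f z) (D f z v) (D (\<lambda>y. D f y w) z u)
          + \<Gamma> (f z) (D (\<lambda>y. D f y v) z u) (D f z w)))) (at z)"
      unfolding amb_def
      by (intro has_derivative_add has_derivative_\<Gamma>_along[OF open_U z f_V smooth_on_has_derivative[OF f_smooth z] dD dD]
        smooth_on_has_derivative[OF smooth_on_D[OF smooth_on_D[OF f_smooth]] z])
    have "amb z u (christoffel g z v w) = D (\<lambda>y. D f y (christoffel g z v w)) z u
      + \<Gamma> (f z) (D f z u) (D (\<lambda>y. D f y w) z v) + \<Gamma> (f z) (D f z u) (\<Gamma> (f z) (D f z v) (D f z w))"
      unfolding amb_def[of z u] christoffel_tangential[OF z] unfolding amb_def by (simp add: lin)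
    then show ?thesis using has_derivative_unique[OF 1 2, THEN fun_cong, of u] by (simp add: algebra_simps)
  qed
  have "D f z (curvature g z u v w) =
     (D f z (D (\<lambda>y. christoffel g y v w) z u) + amb z u (christoffel g z v w))
   - (D f z (D (\<lambda>y. christoffel g y u w) z v) + amb z v (christoffel g z u w))"
    unfolding M.curvature_eq by (simp add: lin christoffel_tangential[OF z])
  also have "\<dots> = curvature G (f z) (D f z u) (D f z v) (D f z w)"
    unfolding key curvature_eq D2f_sym[OF z, of v u]
      D_commute[OF open_U z smooth_on_D[OF f_smooth], of w v u] by simp
  finally show ?thesis .
qed

lemma cov_deriv_JM:
  assumes z: "z \<in> U" and \<alpha>: "\<alpha> \<in> {1, 2, 3}"
  shows "cov_deriv_endo g u (\<lambda>y. JM y \<alpha>) z \<in> endo_span (JM z)"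
proof -
  have "D f z (cov_deriv_endo g u (\<lambda>y. JM y \<alpha>) z w)
    = cov_deriv_endo G (D f z u) (\<lambda>y. J y \<alpha>) (f z) (D f z w)" for w
    using amb_JM[OF z \<alpha>, of u w]
    unfolding M.cov_deriv_endo_eq Df_simps[OF z] Df_JM[OF z \<alpha>] christoffel_tangential[OF z]
      by (simp add: algebra_simps)
  then show ?thesis unfolding JM_span[OF z] using cov_deriv_J_in_span[OF f_V[OF z] \<alpha>] by blast
qed

text \<open>The coefficients of a section with respect to \<open>JM\<close> are traces, hence smooth, and the product rule
  reduces the claim to the sections \<open>JM\<close>.\<close>

lemma M_parallel:
  assumes U': "open U'" "U' \<subseteq> U" and E: "\<And>w. smooth_on U' (\<lambda>y. E y w)"
    and span: "\<And>y. y \<in> U' \<Longrightarrow> E y \<in> endo_span (JM y)" and z: "z \<in> U'"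
  shows "cov_deriv_endo g u E z \<in> endo_span (JM z)"
proof -
  have zU: "z \<in> U" using z U' by blast
  have E_lin: "linear (E y)" if "y \<in> U'" for y
    using pq_triple.triple_span_linear[OF JM_triple] span[OF that] U'(2) that
      unfolding endo_span_eq_triple_span by blast
  define r where "r \<alpha> y = \<epsilon> \<alpha> * lin_trace (\<lambda>v. JM y \<alpha> (E y v)) / DIM('f)" for \<alpha> y
  have r_smooth: "smooth_on U' (r \<alpha>)" if \<alpha>: "\<alpha> \<in> {1, 2, 3}" for \<alpha>
  proof -
    have "smooth_on U' (\<lambda>y. JM y \<alpha> (E y b))" for b
      by (rule smooth_on_linear_family[where B = "\<lambda>y. JM y \<alpha>", OF U'(1) _ _ E])
        (use U'(2) pq_basis_linear[OF JM_basis \<alpha>] smooth_on_subset[OF JM_smooth[OF \<alpha>]] in auto)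
    then have "smooth_on U' (\<lambda>y. (\<epsilon> \<alpha> / DIM('f)) *\<^sub>R (\<Sum>b\<in>Basis. JM y \<alpha> (E y b) \<bullet> b))"
      by (intro smooth_on_bounded_linear[OF U'(1) bounded_linear_scaleR_right] smooth_on_sum[OF U'(1)]
        smooth_on_bounded_linear[OF U'(1) bounded_linear_inner_left])
    then show ?thesis by (simp add: r_def[abs_def] lin_trace_def)
  qed
  have expand: "E y w = r 1 y *\<^sub>R JM y 1 w + r 2 y *\<^sub>R JM y 2 w + r 3 y *\<^sub>R JM y 3 w" if y: "y \<in> U'" for y w
    unfolding r_def
    by (rule pq_triple.triple_span_expand[OF JM_triple])
      (use span[OF y] y U'(2) in \<open>auto simp only: endo_span_eq_triple_span\<close>)
  have in123: "1 \<in> {1, 2, 3::nat}" "2 \<in> {1, 2, 3::nat}" "3 \<in> {1, 2, 3::nat}" by auto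
  have der: "((\<lambda>y. r \<alpha> y *\<^sub>R JM y \<alpha> w) has_derivative
     (\<lambda>u. r \<alpha> z *\<^sub>R D (\<lambda>y. JM y \<alpha> w) z u + D (r \<alpha>) z u *\<^sub>R JM z \<alpha> w)) (at z)"
    if \<alpha>: "\<alpha> \<in> {1, 2, 3}" for \<alpha> w
    by (intro has_derivative_scaleR smooth_on_has_derivative[OF r_smooth[OF \<alpha>] z]
      smooth_on_has_derivative[OF JM_smooth[OF \<alpha>] zU])
  have "((\<lambda>y. E y w) has_derivative (\<lambda>u. (r 1 z *\<^sub>R D (\<lambda>y. JM y 1 w) z u + D (r 1) z u *\<^sub>R JM z 1 w)
     + (r 2 z *\<^sub>R D (\<lambda>y. JM y 2 w) z u + D (r 2) z u *\<^sub>R JM z 2 w)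
     + (r 3 z *\<^sub>R D (\<lambda>y. JM y 3 w) z u + D (r 3) z u *\<^sub>R JM z 3 w))) (at z)" for w
    by (rule has_derivative_transform_within_open[OF has_derivative_add[OF has_derivative_add[OF
      der[OF in123(1)] der[OF in123(2)]] der[OF in123(3)]] U'(1) z]) (rule expand[symmetric])
  note DE = D_eq[OF this]
  have "cov_deriv_endo g u E z = (\<lambda>w. D (r 1) z u *\<^sub>R JM z 1 w + D (r 2) z u *\<^sub>R JM z 2 w + D (r 3) z u *\<^sub>R JM z 3 w
     + (r 1 z *\<^sub>R cov_deriv_endo g u (\<lambda>y. JM y 1) z w + r 2 z *\<^sub>R cov_deriv_endo g u (\<lambda>y. JM y 2) z w
      + r 3 z *\<^sub>R cov_deriv_endo g u (\<lambda>y. JM y 3) z w))"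
    unfolding M.cov_deriv_endo_eq DE expand[OF z]
    by (rule ext) (simp only: M.\<Gamma>_simps[OF zU] scaleR_right_distrib scaleR_right_diff_distrib, simp add: algebra_simps)
  also have "\<dots> \<in> endo_span (JM z)"
    by (rule endo_span_closed(1)[OF endo_span_closed(1)[OF endo_span_closed(1)]
        endo_span_closed(1)[OF endo_span_closed(1)]];
      rule endo_span_scaleR, rule endo_span_generator cov_deriv_JM[OF zU], rule in123)
  finally show ?thesis .
qed

end

section \<open>Four-dimensional submanifolds\<close>

lemma R0_eq_sum:
  "R0 h \<epsilon> J X Y Z =
     (\<epsilon> 1 *\<^sub>R ((1/2) *\<^sub>R (h (J 1 X) Y *\<^sub>R J 1 Z) - (1/4) *\<^sub>R wedge h (J 1 X) (J 1 Y) Z) +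
      \<epsilon> 2 *\<^sub>R ((1/2) *\<^sub>R (h (J 2 X) Y *\<^sub>R J 2 Z) - (1/4) *\<^sub>R wedge h (J 2 X) (J 2 Y) Z) +
      \<epsilon> 3 *\<^sub>R ((1/2) *\<^sub>R (h (J 3 X) Y *\<^sub>R J 3 Z) - (1/4) *\<^sub>R wedge h (J 3 X) (J 3 Y) Z)) +
     (1/4) *\<^sub>R wedge h X Y Z"
  by (simp add: R0_def algebra_simps)

text \<open>Apart from one term without generators, \<open>R0\<close> is a contraction of \<open>\<Sum> \<epsilon>\<^sub>\<alpha> J\<^sub>\<alpha> \<otimes> J\<^sub>\<alpha>\<close>.\<close>

lemma R0_independent:
  assumes h: "bilinear h" and J: "pq_basis \<epsilon> J" and J': "pq_basis \<epsilon>' J'" and eq: "endo_span J = endo_span J'"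
  shows "R0 h \<epsilon> J X Y Z = R0 h \<epsilon>' J' X Y Z"
proof -
  define \<beta> where "\<beta> F F' = (1/2) *\<^sub>R (h (F X) Y *\<^sub>R F' Z) - (1/4) *\<^sub>R wedge h (F X) (F' Y) Z" for F F'
  note hs = bilinear_ladd[OF h] bilinear_radd[OF h] bilinear_lmul[OF h] bilinear_rmul[OF h]
  have "\<epsilon> 1 *\<^sub>R \<beta> (J 1) (J 1) + \<epsilon> 2 *\<^sub>R \<beta> (J 2) (J 2) + \<epsilon> 3 *\<^sub>R \<beta> (J 3) (J 3)
    = \<epsilon>' 1 *\<^sub>R \<beta> (J' 1) (J' 1) + \<epsilon>' 2 *\<^sub>R \<beta> (J' 2) (J' 2) + \<epsilon>' 3 *\<^sub>R \<beta> (J' 3) (J' 3)"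
    by (rule casimir_independent[OF J[unfolded pq_basis_iff_triple] J'[unfolded pq_basis_iff_triple]
        eq[unfolded endo_span_eq_triple_span]])
      (simp_all add: \<beta>_def wedge_def hs algebra_simps)
  then show ?thesis unfolding R0_eq_sum \<beta>_def by (simp only:)
qed

lemma R0_eq_model:
  assumes "pq_form h (\<epsilon> 1) (\<epsilon> 2) (\<epsilon> 3) (J 1) (J 2) (J 3)"
  shows "R0 h \<epsilon> J = pq_form.model h (\<epsilon> 1) (\<epsilon> 2) (\<epsilon> 3) (J 1) (J 2) (J 3)"
  unfolding pq_form.model_def[OF assms, abs_def] pq_form.q_def[OF assms] pq_form.w_def[OF assms]
  by (intro ext) (simp add: R0_eq_sum algebra_simps)

context pq_submanifold_patch
begin

lemma Df_R0:
  assumes z: "z \<in> U"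
  shows "D f z (R0 (g z) \<epsilon> (JM z) X Y Z) = R0 (G (f z)) \<epsilon> (J (f z)) (D f z X) (D f z Y) (D f z Z)"
proof -
  have J: "D f z (JM z 1 u) = J (f z) 1 (D f z u)" "D f z (JM z 2 u) = J (f z) 2 (D f z u)"
    "D f z (JM z 3 u) = J (f z) 3 (D f z u)" for u by (rule Df_JM[OF z], blast)+
  show ?thesis unfolding R0_eq_sum wedge_def g_eq[OF z] Df_simps[OF z] J ..
qed

text \<open>In equal dimensions \<open>D f\<close> is an isomorphism that carries over all tensors of the decomposition.\<close>

lemma decomposition_equal_dimension:
  assumes dim: "DIM('f) = DIM('e)" and z: "z \<in> U"
    and W: "algebraic_curvature_tensor (G (f z)) W" "\<And>v w. ricci_contraction W v w = 0"
      "invariant_tensor (endo_span (J (f z))) W"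
    and R: "\<And>X Y Z. curvature G (f z) X Y Z = \<nu> *\<^sub>R R0 (G (f z)) \<epsilon> (J (f z)) X Y Z + W X Y Z"
  shows "\<exists>W. algebraic_curvature_tensor (g z) W \<and> (\<forall>v w. ricci_contraction W v w = 0) \<and>
    invariant_tensor (endo_span (JM z)) W \<and>
    (\<forall>X Y Z. curvature g z X Y Z = \<nu> *\<^sub>R R0 (g z) \<epsilon> (JM z) X Y Z + W X Y Z)"
proof -
  let ?L = "D f z"
  define K where "K = inv ?L"
  have lin: "linear ?L" and inj: "inj ?L" using Df_linear[OF z] Df_inj[OF z] .
  have "dim (range ?L) = DIM('e)"
    using dim_image_eq[OF lin, of UNIV] inj dim by simp
  then have "span (range ?L) = UNIV" by (simp only: dim_eq_full)
  then have surj: "range ?L = UNIV" using range_Df_subspace[OF z] by (simp add: span_eq_iff[THEN iffD2])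
  have LK: "?L (K w) = w" for w using surj by (simp add: K_def surj_f_inv_f)
  have K: "linear K"
    by (rule linearI; subst Df_eq_iff[OF z, symmetric]) (simp_all add: LK Df_simps[OF z])
  define W' where "W' u v w = K (W (?L u) (?L v) (?L w))" for u v w
  have LW': "?L (W' u v w) = W (?L u) (?L v) (?L w)" for u v w by (simp add: W'_def LK)
  note Wl = algebraic_curvature_linear[OF W(1)] algebraic_curvatureD(2)[OF W(1)]
  note Wls = Wl[THEN linear_add] Wl[THEN linear_scale]
  have "algebraic_curvature_tensor (g z) W'"
    unfolding algebraic_curvature_tensor_def bilinear_def linear_iff g_eq[OF z] Df_eq_iff[OF z, symmetric] Df_simps[OF z] LW'
    by (intro conjI allI; (rule algebraic_curvatureD(3-5)[OF W(1)])?; simp only: Wls)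
  moreover have "ricci_contraction W' v w = 0" for v w
  proof -
    have g: "linear (\<lambda>y. K (W y (?L v) (?L w)))"
      by (rule linear_compose[OF Wl(1) K, unfolded o_def])
    have "ricci_contraction W' v w = lin_trace (\<lambda>y. ?L (K (W y (?L v) (?L w))))"
      unfolding ricci_contraction_def W'_def by (rule lin_trace_commute[OF lin g])
    then show ?thesis using W(2)[of "?L v" "?L w"] by (simp add: LK ricci_contraction_def)
  qed
  moreover have "invariant_tensor (endo_span (JM z)) W'"
    unfolding invariant_tensor_def
  proof (intro ballI allI)
    fix F u v w assume "F \<in> endo_span (JM z)"
    then obtain E where E: "E \<in> endo_span (J (f z))" "\<And>u. ?L (F u) = E (?L u)"
      unfolding JM_span[OF z] by blast
    have "E (W (?L u) (?L v) (?L w)) - W (E (?L u)) (?L v) (?L w) - W (?L u) (E (?L v)) (?L w)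
      - W (?L u) (?L v) (E (?L w)) = 0"
      using W(3) E(1) unfolding invariant_tensor_def by blast
    then show "F (W' u v w) - W' (F u) v w - W' u (F v) w - W' u v (F w) = 0"
      unfolding Df_eq_iff[OF z, symmetric] Df_simps[OF z] E(2) LW' .
  qed
  moreover have "curvature g z X Y Z = \<nu> *\<^sub>R R0 (g z) \<epsilon> (JM z) X Y Z + W' X Y Z" for X Y Z
    unfolding Df_eq_iff[OF z, symmetric] Df_simps[OF z] LW' Df_R0[OF z] gauss_equation[OF z] by (rule R)
  ultimately show ?thesis by blast
qed

lemma tangent_projection:
  assumes z: "z \<in> U"
  shows "\<exists>t\<in>range (D f z). \<forall>s\<in>range (D f z). G (f z) (v - t) s = 0"
proof -
  have pz: "f z \<in> V" by (rule f_V[OF z])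
  have "linear (\<lambda>w. G (f z) v (D f z w))"
    by (rule linear_compose[OF Df_linear[OF z] G_linear(1)[OF pz], unfolded o_def])
  then obtain t where "\<And>w. g z t w = G (f z) v (D f z w)"
    using nondegenerate_form.representation[OF M.G_form[OF z]] by blast
  then have "\<forall>s\<in>range (D f z). G (f z) (v - D f z t) s = 0"
    by (auto simp: G_simps[OF pz] g_eq[OF z])
  then show ?thesis by blast
qed

text \<open>The tangent space is a curvature-invariant quaternionic line, and there is a non-zero normal
  vector.\<close>

lemma decomposition_larger_dimension:
  assumes dim: "DIM('f) = 4" "DIM('e) \<noteq> 4" and z: "z \<in> U"
  shows "\<exists>\<nu> W. algebraic_curvature_tensor (g z) W \<and> (\<forall>v w. ricci_contraction W v w = 0) \<and>
    invariant_tensor (endo_span (JM z)) W \<and>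
    (\<forall>X Y Z. curvature g z X Y Z = \<nu> *\<^sub>R R0 (g z) \<epsilon> (JM z) X Y Z + W X Y Z)"
proof -
  let ?L = "D f z" and ?T = "range (D f z)"
  have pz: "f z \<in> V" by (rule f_V[OF z])
  have in123: "1 \<in> {1, 2, 3::nat}" "2 \<in> {1, 2, 3::nat}" "3 \<in> {1, 2, 3::nat}" by auto
  interpret a: pq_form "G (f z)" "\<epsilon> 1" "\<epsilon> 2" "\<epsilon> 3" "J (f z) 1" "J (f z) 2" "J (f z) 3"
    by (rule form[OF pz])
  interpret m: pq_form "g z" "\<epsilon> 1" "\<epsilon> 2" "\<epsilon> 3" "JM z 1" "JM z 2" "JM z 3"
    by (rule JM_form[OF z])
  have LJ: "?L (JM z 1 u) = J (f z) 1 (?L u)" "?L (JM z 2 u) = J (f z) 2 (?L u)" "?L (JM z 3 u) = J (f z) 3 (?L u)" for u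
    by (rule Df_JM[OF z], rule in123)+
  have T: "subspace ?T" by (rule range_Df_subspace[OF z])
  have dimT: "dim ?T = 4"
    using dim_image_eq[OF Df_linear[OF z], of UNIV] Df_inj[OF z] dim(1) by simp
  have "?T \<noteq> UNIV" using dimT dim(2) by auto
  then obtain v where v: "v \<notin> ?T" by blast
  obtain t where t: "t \<in> ?T" "\<forall>s\<in>?T. G (f z) (v - t) s = 0" using tangent_projection[OF z] by blast
  obtain x where x: "g z x x \<noteq> 0" "span {x, JM z 1 x, JM z 2 x, JM z 3 x} = UNIV"
    by (rule m.spanning_vector[OF dim(1)])
  have "?T = span (?L ` {x, JM z 1 x, JM z 2 x, JM z 3 x})"
    using linear_span_image[OF Df_linear[OF z], of "{x, JM z 1 x, JM z 2 x, JM z 3 x}"] x(2) by simp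
  then have T_span: "?T \<subseteq> span {?L x, J (f z) 1 (?L x), J (f z) 2 (?L x), J (f z) 3 (?L x)}"
    unfolding image_insert image_empty LJ by blast
  have "\<exists>\<kappa>. \<forall>X\<in>?T. \<forall>Y\<in>?T. \<forall>Z. \<forall>e\<in>{J (f z) 1, J (f z) 2, J (f z) 3}.
    curvature G (f z) X Y (e Z) - e (curvature G (f z) X Y Z) = \<kappa> *\<^sub>R (a.q X Y (e Z) - e (a.q X Y Z))"
  proof (rule a.mixed_curvature[OF curvature_algebraic[OF pz] _ T _ rangeI[of _ x] _ T_span])
    fix X Y e assume "e \<in> {J (f z) 1, J (f z) 2, J (f z) 3}"
    then obtain \<alpha> where \<alpha>: "\<alpha> \<in> {1, 2, 3}" "e = J (f z) \<alpha>" by blast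
    show "(\<lambda>Z. curvature G (f z) X Y (e Z) - e (curvature G (f z) X Y Z))
      \<in> triple_span (J (f z) 1) (J (f z) 2) (J (f z) 3)"
      using curvature_commutator_in_span[OF pz \<alpha>(1)] unfolding \<alpha>(2) endo_span_eq_triple_span .
  next
    fix t e assume "e \<in> {J (f z) 1, J (f z) 2, J (f z) 3}" "t \<in> ?T"
    then show "e t \<in> ?T" using invariant[OF z in123(1)] invariant[OF z in123(2)] invariant[OF z in123(3)]
      by blast
  next
    show "G (f z) (?L x) (?L x) \<noteq> 0" using x(1) by (simp add: g_eq[OF z])
    show "curvature G (f z) X Y Z \<in> ?T" if "X \<in> ?T" "Y \<in> ?T" "Z \<in> ?T" for X Y Z
      using that by (auto simp: gauss_equation[OF z, symmetric])
    show "\<exists>t\<in>?T. \<forall>s\<in>?T. G (f z) (v - t) s = 0" for v by (rule tangent_projection[OF z])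
    show "v - t \<noteq> 0" using v t(1) by auto
    show "G (f z) (v - t) s = 0" if "s \<in> ?T" for s using t(2) that by blast
  qed
  then obtain \<kappa> where \<kappa>: "\<And>X Y Z \<alpha>. \<alpha> \<in> {1, 2, 3} \<Longrightarrow> 
      curvature G (f z) (?L X) (?L Y) (J (f z) \<alpha> Z) - J (f z) \<alpha> (curvature G (f z) (?L X) (?L Y) Z)
      = \<kappa> *\<^sub>R (a.q (?L X) (?L Y) (J (f z) \<alpha> Z) - J (f z) \<alpha> (a.q (?L X) (?L Y) Z))" by blast
  have Lq: "?L (m.q X Y Z) = a.q (?L X) (?L Y) (?L Z)" for X Y Z
    unfolding m.q_def a.q_def Df_simps[OF z] LJ g_eq[OF z] ..
  have comm: "curvature g z X Y (e Z) - e (curvature g z X Y Z) = \<kappa> *\<^sub>R (m.q X Y (e Z) - e (m.q X Y Z))"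
    if "e \<in> {JM z 1, JM z 2, JM z 3}" for X Y Z e
  proof -
    obtain \<alpha> where \<alpha>: "\<alpha> \<in> {1, 2, 3}" "e = JM z \<alpha>" using \<open>e \<in> _\<close> by blast
    show ?thesis
      unfolding Df_eq_iff[OF z, symmetric] \<alpha>(2) Df_simps[OF z] Df_JM[OF z \<alpha>(1)] Lq gauss_equation[OF z]
      by (rule \<kappa>[OF \<alpha>(1)])
  qed
  note W = m.curvature_decomposition[OF M.curvature_algebraic[OF z] comm]
  show ?thesis unfolding R0_eq_model[OF JM_form[OF z]] endo_span_eq_triple_span
    by (rule exI[of _ "2 * \<kappa>"], rule exI[of _ "\<lambda>X Y Z. curvature g z X Y Z - (2 * \<kappa>) *\<^sub>R m.model X Y Z"])
      (use W in auto)
qed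

text \<open>The condition is imposed for all adapted bases \<open>J'\<close> and with the reduced scalar curvature as
  factor; the first is a matter of \<open>R0_independent\<close>, the second of \<open>reduced_scal_eq\<close>.\<close>

lemma pq_decomposition:
  assumes dim: "DIM('f) = 4" and z: "z \<in> U"
    and ambient: "DIM('e) = 4 \<Longrightarrow> \<exists>W. algebraic_curvature_tensor (G (f z)) W \<and>
      (\<forall>v w. ricci_contraction W v w = 0) \<and> invariant_tensor (endo_span (J (f z))) W \<and>
      (\<forall>X Y Z. curvature G (f z) X Y Z = reduced_scal G (f z) *\<^sub>R R0 (G (f z)) \<epsilon> (J (f z)) X Y Z + W X Y Z)"
    and basis': "pq_basis \<epsilon>' J'" "endo_span (JM z) = endo_span J'"
  shows "\<exists>W. algebraic_curvature_tensor (g z) W \<and>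
      (\<forall>v w. ricci_contraction W v w = 0) \<and> invariant_tensor (endo_span (JM z)) W \<and>
      (\<forall>X Y Z. curvature g z X Y Z = reduced_scal g z *\<^sub>R R0 (g z) \<epsilon>' J' X Y Z + W X Y Z)"
proof -
  have "\<exists>\<nu> W. algebraic_curvature_tensor (g z) W \<and> (\<forall>v w. ricci_contraction W v w = 0) \<and>
    invariant_tensor (endo_span (JM z)) W \<and>
    (\<forall>X Y Z. curvature g z X Y Z = \<nu> *\<^sub>R R0 (g z) \<epsilon> (JM z) X Y Z + W X Y Z)"
  proof (cases "DIM('e) = 4")
    case True
    with ambient obtain W where "algebraic_curvature_tensor (G (f z)) W"
      "\<And>v w. ricci_contraction W v w = 0" "invariant_tensor (endo_span (J (f z))) W"
      "\<And>X Y Z. curvature G (f z) X Y Z = reduced_scal G (f z) *\<^sub>R R0 (G (f z)) \<epsilon> (J (f z)) X Y Z + W X Y Z"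
      by blast
    from decomposition_equal_dimension[OF _ z this] True dim show ?thesis by auto
  next
    case False
    then show ?thesis by (rule decomposition_larger_dimension[OF dim _ z])
  qed
  then obtain \<nu> W where W: "algebraic_curvature_tensor (g z) W" "\<And>v w. ricci_contraction W v w = 0"
    "invariant_tensor (endo_span (JM z)) W"
    and R: "\<And>X Y Z. curvature g z X Y Z = \<nu> *\<^sub>R R0 (g z) \<epsilon> (JM z) X Y Z + W X Y Z" by blast
  have "reduced_scal g z = \<nu>"
    by (rule pq_form.reduced_scal_eq[where G = g and z = z, OF JM_form[OF z] refl dim W(1,2)])
      (simp only: R R0_eq_model[OF JM_form[OF z]])
  moreover have "R0 (g z) \<epsilon> (JM z) X Y Z = R0 (g z) \<epsilon>' J' X Y Z" for X Y Z
    by (rule R0_independent[OF M.bil[OF z] JM_basis[OF z] basis'])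
  ultimately show ?thesis using W R by auto
qed

end

section \<open>Changes of charts\<close>

lemma smooth_manifoldD:
  assumes "smooth_manifold T A" "c \<in> A"
  shows "openin T (fst c)" "open (coords c)" "homeomorphic_map (subtopology T (fst c)) (top_of_set (coords c)) (snd c)"
    "inj_on (snd c) (fst c)"
proof -
  show 1: "openin T (fst c)" "open (coords c)"
    and 2: "homeomorphic_map (subtopology T (fst c)) (top_of_set (coords c)) (snd c)"
    using assms unfolding smooth_manifold_def by blast+
  have "topspace (subtopology T (fst c)) = fst c"
    using openin_subset[OF 1(1)] by auto
  then show "inj_on (snd c) (fst c)" using homeomorphic_imp_injective_map[OF 2] by simp
qed

lemma chart_inv_snd: "inj_on (snd c) (fst c) \<Longrightarrow> p \<in> fst c \<Longrightarrow> chart_inv c (snd c p) = p"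
  unfolding chart_inv_def by (rule inv_into_f_f)

lemma open_chart_image:
  assumes T: "smooth_manifold T A" and c: "c \<in> A" and W: "openin T W"
  shows "open (snd c ` (fst c \<inter> W))"
proof -
  have "openin (subtopology T (fst c)) (fst c \<inter> W)"
    using W by (metis inf_commute openin_subtopology)
  then have "openin (top_of_set (coords c)) (snd c ` (fst c \<inter> W))"
    using homeomorphic_imp_open_map[OF smooth_manifoldD(3)[OF T c]] unfolding open_map_def by blast
  then show ?thesis using smooth_manifoldD(2)[OF T c] openin_open_eq by blast
qed

lemma jac_chain:
  fixes c :: "('a, 'd::euclidean_space) chart" and d :: "('a, 'e::euclidean_space) chart"
    and e :: "('a, 'f::euclidean_space) chart"
  assumes c: "inj_on (snd c) (fst c)" and d: "inj_on (snd d) (fst d)"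
    and op: "open (overlap c d)" and p: "p \<in> fst c \<inter> fst d"
    and cd: "transition c d differentiable (at (snd c p))"
      and de: "transition d e differentiable (at (snd d p))"
  shows "jac c e p = jac d e p \<circ> jac c d p"
proof -
  have pz: "transition c d (snd c p) = snd d p"
    using p by (simp add: transition_def chart_inv_snd[OF c])
  have "((transition d e \<circ> transition c d) has_derivative
      (D (transition d e) (snd d p) \<circ> D (transition c d) (snd c p))) (at (snd c p))"
    by (rule diff_chain_at[OF D_works[OF cd]]) (use D_works[OF de] pz in simp)
  then have "(transition c e has_derivative
      (D (transition d e) (snd d p) \<circ> D (transition c d) (snd c p))) (at (snd c p))"
  proof (rule has_derivative_transform_within_open[OF _ op])
    show "snd c p \<in> overlap c d" using p by (auto simp: overlap_def)
    fix y assume "y \<in> overlap c d"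
    then obtain q where "q \<in> fst c" "q \<in> fst d" "y = snd c q" by (auto simp: overlap_def)
    then show "(transition d e \<circ> transition c d) y = transition c e y"
      by (simp add: transition_def chart_inv_snd[OF c] chart_inv_snd[OF d])
  qed
  from D_eq[OF this] show ?thesis by (simp add: jac_def)
qed

lemma jac_self:
  assumes "inj_on (snd c) (fst c)" "open (coords c)" "p \<in> fst c"
  shows "jac c c p = id"
proof -
  have "((\<lambda>y. y) has_derivative id) (at (snd c p))" by (simp add: id_def)
  then have "(transition c c has_derivative id) (at (snd c p))"
    by (rule has_derivative_transform_within_open[OF _ assms(2)])
      (use assms in \<open>auto simp: coords_def transition_def chart_inv_snd\<close>)
  from D_eq[OF this] show ?thesis by (simp add: jac_def)
qed

section \<open>The induced structure of a para-quaternionic submanifold\<close>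

locale pq_submanifold =
  fixes T S :: "'a topology"
    and A :: "('a, 'e::euclidean_space) chart set"
    and B :: "('a, 'f::euclidean_space) chart set"
    and g :: "('a, 'e) metric"
    and Q :: "('a, 'e) endo_field"
  assumes kaehler: "pq_kaehler_manifold T A g Q"
    and submanifold: "almost_pq_submanifold S B T A Q"
    and nondegenerate: "nondegenerate_submanifold B A g"
begin

lemma T_manifold: "smooth_manifold T A" and metric: "pseudo_riemannian_metric A g"
  and pq_str: "almost_pq_structure A Q" and skew: "skew_structure A g Q" and par: "parallel_structure A g Q"
  and dim4: "DIM('e) = 4 \<Longrightarrow> pq_curvature_decomposition A g Q"
  using kaehler unfolding pq_kaehler_manifold_def by blast+

lemma immersed: "immersed_submanifold S B T A"
  using submanifold unfolding almost_pq_submanifold_def by blast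

lemma S_manifold: "smooth_manifold S B"
  using immersed unfolding immersed_submanifold_def by blast

lemmas A_chart = smooth_manifoldD[OF T_manifold]
lemmas B_chart = smooth_manifoldD[OF S_manifold]

lemma ambient_chart:
  assumes "c \<in> B" "p \<in> fst c"
  obtains d where "d \<in> A" "p \<in> fst d"
proof -
  have "p \<in> topspace S" using B_chart(1)[OF assms(1)] assms(2) openin_subset by blast
  then have "p \<in> (\<Union>d\<in>A. fst d)"
    using immersed T_manifold unfolding immersed_submanifold_def smooth_manifold_def by blast
  then show ?thesis using that by blast
qed

lemma chart_at: "d \<in> A \<Longrightarrow> p \<in> fst d \<Longrightarrow> chart_at A p \<in> A \<and> p \<in> fst (chart_at A p)"
  unfolding chart_at_def by (rule someI[of _ d]) blast

lemma open_overlap_AA: "d \<in> A \<Longrightarrow> d' \<in> A \<Longrightarrow> open (overlap d d')"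
  unfolding overlap_def by (rule open_chart_image[OF T_manifold _ A_chart(1)])

lemma open_overlap_BB: "c \<in> B \<Longrightarrow> c' \<in> B \<Longrightarrow> open (overlap c c')"
  unfolding overlap_def by (rule open_chart_image[OF S_manifold _ B_chart(1)])

lemma open_overlap_BA:
  assumes "c \<in> B" "d \<in> A" shows "open (overlap c d)"
proof -
  have "openin S {x \<in> topspace S. id x \<in> fst d}"
    using immersed A_chart(1)[OF assms(2)] openin_continuous_map_preimage
    unfolding immersed_submanifold_def by blast
  from open_chart_image[OF S_manifold assms(1) this]
  have "open (snd c ` (fst c \<inter> {x \<in> topspace S. id x \<in> fst d}))" .
  moreover have "fst c \<inter> {x \<in> topspace S. id x \<in> fst d} = fst c \<inter> fst d"
    using openin_subset[OF B_chart(1)[OF assms(1)]] by auto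
  ultimately show ?thesis by (simp add: overlap_def)
qed

lemma smooth_AA: "d \<in> A \<Longrightarrow> d' \<in> A \<Longrightarrow> smooth_on (overlap d d') (transition d d')"
  using T_manifold unfolding smooth_manifold_def by blast

lemma smooth_BB: "c \<in> B \<Longrightarrow> c' \<in> B \<Longrightarrow> smooth_on (overlap c c') (transition c c')"
  using S_manifold unfolding smooth_manifold_def by blast

lemma smooth_BA: "c \<in> B \<Longrightarrow> d \<in> A \<Longrightarrow> smooth_on (overlap c d) (transition c d)"
  using immersed unfolding immersed_submanifold_def by blast

lemma jac_inj: "c \<in> B \<Longrightarrow> d \<in> A \<Longrightarrow> p \<in> fst c \<inter> fst d \<Longrightarrow> inj (jac c d p)"
  using immersed unfolding immersed_submanifold_def by blast

lemma in_overlap: "p \<in> fst c \<Longrightarrow> p \<in> fst d \<Longrightarrow> snd c p \<in> overlap c d"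
  by (auto simp: overlap_def)

lemma jac_AAA:
  "d \<in> A \<Longrightarrow> d' \<in> A \<Longrightarrow> d'' \<in> A \<Longrightarrow> p \<in> fst d \<Longrightarrow> p \<in> fst d' \<Longrightarrow> p \<in> fst d'' \<Longrightarrow>
    jac d d'' p = jac d' d'' p \<circ> jac d d' p"
  by (intro jac_chain A_chart(4) open_overlap_AA smooth_on_differentiable[OF smooth_AA] in_overlap IntI)

lemma jac_BAA:
  "c \<in> B \<Longrightarrow> d \<in> A \<Longrightarrow> d' \<in> A \<Longrightarrow> p \<in> fst c \<Longrightarrow> p \<in> fst d \<Longrightarrow> p \<in> fst d' \<Longrightarrow>
    jac c d' p = jac d d' p \<circ> jac c d p"
  by (intro jac_chain A_chart(4) B_chart(4) open_overlap_BA smooth_on_differentiable[OF smooth_AA]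
    smooth_on_differentiable[OF smooth_BA] in_overlap IntI)

lemma jac_BBA:
  "c \<in> B \<Longrightarrow> c' \<in> B \<Longrightarrow> d \<in> A \<Longrightarrow> p \<in> fst c \<Longrightarrow> p \<in> fst c' \<Longrightarrow> p \<in> fst d \<Longrightarrow>
    jac c d p = jac c' d p \<circ> jac c c' p"
  by (intro jac_chain B_chart(4) open_overlap_BB smooth_on_differentiable[OF smooth_BB]
    smooth_on_differentiable[OF smooth_BA] in_overlap IntI)

lemma jac_BBB:
  "c \<in> B \<Longrightarrow> c' \<in> B \<Longrightarrow> p \<in> fst c \<Longrightarrow> p \<in> fst c' \<Longrightarrow> jac c' c p (jac c c' p u) = u"
  using jac_chain[of c c' p c] jac_self[of c p] B_chart(2,4) open_overlap_BB
    smooth_on_differentiable[OF smooth_BB] in_overlap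
  by (metis IntI comp_apply id_apply)

lemma jac_AA_inverse:
  "d \<in> A \<Longrightarrow> d' \<in> A \<Longrightarrow> p \<in> fst d \<Longrightarrow> p \<in> fst d' \<Longrightarrow> jac d' d p (jac d d' p u) = u"
  using jac_AAA[of d d' d p] jac_self[of d p] A_chart(2,4) by (metis comp_apply id_apply)

text \<open>The ambient chart chosen in the definition is arbitrary; by the transformation rules any other
  one around the point may be used.\<close>

lemma induced_metric_eq:
  assumes c: "c \<in> B" and d: "d \<in> A" and p: "p \<in> fst c" "p \<in> fst d"
  shows "induced_metric A g c (snd c p) u v = g d (snd d p) (jac c d p u) (jac c d p v)"
proof -
  define d' where "d' = chart_at A p"
  have d': "d' \<in> A" "p \<in> fst d'" using chart_at[OF d p(2)] by (auto simp: d'_def)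
  have "g d (snd d p) x y = g d' (snd d' p) (jac d d' p x) (jac d d' p y)" for x y
    using metric d d' p unfolding pseudo_riemannian_metric_def by blast
  then show ?thesis
    using jac_BAA[OF c d d'(1) p d'(2)]
    by (simp add: induced_metric_def Let_def chart_inv_snd[OF B_chart(4)[OF c] p(1)] d'_def)
qed

lemma induced_structure_eq:
  assumes c: "c \<in> B" and d: "d \<in> A" and p: "p \<in> fst c" "p \<in> fst d"
  shows "induced_structure A Q c (snd c p) = {F. \<exists>E\<in>Q d (snd d p). \<forall>u. jac c d p (F u) = E (jac c d p u)}"
proof -
  define d' where "d' = chart_at A p"
  have d': "d' \<in> A" "p \<in> fst d'" using chart_at[OF d p(2)] by (auto simp: d'_def)
  have Q: "Q d' (snd d' p) = (\<lambda>E. jac d d' p \<circ> E \<circ> jac d' d p) ` Q d (snd d p)"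
    using pq_str d d' p unfolding almost_pq_structure_def by blast
  have inv: "jac d' d p (jac d d' p u) = u" for u by (rule jac_AA_inverse[OF d d'(1) p(2) d'(2)])
  have J: "jac c d' p u = jac d d' p (jac c d p u)" for u
    using jac_BAA[OF c d d'(1) p d'(2)] by simp
  have inj: "jac d d' p x = jac d d' p y \<longleftrightarrow> x = y" for x y using inv by metis
  show ?thesis
    by (simp add: induced_structure_def Let_def chart_inv_snd[OF B_chart(4)[OF c] p(1)] d'_def[symmetric] Q J inv inj)
qed

text \<open>Near each point the submanifold is described by a single pair of charts and an adapted basis
  of the ambient structure.\<close>

definition adapted where
  "adapted c d V \<epsilon> J U \<longleftrightarrow>
     pq_submanifold_patch V (g d) \<epsilon> J U (transition c d) (induced_metric A g c) \<and>
     U \<subseteq> overlap c d \<and> V \<subseteq> coords d \<and> (\<forall>y\<in>V. Q d y = endo_span (J y))"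

lemma adapted_patch:
  assumes c: "c \<in> B" and d: "d \<in> A" and p: "p \<in> fst c" "p \<in> fst d"
  obtains V \<epsilon> J U where "adapted c d V \<epsilon> J U" "snd c p \<in> U"
proof -
  let ?f = "transition c d"
  have f: "?f (snd c q) = snd d q" if "q \<in> fst c" for q
    using that by (simp add: transition_def chart_inv_snd[OF B_chart(4)[OF c]])
  have "snd d p \<in> coords d" using p by (auto simp: coords_def)
  then obtain V \<epsilon> J where V: "open V" "snd d p \<in> V" "V \<subseteq> coords d"
    and Js: "\<forall>\<alpha>\<in>{1, 2, 3}. \<forall>v. smooth_on V (\<lambda>y. J y \<alpha> v)"
    and Jb: "\<forall>y\<in>V. pq_basis \<epsilon> (J y) \<and> Q d y = endo_span (J y)"
    using pq_str d unfolding almost_pq_structure_def by metis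
  define U where "U = {y \<in> overlap c d. ?f y \<in> V}"
  have openU: "open U"
    using continuous_open_preimage[OF smooth_on_continuous[OF smooth_BA[OF c d]] open_overlap_BA[OF c d] V(1)]
    by (simp add: U_def vimage_def Int_def)
  have Usub: "U \<subseteq> overlap c d" by (auto simp: U_def)
  have point: "\<exists>q\<in>fst c \<inter> fst d. y = snd c q" if "y \<in> U" for y
    using that by (auto simp: U_def overlap_def)
  have g: "bilinear (g d z)" "g d z u v = g d z v u" "(\<And>v. g d z u v = 0) \<Longrightarrow> u = 0"
    if "z \<in> V" for z u v
    using metric d V(3) that unfolding pseudo_riemannian_metric_def by blast+
  have "pq_submanifold_patch V (g d) \<epsilon> J U ?f (induced_metric A g c)"
  proof
    show "open V" "open U" by (rule V(1), rule openU)
    show "smooth_on V (\<lambda>z. g d z u v)" for u v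
      using metric d smooth_on_subset[OF _ V(3)] unfolding pseudo_riemannian_metric_def by blast
    fix z assume z: "z \<in> V"
    show "bilinear (g d z)" "\<And>u v. g d z u v = g d z v u" "\<And>u. (\<And>v. g d z u v = 0) \<Longrightarrow> u = 0"
      using g[OF z] by blast+
    show "pq_basis \<epsilon> (J z)" using Jb z by blast
    show "g d z (J z \<alpha> u) v = - g d z u (J z \<alpha> v)" if "\<alpha> \<in> {1, 2, 3}" for \<alpha> u v
    proof -
      have "J z \<alpha> \<in> Q d z" using endo_span_generator[OF that] Jb z by blast
      then show ?thesis using skew d z V(3) unfolding skew_structure_def by blast
    qed
    show "cov_deriv_endo (g d) u E z \<in> endo_span (J z)"
      if "\<And>w. smooth_on V (\<lambda>y. E y w)" "\<And>y. y \<in> V \<Longrightarrow> E y \<in> endo_span (J y)" for E u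
    proof -
      have "\<forall>y\<in>V. E y \<in> Q d y" using that(2) Jb by blast
      then have "cov_deriv_endo (g d) u E z \<in> Q d z"
        using par d V that(1) z unfolding parallel_structure_def by blast
      then show ?thesis using Jb z by blast
    qed
  next
    show "smooth_on V (\<lambda>y. J y \<alpha> v)" if "\<alpha> \<in> {1, 2, 3}" for \<alpha> v using Js that by blast
    show "smooth_on U ?f" by (rule smooth_on_subset[OF smooth_BA[OF c d] Usub])
    fix y assume y: "y \<in> U"
    then obtain q where q: "q \<in> fst c" "q \<in> fst d" "y = snd c q" using point by blast
    have qz: "snd d q = ?f y" using f q by simp
    have jac: "jac c d q = D ?f y" by (simp add: jac_def q(3))
    show yV: "?f y \<in> V" using y by (simp add: U_def)
    show inj: "inj (D ?f y)" using jac_inj[OF c d, of q] q jac by simp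
    show eq: "induced_metric A g c y u v = g d (?f y) (D ?f y u) (D ?f y v)" for u v
      using induced_metric_eq[OF c d q(1,2), of u v] by (simp only: qz jac q(3))
    show "J (?f y) \<alpha> (D ?f y u) \<in> range (D ?f y)" if "\<alpha> \<in> {1, 2, 3}" for \<alpha> u
    proof -
      have "J (?f y) \<alpha> \<in> Q d (snd d q)" using endo_span_generator[OF that] Jb yV qz by metis
      then have "J (?f y) \<alpha> ` tangent_space c d q \<subseteq> tangent_space c d q"
        using submanifold c d q unfolding almost_pq_submanifold_def by blast
      then show ?thesis unfolding tangent_space_def jac by blast
    qed
    show "u = 0" if u: "\<And>v. induced_metric A g c y u v = 0" for u
    proof -
      have "\<forall>s\<in>tangent_space c d q. g d (snd d q) (D ?f y u) s = 0"
        using u unfolding tangent_space_def jac eq qz by blast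
      moreover have "D ?f y u \<in> tangent_space c d q" unfolding tangent_space_def jac by blast
      ultimately have "D ?f y u = 0"
        using nondegenerate c d q(1,2) unfolding nondegenerate_submanifold_def by blast
      moreover have "linear (D ?f y)"
        using linear_D[OF smooth_on_differentiable[OF smooth_BA[OF c d]]] Usub y by blast
      ultimately show ?thesis using inj linear_injective_0 by blast
    qed
  qed
  moreover have "snd c p \<in> U" using p f V(2) by (auto simp: U_def in_overlap)
  ultimately show ?thesis using that[of V \<epsilon> J U] Usub Jb V(3) unfolding adapted_def by blast
qed

lemma adapted_patch_at:
  assumes c: "c \<in> B" and z: "z \<in> coords c"
  obtains d V \<epsilon> J U where "d \<in> A" "adapted c d V \<epsilon> J U" "z \<in> U"
proof -
  obtain p where p: "p \<in> fst c" "z = snd c p" using z by (auto simp: coords_def)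
  obtain d where d: "d \<in> A" "p \<in> fst d" using ambient_chart[OF c p(1)] .
  obtain V \<epsilon> J U where "adapted c d V \<epsilon> J U" "snd c p \<in> U"
    using adapted_patch[OF c d(1) p(1) d(2)] .
  then show ?thesis using that[OF d(1)] p(2) by blast
qed

lemma adapted_induced_structure:
  assumes c: "c \<in> B" and d: "d \<in> A" and ad: "adapted c d V \<epsilon> J U" and y: "y \<in> U"
  shows "induced_structure A Q c y = endo_span (pq_submanifold_patch.JM J (transition c d) y)"
proof -
  interpret P: pq_submanifold_patch V "g d" \<epsilon> J U "transition c d" "induced_metric A g c"
    using ad unfolding adapted_def by blast
  obtain q where q: "q \<in> fst c" "q \<in> fst d" "y = snd c q"
    using ad y unfolding adapted_def overlap_def by blast
  have qz: "snd d q = transition c d y"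
    using q by (simp add: transition_def chart_inv_snd[OF B_chart(4)[OF c]])
  have V: "Q d (transition c d y) = endo_span (J (transition c d y))"
    using ad P.f_V[OF y] unfolding adapted_def by blast
  show ?thesis
    unfolding P.JM_span[OF y] V[symmetric] using induced_structure_eq[OF c d q(1,2)]
    unfolding qz jac_def q(3) .
qed

lemma totally_geodesic: "totally_geodesic B A g"
  unfolding totally_geodesic_def
proof (intro ballI allI)
  fix c d p u v
  assume c: "c \<in> B" and d: "d \<in> A" and p: "p \<in> fst c \<inter> fst d"
  obtain V \<epsilon> J U where ad: "adapted c d V \<epsilon> J U" and U: "snd c p \<in> U"
    using adapted_patch[OF c d] p by blast
  interpret P: pq_submanifold_patch V "g d" \<epsilon> J U "transition c d" "induced_metric A g c"
    using ad unfolding adapted_def by blast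
  have pz: "transition c d (snd c p) = snd d p"
    using p by (simp add: transition_def chart_inv_snd[OF B_chart(4)[OF c]])
  have tan: "ambient_deriv g c d p u v \<in> tangent_space c d p"
    using P.amb_tangent[OF U, of u v] by (simp add: ambient_deriv_def P.amb_def tangent_space_def jac_def pz)
  have V: "snd d p \<in> V" using P.f_V[OF U] pz by simp
  have sub: "subspace (tangent_space c d p)"
    using P.range_Df_subspace[OF U] by (simp add: tangent_space_def jac_def)
  show "second_fundamental_form g c d p u v = 0"
    unfolding second_fundamental_form_def
  proof (rule the_equality)
    show "(\<forall>t\<in>tangent_space c d p. g d (snd d p) 0 t = 0) \<and> ambient_deriv g c d p u v - 0 \<in> tangent_space c d p"
      using tan by (simp add: P.G_simps[OF V])
    fix N assume N: "(\<forall>t\<in>tangent_space c d p. g d (snd d p) N t = 0) \<and> ambient_deriv g c d p u v - N \<in> tangent_space c d p"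
    have "ambient_deriv g c d p u v - (ambient_deriv g c d p u v - N) \<in> tangent_space c d p"
      by (rule subspace_diff[OF sub tan conjunct2[OF N]])
    then have "N \<in> tangent_space c d p" by simp
    then show "N = 0" using N nondegenerate c d p unfolding nondegenerate_submanifold_def by blast
  qed
qed

lemma induced_pseudo_riemannian: "pseudo_riemannian_metric B (induced_metric A g)"
  unfolding pseudo_riemannian_metric_def
proof (intro conjI ballI allI impI)
  fix c c' p u v assume c: "c \<in> B" "c' \<in> B" and p: "p \<in> fst c \<inter> fst c'"
  obtain d where d: "d \<in> A" "p \<in> fst d" using ambient_chart[OF c(1)] p by blast
  show "induced_metric A g c (snd c p) u v
    = induced_metric A g c' (snd c' p) (jac c c' p u) (jac c c' p v)"
    using p induced_metric_eq[OF c(1) d(1) _ d(2)] induced_metric_eq[OF c(2) d(1) _ d(2)]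
      jac_BBA[OF c d(1) _ _ d(2)] by simp
next
  fix c z assume c: "c \<in> B" and z: "z \<in> coords c"
  obtain d V \<epsilon> J U where d: "d \<in> A" and ad: "adapted c d V \<epsilon> J U" and U: "z \<in> U"
    using adapted_patch_at[OF c z] .
  note Q = adapted_induced_structure[OF c d ad]
  interpret P: pq_submanifold_patch V "g d" \<epsilon> J U "transition c d" "induced_metric A g c"
    using ad unfolding adapted_def by blast
  show "bilinear (induced_metric A g c z)" by (rule P.M.bil[OF U])
  show "induced_metric A g c z u v = induced_metric A g c z v u" for u v by (rule P.M.sym[OF U])
  show "u = 0" if "\<forall>v. induced_metric A g c z u v = 0" for u by (rule P.M.nondeg[OF U]) (use that in blast)
next
  fix c u v assume c: "c \<in> B"
  show "smooth_on (coords c) (\<lambda>z. induced_metric A g c z u v)"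
  proof (rule smooth_on_local)
    fix z assume z: "z \<in> coords c"
    obtain d V \<epsilon> J U where d: "d \<in> A" and ad: "adapted c d V \<epsilon> J U" and U: "z \<in> U"
    using adapted_patch_at[OF c z] .
  note Q = adapted_induced_structure[OF c d ad]
    interpret P: pq_submanifold_patch V "g d" \<epsilon> J U "transition c d" "induced_metric A g c"
    using ad unfolding adapted_def by blast
    show "\<exists>U. open U \<and> z \<in> U \<and> smooth_on U (\<lambda>z. induced_metric A g c z u v)"
      using P.open_U U P.M.smooth by blast
  qed
qed

lemma induced_neutral: "neutral_metric B (induced_metric A g)"
  unfolding neutral_metric_def
proof (intro ballI)
  fix c z assume c: "c \<in> B" and z: "z \<in> coords c"
  obtain d V \<epsilon> J U where d: "d \<in> A" and ad: "adapted c d V \<epsilon> J U" and U: "z \<in> U"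
    using adapted_patch_at[OF c z] .
  note Q = adapted_induced_structure[OF c d ad]
  interpret P: pq_submanifold_patch V "g d" \<epsilon> J U "transition c d" "induced_metric A g c"
    using ad unfolding adapted_def by blast
  show "neutral_form (induced_metric A g c z)" by (rule pq_form.neutral[OF P.JM_form[OF U]])
qed

text \<open>The transformation rule is conjugation of \<open>F\<close> by the Jacobian of the change of charts, under which
  the element \<open>E\<close> of \<open>Q\<close> that restricts to \<open>F\<close> stays the same.\<close>

lemma induced_almost_pq: "almost_pq_structure B (induced_structure A Q)"
  unfolding almost_pq_structure_def
proof (intro conjI ballI)
  fix c c' p assume c: "c \<in> B" and c': "c' \<in> B" and p: "p \<in> fst c \<inter> fst c'"
  obtain d where d: "d \<in> A" "p \<in> fst d" using ambient_chart[OF c] p by blast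
  have inv: "jac c' c p (jac c c' p u) = u" "jac c c' p (jac c' c p w) = w" for u w
    using jac_BBB[OF c c'] jac_BBB[OF c' c] p by blast+
  have J: "jac c d p u = jac c' d p (jac c c' p u)" for u
    using jac_BBA[OF c c' d(1) _ _ d(2)] p by simp
  have J': "jac c' d p w = jac c d p (jac c' c p w)" for w unfolding J inv ..
  have eq: "induced_structure A Q c (snd c p) = {F. \<exists>E\<in>Q d (snd d p). \<forall>u. jac c d p (F u) = E (jac c d p u)}"
    "induced_structure A Q c' (snd c' p) = {F. \<exists>E\<in>Q d (snd d p). \<forall>u. jac c' d p (F u) = E (jac c' d p u)}"
    using induced_structure_eq[OF c d(1) _ d(2)] induced_structure_eq[OF c' d(1) _ d(2)] p by blast+
  show "induced_structure A Q c' (snd c' p) = (\<lambda>E. jac c c' p \<circ> E \<circ> jac c' c p) ` induced_structure A Q c (snd c p)"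
  proof (intro set_eqI iffI)
    fix F assume "F \<in> induced_structure A Q c' (snd c' p)"
    then obtain E where E: "E \<in> Q d (snd d p)" "\<And>w. jac c' d p (F w) = E (jac c' d p w)" unfolding eq by blast
    have "jac c d p ((jac c' c p \<circ> F \<circ> jac c c' p) u) = E (jac c d p u)" for u
      unfolding J by (simp add: inv E(2))
    then have "jac c' c p \<circ> F \<circ> jac c c' p \<in> induced_structure A Q c (snd c p)" unfolding eq using E(1)
      by blast
    moreover have "F = jac c c' p \<circ> (jac c' c p \<circ> F \<circ> jac c c' p) \<circ> jac c' c p" by (auto simp: inv)
    ultimately show "F \<in> (\<lambda>E. jac c c' p \<circ> E \<circ> jac c' c p) ` induced_structure A Q c (snd c p)" by blast
  next
    fix F assume "F \<in> (\<lambda>E. jac c c' p \<circ> E \<circ> jac c' c p) ` induced_structure A Q c (snd c p)"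
    then obtain F0 where F0: "F0 \<in> induced_structure A Q c (snd c p)" "F = jac c c' p \<circ> F0 \<circ> jac c' c p"
      by blast
    then obtain E where E: "E \<in> Q d (snd d p)" "\<And>u. jac c d p (F0 u) = E (jac c d p u)" unfolding eq by blast
    have "jac c' d p (F w) = E (jac c' d p w)" for w
      unfolding J' F0(2) by (simp add: inv E(2))
    then show "F \<in> induced_structure A Q c' (snd c' p)" unfolding eq using E(1) by blast
  qed
next
  fix c z assume c: "c \<in> B" and z: "z \<in> coords c"
  obtain d V \<epsilon> J U where d: "d \<in> A" and ad: "adapted c d V \<epsilon> J U" and U: "z \<in> U"
    using adapted_patch_at[OF c z] .
  note Q = adapted_induced_structure[OF c d ad]
  interpret P: pq_submanifold_patch V "g d" \<epsilon> J U "transition c d" "induced_metric A g c"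
    using ad unfolding adapted_def by blast
  show "\<exists>U \<epsilon> J. open U \<and> z \<in> U \<and> U \<subseteq> coords c \<and>
        (\<forall>\<alpha>\<in>{1, 2, 3}. \<forall>v. smooth_on U (\<lambda>y. J y \<alpha> v)) \<and>
        (\<forall>y\<in>U. pq_basis \<epsilon> (J y) \<and> induced_structure A Q c y = endo_span (J y))"
  proof (intro exI conjI ballI allI)
    show "open U" by (rule P.open_U)
    show "smooth_on U (\<lambda>y. P.JM y \<alpha> v)" if "\<alpha> \<in> {1, 2, 3}" for \<alpha> v by (rule P.JM_smooth[OF that])
    show "pq_basis \<epsilon> (P.JM y)" "induced_structure A Q c y = endo_span (P.JM y)" if "y \<in> U" for y
      by (rule P.JM_basis[OF that], rule Q[OF that])
      show "z \<in> U" by (rule U)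
    show "U \<subseteq> coords c" using ad unfolding adapted_def overlap_def coords_def by blast
  qed
qed

lemma induced_skew: "skew_structure B (induced_metric A g) (induced_structure A Q)"
  unfolding skew_structure_def
proof (intro ballI allI)
  fix c z E u v assume c: "c \<in> B" and z: "z \<in> coords c" and E: "E \<in> induced_structure A Q c z"
  obtain d V \<epsilon> J U where d: "d \<in> A" and ad: "adapted c d V \<epsilon> J U" and U: "z \<in> U"
    using adapted_patch_at[OF c z] .
  note Q = adapted_induced_structure[OF c d ad]
  interpret P: pq_submanifold_patch V "g d" \<epsilon> J U "transition c d" "induced_metric A g c"
    using ad unfolding adapted_def by blast
  obtain F where F: "F \<in> endo_span (J (transition c d z))"
    "\<And>u. D (transition c d) z (E u) = F (D (transition c d) z u)"
    using E unfolding Q[OF U] P.JM_span[OF U] by blast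
  have "g d (transition c d z) (F x) y = - g d (transition c d z) x (F y)" for x y
    using skew d F(1) ad P.f_V[OF U] unfolding skew_structure_def adapted_def by blast
  then show "induced_metric A g c z (E u) v = - induced_metric A g c z u (E v)"
    by (simp add: P.g_eq[OF U] F(2))
qed

lemma induced_parallel: "parallel_structure B (induced_metric A g) (induced_structure A Q)"
  unfolding parallel_structure_def
proof (intro ballI allI impI)
  fix c W E z u
  assume c: "c \<in> B" and W: "open W" "W \<subseteq> coords c" and E: "\<forall>w. smooth_on W (\<lambda>y. E y w)"
    "\<forall>y\<in>W. E y \<in> induced_structure A Q c y" and z: "z \<in> W"
  have zc: "z \<in> coords c" using W z by blast
  obtain d V \<epsilon> J U where d: "d \<in> A" and ad: "adapted c d V \<epsilon> J U" and U: "z \<in> U"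
    using adapted_patch_at[OF c zc] .
  note Q = adapted_induced_structure[OF c d ad]
  interpret P: pq_submanifold_patch V "g d" \<epsilon> J U "transition c d" "induced_metric A g c"
    using ad unfolding adapted_def by blast
  show "cov_deriv_endo (induced_metric A g c) u E z \<in> induced_structure A Q c z"
    unfolding Q[OF U]
  proof (rule P.M_parallel)
    show "open (W \<inter> U)" "W \<inter> U \<subseteq> U" using W(1) P.open_U by auto
    show "smooth_on (W \<inter> U) (\<lambda>y. E y w)" for w by (rule smooth_on_subset[OF E(1)[rule_format]]) simp
    show "E y \<in> endo_span (P.JM y)" if "y \<in> W \<inter> U" for y using E(2) Q that by blast
    show "z \<in> W \<inter> U" using z U by blast
  qed
qed

lemma induced_decomposition:
  assumes "DIM('f) = 4"
  shows "pq_curvature_decomposition B (induced_metric A g) (induced_structure A Q)"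
  unfolding pq_curvature_decomposition_def
proof (intro ballI allI impI)
  fix c z \<epsilon>' J' assume c: "c \<in> B" and z: "z \<in> coords c"
    and J': "pq_basis \<epsilon>' J' \<and> induced_structure A Q c z = endo_span J'"
  obtain d V \<epsilon> J U where d: "d \<in> A" and ad: "adapted c d V \<epsilon> J U" and U: "z \<in> U"
    using adapted_patch_at[OF c z] .
  note Q = adapted_induced_structure[OF c d ad]
  interpret P: pq_submanifold_patch V "g d" \<epsilon> J U "transition c d" "induced_metric A g c"
    using ad unfolding adapted_def by blast
  show "\<exists>W. algebraic_curvature_tensor (induced_metric A g c z) W \<and> (\<forall>v w. ricci_contraction W v w = 0) \<and>
     invariant_tensor (induced_structure A Q c z) W \<and>
     (\<forall>X Y Z. curvature (induced_metric A g c) z X Y Z =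
        reduced_scal (induced_metric A g c) z *\<^sub>R R0 (induced_metric A g c z) \<epsilon>' J' X Y Z + W X Y Z)"
    unfolding Q[OF U]
  proof (rule P.pq_decomposition[OF assms U])
    show "pq_basis \<epsilon>' J'" "endo_span (P.JM z) = endo_span J'" using J' Q[OF U] by auto
    let ?y = "transition c d z"
    have y: "?y \<in> V" by (rule P.f_V[OF U])
    assume "DIM('e) = 4"
    have V: "?y \<in> coords d" "Q d ?y = endo_span (J ?y)" using ad y unfolding adapted_def by blast+
    from dim4[OF \<open>DIM('e) = 4\<close>] d V(1) P.basis[OF y] V(2)
    show "\<exists>W. algebraic_curvature_tensor (g d ?y) W \<and> (\<forall>v w. ricci_contraction W v w = 0) \<and>
      invariant_tensor (endo_span (J ?y)) W \<and>
      (\<forall>X Y Z. curvature (g d) ?y X Y Z = reduced_scal (g d) ?y *\<^sub>R R0 (g d ?y) \<epsilon> (J ?y) X Y Z + W X Y Z)"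
      unfolding pq_curvature_decomposition_def by metis
  qed
qed

end

theorem proposition3p8:
  fixes T S :: "'a topology"
    and A :: "('a, 'e::euclidean_space) chart set"
    and B :: "('a, 'f::euclidean_space) chart set"
    and g :: "('a, 'e) metric"
    and Q :: "('a, 'e) endo_field"
    and n m :: nat
  assumes "DIM('e) = 4 * n" and "DIM('f) = 4 * m"
    and "pq_kaehler_manifold T A g Q"
    and "\<forall>c\<in>A. \<forall>z\<in>coords c. reduced_scal (g c) z \<noteq> 0"
    and "almost_pq_submanifold S B T A Q"
    and "nondegenerate_submanifold B A g"
  shows "totally_geodesic B A g \<and>
         pq_kaehler_manifold S B (induced_metric A g) (induced_structure A Q)"
proof -
  interpret pq_submanifold T S A B g Q
    using assms(3,5,6) by (rule pq_submanifold.intro)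
  show ?thesis
    unfolding pq_kaehler_manifold_def
    using totally_geodesic S_manifold assms(2) induced_pseudo_riemannian induced_neutral induced_almost_pq
      induced_skew induced_parallel induced_decomposition by simp
qed

end
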